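(* Let $n\ge2$ be an integer and let $f^n_{\lambda,\kappa_0}$ be the real analytic $2$-parameter family of $n$-lobed constrained Willmore Hopf tori described in the context. Let $\tilde\Pi$ be the map which assigns to $(\lambda,\kappa_0)$ the conformal class of $f^n_{\lambda,\kappa_0}$. Then for every $b\in\mathbb R_{>1}$ the image of $\tilde\Pi$ contains an open neighborhood, in the moduli space of conformal tori, of the rectangular conformal class $(0,b)$.
   Context: Hopf tori: let $S^2$ be the round $2$-sphere of constant curvature $G=1$. The preimage in $S^3$ under the Hopf fibration of a closed curve $\gamma$ in $S^2$ (the profile curve) is a Hopf torus. If $\gamma$ has length $L$ and oriented enclosed area $A$ (determined modulo $4\pi$, via Gauss–Bonnet, by $\int_\gamma\kappa\,ds$, where $\kappa$ is the geodesic curvature), then the Hopf torus is conformal to $\mathbb C/\Gamma$, with $\Gamma$ generated by $2\pi$ and $\tfrac12(A+iL)$. A torus is constrained Willmore if it is critical for the Willmore energy among immersions inducing the same conformal structure. A Hopf torus is constrained Willmore iff $\gamma$ is constrained elastic, i.e. there are $\mu,\lambda\in\mathbb R$ with $$\kappa''+\tfrac12\kappa^3+(\mu+\tfrac12)\kappa+\lambda=0$$ ($'$ is the derivative with respect to arclength). Let $\kappa(\cdot,\mu,\lambda,\kappa_0)$ be the solution with $\kappa(0)=\kappa_0$, $\kappa'(0)=0$. The curve is called $n$-lobed if it closes after exactly $n$ periods of its curvature with winding number one. The family $f^n_{\lambda,\kappa_0}$: these are the Hopf tori over closed $n$-lobed constrained elastic curves with curvature $\kappa(\cdot,\mu(\lambda,\kappa_0),\lambda,\kappa_0)$,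 where the real analytic function $\mu(\lambda,\kappa_0)$ is determined by the closing condition and continues the value $\mu(0,0)=n^2-\tfrac12$ at the Clifford torus ($\lambda=\kappa_0=0$). One normalizes $\lambda\le0$ (so that constant solutions have curvature $\ge0$), and $\kappa_0$ is the larger of the two real roots of the quartic $P(\kappa)=\tfrac14\kappa^4+(\mu+\tfrac12)\kappa^2+2\lambda\kappa+\nu$ arising in the integrated equation $(\kappa')^2+P(\kappa)=0$ (or the real double root if $\kappa$ is constant). For each $\kappa_0>0$ there is a unique $\lambda=\lambda(\kappa_0)$ for which $f^n_{\lambda(\kappa_0),\kappa_0}$ is a homogenous torus (product of circles), namely the one whose profile curve is a circle of constant curvature $\kappa_0$. Moduli space: conformal structures on tori modulo diffeomorphisms (including orientation reversing ones); the class $(a,b)$ is that of $\mathbb C/(\mathbb Z\oplus(a+ib)\mathbb Z)$. The rectangular classes $(0,b)$ lie on the boundary of this moduli space, and "open neighborhood" is meant relative to the moduli space. *)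

theory Defs
  imports "HOL-Complex_Analysis.Complex_Analysis"
begin

section \<open>The moduli space of conformal tori\<close>

definition upper_half_plane :: "complex set" where
  "upper_half_plane = {\<tau>. Im \<tau> > 0}"

text \<open>The lattice \<open>\<int> \<oplus> \<tau>\<int>\<close>.\<close>

definition torus_lattice :: "complex \<Rightarrow> complex set" where
  "torus_lattice \<tau> = {of_int m + of_int k * \<tau> | m k. True}"

text \<open>
  A (possibly orientation reversing) conformal diffeomorphism \<open>\<complex>/\<Lambda> \<rightarrow> \<complex>/\<Lambda>'\<close>, described by its lift
  to the universal coverings: a holomorphic or antiholomorphic bijection of \<open>\<complex>\<close> that descends
  to a bijection of the quotients.
\<close>

definition conformally_equivalent_tori :: "complex set \<Rightarrow> complex set \<Rightarrow> bool" where
  "conformally_equivalent_tori \<Lambda> \<Lambda>' \<longleftrightarrow>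
     (\<exists>\<phi>. bij \<phi> \<and> (\<phi> holomorphic_on UNIV \<or> (cnj \<circ> \<phi>) holomorphic_on UNIV) \<and>
          (\<forall>z w. z - w \<in> \<Lambda> \<longleftrightarrow> \<phi> z - \<phi> w \<in> \<Lambda>'))"

text \<open>
  A point of the moduli space is represented by the set of all \<open>\<tau>\<close> in the upper half plane whose
  torus \<open>\<complex>/(\<int> \<oplus> \<tau>\<int>)\<close> belongs to it; the class \<open>(a, b)\<close> is \<open>conformal_class (Complex a b)\<close>.
\<close>

definition conformal_class :: "complex \<Rightarrow> complex set" where
  "conformal_class \<tau> =
     {\<tau>' \<in> upper_half_plane. conformally_equivalent_tori (torus_lattice \<tau>) (torus_lattice \<tau>')}"

text \<open>The moduli space carries the quotient topology of the upper half plane.\<close>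

definition moduli_space :: "complex set topology" where
  "moduli_space = topology (\<lambda>V. V \<subseteq> conformal_class ` upper_half_plane \<and>
     open {\<tau> \<in> upper_half_plane. conformal_class \<tau> \<in> V})"

lemma openin_moduli_space:
  "openin moduli_space V \<longleftrightarrow> V \<subseteq> conformal_class ` upper_half_plane \<and>
     open {\<tau> \<in> upper_half_plane. conformal_class \<tau> \<in> V}"
proof -
  have "istopology (\<lambda>V. V \<subseteq> conformal_class ` upper_half_plane \<and>
     open {\<tau> \<in> upper_half_plane. conformal_class \<tau> \<in> V})"
    unfolding istopology_def
  proof (intro conjI allI impI)
    fix S T :: "complex set set"
    assume S: "S \<subseteq> conformal_class ` upper_half_plane \<and>
        open {\<tau> \<in> upper_half_plane. conformal_class \<tau> \<in> S}"
      and T: "T \<subseteq> conformal_class ` upper_half_plane \<and>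
        open {\<tau> \<in> upper_half_plane. conformal_class \<tau> \<in> T}"
    show "S \<inter> T \<subseteq> conformal_class ` upper_half_plane" using S by blast
    have "{\<tau> \<in> upper_half_plane. conformal_class \<tau> \<in> S \<inter> T} =
        {\<tau> \<in> upper_half_plane. conformal_class \<tau> \<in> S} \<inter>
        {\<tau> \<in> upper_half_plane. conformal_class \<tau> \<in> T}" by blast
    then show "open {\<tau> \<in> upper_half_plane. conformal_class \<tau> \<in> S \<inter> T}"
      using S T by (simp add: open_Int)
  next
    fix \<K> :: "complex set set set"
    assume K: "\<forall>K\<in>\<K>. K \<subseteq> conformal_class ` upper_half_plane \<and>
        open {\<tau> \<in> upper_half_plane. conformal_class \<tau> \<in> K}"
    show "\<Union>\<K> \<subseteq> conformal_class ` upper_half_plane" using K by blast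
    have "{\<tau> \<in> upper_half_plane. conformal_class \<tau> \<in> \<Union>\<K>} =
        (\<Union>K\<in>\<K>. {\<tau> \<in> upper_half_plane. conformal_class \<tau> \<in> K})" by blast
    then show "open {\<tau> \<in> upper_half_plane. conformal_class \<tau> \<in> \<Union>\<K>}"
      using K by (simp add: open_UN)
  qed
  then show ?thesis by (simp add: moduli_space_def)
qed


section \<open>Hopf tori\<close>

text \<open>The Hopf fibration \<open>S\<^sup>3 \<rightarrow> S\<^sup>2\<close> onto the sphere of curvature 1.\<close>

definition hopf_map :: "complex \<times> complex \<Rightarrow> real^3" where
  "hopf_map p = (let z = fst p; w = snd p in
     vector [2 * Re (z * cnj w), 2 * Im (z * cnj w), (cmod z)\<^sup>2 - (cmod w)\<^sup>2])"

text \<open>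
  The preimage under the Hopf fibration of a closed curve \<open>\<gamma>\<close> of length \<open>L\<close>, parametrized by
  arclength.  As \<open>\<gamma>\<close> may have self-intersections, this is the total space of the pullback of
  the Hopf fibration to the circle \<open>\<real>/L\<int>\<close>, whose points are written \<open>cis (2 \<pi> s / L)\<close>; its
  immersion into \<open>S\<^sup>3\<close> is \<open>snd\<close>.
\<close>

definition hopf_torus :: "(real \<Rightarrow> real^3) \<Rightarrow> real \<Rightarrow> (complex \<times> (complex \<times> complex)) set" where
  "hopf_torus \<gamma> L = {(cis (2 * pi * s / L), p) | s p. norm p = 1 \<and> hopf_map p = \<gamma> s}"

definition conformal_immersion :: "(complex \<Rightarrow> complex \<times> complex) \<Rightarrow> bool" where
  "conformal_immersion F \<longleftrightarrow>
     (\<exists>Fx Fy. continuous_on UNIV Fx \<and> continuous_on UNIV Fy \<and>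
        (\<forall>z. (F has_derivative (\<lambda>h. Re h *\<^sub>R Fx z + Im h *\<^sub>R Fy z)) (at z) \<and>
             Fx z \<noteq> 0 \<and> norm (Fx z) = norm (Fy z) \<and> Fx z \<bullet> Fy z = 0))"

text \<open>
  The Hopf torus, with the conformal structure induced by its immersion into \<open>S\<^sup>3\<close>, is
  conformally equivalent to \<open>\<complex>/\<Lambda>\<close>.  Here \<open>\<Phi>\<close> is the universal covering \<open>\<complex> \<rightarrow> \<complex>/\<Lambda>\<close> followed by
  the conformal equivalence.
\<close>

definition hopf_torus_conformal_to :: "(real \<Rightarrow> real^3) \<Rightarrow> real \<Rightarrow> complex set \<Rightarrow> bool" where
  "hopf_torus_conformal_to \<gamma> L \<Lambda> \<longleftrightarrow>
     (\<exists>\<Phi>. continuous_on UNIV \<Phi> \<and> range \<Phi> = hopf_torus \<gamma> L \<and>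
          (\<forall>z w. \<Phi> z = \<Phi> w \<longleftrightarrow> z - w \<in> \<Lambda>) \<and> conformal_immersion (snd \<circ> \<Phi>))"


section \<open>Constrained elastic curves in the 2-sphere\<close>

definition spherical_curve_with_curvature :: "(real \<Rightarrow> real^3) \<Rightarrow> (real \<Rightarrow> real) \<Rightarrow> bool" where
  "spherical_curve_with_curvature \<gamma> \<kappa> \<longleftrightarrow>
     (\<forall>s. norm (\<gamma> s) = 1) \<and>
     (\<exists>\<gamma>' \<gamma>''. \<forall>s. (\<gamma> has_vector_derivative \<gamma>' s) (at s) \<and>
                  (\<gamma>' has_vector_derivative \<gamma>'' s) (at s) \<and>
                  norm (\<gamma>' s) = 1 \<and> \<kappa> s = \<gamma>'' s \<bullet> cross3 (\<gamma> s) (\<gamma>' s))"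

text \<open>
  \<open>\<kappa>\<close> is the function \<open>\<kappa>(\<cdot>, \<mu>, lam, \<kappa>\<^sub>0)\<close>; \<open>lam\<close> stands for the Greek letter lambda.
\<close>

definition constrained_elastic_curvature ::
    "real \<Rightarrow> real \<Rightarrow> real \<Rightarrow> (real \<Rightarrow> real) \<Rightarrow> bool" where
  "constrained_elastic_curvature \<mu> lam \<kappa>\<^sub>0 \<kappa> \<longleftrightarrow>
     \<kappa> 0 = \<kappa>\<^sub>0 \<and>
     (\<exists>\<kappa>' \<kappa>''. \<kappa>' 0 = 0 \<and>
        (\<forall>s. (\<kappa> has_real_derivative \<kappa>' s) (at s) \<and> (\<kappa>' has_real_derivative \<kappa>'' s) (at s) \<and>
             \<kappa>'' s + 1/2 * \<kappa> s ^ 3 + (\<mu> + 1/2) * \<kappa> s + lam = 0))"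

text \<open>
  \<open>\<gamma>\<close> closes after exactly \<open>n\<close> periods \<open>T\<close> of its curvature \<open>\<kappa>\<close> with winding number one.  If
  \<open>\<kappa>\<close> is constant, every \<open>T > 0\<close> is admitted as a period, so that \<open>\<gamma>\<close> is a circle of length
  \<open>n * T\<close>.

  The curve is invariant, with shift \<open>T\<close> of the parameter, under a rotation of the sphere.
  The winding number is the one about the axis \<open>\<real>e\<^sub>3\<close> of this rotation, i.e. that of the
  projection of \<open>\<gamma>\<close> to the plane spanned by \<open>e\<^sub>1\<close> and \<open>e\<^sub>2\<close> about the origin.  As the orthonormal
  basis may have either orientation, no direction of rotation is distinguished.
\<close>

definition n_lobed :: "nat \<Rightarrow> (real \<Rightarrow> real^3) \<Rightarrow> (real \<Rightarrow> real) \<Rightarrow> real \<Rightarrow> bool" where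
  "n_lobed n \<gamma> \<kappa> T \<longleftrightarrow>
     T > 0 \<and> (\<forall>s. \<kappa> (s + T) = \<kappa> s) \<and>
     (\<not> \<kappa> constant_on UNIV \<longrightarrow> (\<forall>T'. 0 < T' \<and> T' < T \<longrightarrow> (\<exists>s. \<kappa> (s + T') \<noteq> \<kappa> s))) \<and>
     (\<forall>s. \<gamma> (s + real n * T) = \<gamma> s) \<and>
     (\<forall>j\<in>{1..<n}. \<exists>s. \<gamma> (s + real j * T) \<noteq> \<gamma> s) \<and>
     (\<exists>e\<^sub>1 e\<^sub>2 e\<^sub>3. norm e\<^sub>1 = 1 \<and> norm e\<^sub>2 = 1 \<and> norm e\<^sub>3 = 1 \<and>
        e\<^sub>1 \<bullet> e\<^sub>2 = 0 \<and> e\<^sub>1 \<bullet> e\<^sub>3 = 0 \<and> e\<^sub>2 \<bullet> e\<^sub>3 = 0 \<and>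
        (\<forall>s. \<gamma> (s + T) \<bullet> e\<^sub>3 = \<gamma> s \<bullet> e\<^sub>3) \<and>
        (\<forall>s. Complex (\<gamma> s \<bullet> e\<^sub>1) (\<gamma> s \<bullet> e\<^sub>2) \<noteq> 0) \<and>
        winding_number (\<lambda>t. Complex (\<gamma> (real n * T * t) \<bullet> e\<^sub>1) (\<gamma> (real n * T * t) \<bullet> e\<^sub>2)) 0 = 1)"

definition n_lobed_constrained_elastic ::
    "nat \<Rightarrow> real \<Rightarrow> real \<Rightarrow> real \<Rightarrow> (real \<Rightarrow> real^3) \<Rightarrow> real \<Rightarrow> bool" where
  "n_lobed_constrained_elastic n \<mu> lam \<kappa>\<^sub>0 \<gamma> T \<longleftrightarrow>
     (\<exists>\<kappa>. constrained_elastic_curvature \<mu> lam \<kappa>\<^sub>0 \<kappa> \<and> spherical_curve_with_curvature \<gamma> \<kappa> \<and>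
          n_lobed n \<gamma> \<kappa> T)"


section \<open>The 2-parameter family\<close>

definition real_analytic_on2 :: "(real \<times> real \<Rightarrow> real) \<Rightarrow> (real \<times> real) set \<Rightarrow> bool" where
  "real_analytic_on2 f U \<longleftrightarrow>
     (\<forall>(x\<^sub>0, y\<^sub>0)\<in>U. \<exists>r>0. \<exists>c :: nat \<Rightarrow> nat \<Rightarrow> real. \<forall>x y. \<bar>x\<bar> < r \<and> \<bar>y\<bar> < r \<longrightarrow>
        ((\<lambda>(i, j). c i j * x ^ i * y ^ j) has_sum f (x\<^sub>0 + x, y\<^sub>0 + y)) UNIV)"

text \<open>The quartic \<open>P\<close> with \<open>(\<kappa>')\<^sup>2 + P(\<kappa>) = 0\<close>.\<close>

definition elastic_quartic :: "real \<Rightarrow> real \<Rightarrow> real \<Rightarrow> real poly" where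
  "elastic_quartic \<mu> lam \<nu> = [:\<nu>, 2 * lam, \<mu> + 1/2, 0, 1/4:]"

text \<open>
  \<open>\<kappa>\<^sub>0\<close> is the larger of the two real roots of \<open>P\<close>, or its real double root (\<open>\<kappa>\<^sub>1 = \<kappa>\<^sub>0\<close>).  The
  constant of integration \<open>\<nu>\<close> is determined by \<open>P(\<kappa>\<^sub>0) = 0\<close>.
\<close>

definition larger_real_root :: "real \<Rightarrow> real \<Rightarrow> real \<Rightarrow> bool" where
  "larger_real_root \<mu> lam \<kappa>\<^sub>0 \<longleftrightarrow>
     (\<exists>\<nu> \<kappa>\<^sub>1 q. elastic_quartic \<mu> lam \<nu> = [:- \<kappa>\<^sub>0, 1:] * [:- \<kappa>\<^sub>1, 1:] * q \<and>
        (\<forall>x. poly q x \<noteq> 0) \<and> \<kappa>\<^sub>1 \<le> \<kappa>\<^sub>0)"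

text \<open>The parameters \<open>(lam, \<kappa>\<^sub>0)\<close> in the domain \<open>U\<close> of \<open>\<mu>\<close> that obey the normalization.\<close>

definition family_parameters :: "(real \<times> real) set \<Rightarrow> (real \<times> real \<Rightarrow> real) \<Rightarrow> (real \<times> real) set" where
  "family_parameters U \<mu> =
     {(lam, \<kappa>\<^sub>0). (lam, \<kappa>\<^sub>0) \<in> U \<and> lam \<le> 0 \<and> larger_real_root (\<mu> (lam, \<kappa>\<^sub>0)) lam \<kappa>\<^sub>0}"

text \<open>
  The real analytic family \<open>f\<^sup>n\<close> of Hopf tori over closed \<open>n\<close>-lobed constrained elastic
  curves, given by the real analytic function \<open>\<mu>\<close> solving the closing condition.  The open set
  \<open>U\<close> contains the normalized parameters, some of which (such as those of the homogeneous tori)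
  lie on the boundary of \<open>family_parameters U \<mu>\<close>.  The last condition says that for every
  \<open>\<kappa>\<^sub>0 > 0\<close> there is exactly one member of the family with initial curvature \<open>\<kappa>\<^sub>0\<close> whose
  profile curve is a circle.
\<close>

definition hopf_torus_family :: "nat \<Rightarrow> (real \<times> real) set \<Rightarrow> (real \<times> real \<Rightarrow> real) \<Rightarrow> bool" where
  "hopf_torus_family n U \<mu> \<longleftrightarrow>
     open U \<and> connected U \<and> (0, 0) \<in> U \<and>
     real_analytic_on2 \<mu> U \<and> \<mu> (0, 0) = real n ^ 2 - 1/2 \<and>
     (\<forall>(lam, \<kappa>\<^sub>0)\<in>U. \<exists>\<gamma> T. n_lobed_constrained_elastic n (\<mu> (lam, \<kappa>\<^sub>0)) lam \<kappa>\<^sub>0 \<gamma> T) \<and>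
     (\<forall>\<kappa>\<^sub>0>0. \<exists>!lam. (lam, \<kappa>\<^sub>0) \<in> family_parameters U \<mu> \<and>
        constrained_elastic_curvature (\<mu> (lam, \<kappa>\<^sub>0)) lam \<kappa>\<^sub>0 (\<lambda>_. \<kappa>\<^sub>0))"

text \<open>
  The image of the map that assigns to \<open>(lam, \<kappa>\<^sub>0)\<close> the conformal class of the Hopf torus over the
  corresponding closed curve, which is unique up to rotation and has length \<open>n * T\<close>.
\<close>

definition conformal_classes_of_family ::
    "nat \<Rightarrow> (real \<times> real) set \<Rightarrow> (real \<times> real \<Rightarrow> real) \<Rightarrow> complex set set" where
  "conformal_classes_of_family n U \<mu> =
     {conformal_class \<tau> | \<tau> lam \<kappa>\<^sub>0 \<gamma> T.
        (lam, \<kappa>\<^sub>0) \<in> family_parameters U \<mu> \<and>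
        n_lobed_constrained_elastic n (\<mu> (lam, \<kappa>\<^sub>0)) lam \<kappa>\<^sub>0 \<gamma> T \<and>
        \<tau> \<in> upper_half_plane \<and> hopf_torus_conformal_to \<gamma> (real n * T) (torus_lattice \<tau>)}"

end

theory Submission
  imports Defs
begin

text \<open>
  Write the lattice parameter of the Hopf torus over a curve of length \<open>L\<close> as \<open>\<tau> = 1/2 + (H + \<i> L) / (4 \<pi>)\<close>.
  The homogeneous tori have \<open>H\<^sup>2 + L\<^sup>2 = 4 \<pi>\<^sup>2\<close>, i.e. \<open>\<tau>\<close> lies on the circle \<open>\<bar>\<tau> - 1/2\<bar> = 1/2\<close>, and they realize all
  rectangular classes. For the noncircular members of the family near a homogeneous torus an isoperimetric
  inequality gives \<open>H\<^sup>2 + L\<^sup>2 > 4 \<pi>\<^sup>2\<close>, so \<open>\<tau>\<close> moves strictly to the outside of the circle. The parameters that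
  obey the normalization form one side of the curve of homogeneous tori. On a small rectangle adjacent to this curve the
  map to \<open>(H / L, H\<^sup>2 + L\<^sup>2)\<close> therefore covers a half neighbourhood by the theorem of Poincare and Miranda. The
  inversion in the circle preserves conformal classes up to orientation, so that a half neighbourhood of \<open>\<tau>\<close>
  maps onto a neighbourhood in the moduli space.
\<close>

section \<open>Conformal classes of tori\<close>

text \<open>In terms of the area \<open>A = 2 \<pi> + H\<close> that the horizontal lift picks up,
  H^2 + L^2 >= 4 pi^2 is the isoperimetric inequality L^2 >= A (4 pi - A) of the unit sphere. The
  closing condition is never solved for \<open>\<mu>\<close>: the hypotheses only provide some
  \<open>n\<close>-lobed curve at each parameter, and everything is extracted from such curves. To
  pass to the limit of circles, a curve is described by \<open>(c, e, r)\<close> with curvature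
  \<open>c + e * cos \<phi>\<close>. Length, area and rotation angle are then integrals over the
  fixed phase interval from 0 to 2 pi and stay continuous at \<open>e = 0\<close>, although a
  constant curvature has no period of its own. The obstacle is the behaviour of \<open>e\<close>
  near the homogeneous tori. No derivative of \<open>\<mu>\<close> is known there, so
  \<open>e\<close> might vanish to higher order without changing its sign. Comparing closed curves
  with circles bounds the distance of \<open>lam\<close> from its homogeneous value by
  \<open>K * \<bar>e\<bar>\<close>; this forces a nonzero first derivative and singles out the side
  where \<open>e > 0\<close>.\<close>

lemma torus_lattice_I: "of_int m + of_int k * \<tau> \<in> torus_lattice \<tau>"
  by (auto simp: torus_lattice_def)

lemma torus_lattice_diff: "x \<in> torus_lattice \<tau> \<Longrightarrow> y \<in> torus_lattice \<tau> \<Longrightarrow> x - y \<in> torus_lattice \<tau>"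
proof -
  assume "x \<in> torus_lattice \<tau>" "y \<in> torus_lattice \<tau>"
  then obtain m k m' k' where "x = of_int m + of_int k * \<tau>" "y = of_int m' + of_int k' * \<tau>"
    by (auto simp: torus_lattice_def)
  then have "x - y = of_int (m - m') + of_int (k - k') * \<tau>" by (simp add: algebra_simps)
  then show ?thesis using torus_lattice_I by metis
qed

lemma torus_lattice_cnj: "torus_lattice (cnj \<tau>) = cnj ` torus_lattice \<tau>"
  by (auto simp: torus_lattice_def image_iff) (metis complex_cnj_add complex_cnj_mult complex_cnj_of_int complex_cnj_cnj)+

lemma torus_lattice_discrete:
  assumes "Im \<tau> \<noteq> 0"
  obtains e where "e > 0" "\<And>x y. x \<in> torus_lattice \<tau> \<Longrightarrow> y \<in> torus_lattice \<tau> \<Longrightarrow> x \<noteq> y \<Longrightarrow> e \<le> cmod (x - y)"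
proof
  show "min 1 \<bar>Im \<tau>\<bar> > 0" using assms by simp
  fix x y assume xy: "x \<in> torus_lattice \<tau>" "y \<in> torus_lattice \<tau>" "x \<noteq> y"
  then obtain m k where mk: "x - y = of_int m + of_int k * \<tau>"
    using torus_lattice_diff[OF xy(1,2)] by (auto simp: torus_lattice_def)
  show "min 1 \<bar>Im \<tau>\<bar> \<le> cmod (x - y)"
  proof (cases "k = 0")
    case True
    then have "m \<noteq> 0" using mk xy by auto
    then have "1 \<le> cmod (x - y)" using mk True by (simp add: norm_of_int)
    then show ?thesis by simp
  next
    case False
    have "\<bar>Im \<tau>\<bar> \<le> \<bar>of_int k\<bar> * \<bar>Im \<tau>\<bar>"
      using False mult_right_mono[of 1 "\<bar>of_int k\<bar>" "\<bar>Im \<tau>\<bar>"] by linarith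
    also have "\<dots> = \<bar>Im (x - y)\<bar>" by (simp add: mk abs_mult)
    also have "\<dots> \<le> cmod (x - y)" by (rule abs_Im_le_cmod)
    finally show ?thesis by simp
  qed
qed

text \<open>Orientation preserving equivalence of the two tori; the reversing case is handled by
  conjugating one of the parameters.\<close>

definition similar_lattices :: "complex \<Rightarrow> complex \<Rightarrow> bool" where
  "similar_lattices \<tau> \<tau>' \<longleftrightarrow> (\<exists>\<alpha>. \<alpha> \<noteq> 0 \<and> torus_lattice \<tau>' = (*) \<alpha> ` torus_lattice \<tau>)"

lemma similar_lattices_sym: "similar_lattices \<tau> \<tau>' \<Longrightarrow> similar_lattices \<tau>' \<tau>"
proof -
  assume "similar_lattices \<tau> \<tau>'"
  then obtain \<alpha> where a: "\<alpha> \<noteq> 0" "torus_lattice \<tau>' = (*) \<alpha> ` torus_lattice \<tau>" by (auto simp: similar_lattices_def)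
  have "torus_lattice \<tau> = (*) (inverse \<alpha>) ` torus_lattice \<tau>'"
    using a by (simp add: image_image mult.assoc[symmetric])
  with a show ?thesis unfolding similar_lattices_def by (metis inverse_nonzero_iff_nonzero)
qed

lemma similar_lattices_trans:
  "similar_lattices \<tau> \<tau>' \<Longrightarrow> similar_lattices \<tau>' \<tau>'' \<Longrightarrow> similar_lattices \<tau> \<tau>''"
proof -
  assume "similar_lattices \<tau> \<tau>'" "similar_lattices \<tau>' \<tau>''"
  then obtain \<alpha> \<beta> where a: "\<alpha> \<noteq> 0" "torus_lattice \<tau>' = (*) \<alpha> ` torus_lattice \<tau>"
     "\<beta> \<noteq> 0" "torus_lattice \<tau>'' = (*) \<beta> ` torus_lattice \<tau>'" by (auto simp: similar_lattices_def)
  then have "torus_lattice \<tau>'' = (*) (\<beta> * \<alpha>) ` torus_lattice \<tau>"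
    by (simp add: image_image mult.assoc)
  with a show ?thesis unfolding similar_lattices_def by (metis mult_eq_0_iff)
qed

lemma similar_lattices_cnj: "similar_lattices \<tau> \<tau>' \<Longrightarrow> similar_lattices (cnj \<tau>) (cnj \<tau>')"
proof -
  assume "similar_lattices \<tau> \<tau>'"
  then obtain \<alpha> where a: "\<alpha> \<noteq> 0" "torus_lattice \<tau>' = (*) \<alpha> ` torus_lattice \<tau>" by (auto simp: similar_lattices_def)
  then have "torus_lattice (cnj \<tau>') = (*) (cnj \<alpha>) ` torus_lattice (cnj \<tau>)"
    by (simp add: torus_lattice_cnj image_image)
  with a show ?thesis unfolding similar_lattices_def by (metis complex_cnj_zero_iff)
qed

text \<open>For a lattice vector \<open>l\<close> the continuous function
  \<open>f (z + l) - f z\<close> takes values in a discrete set, so it is constant and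
  \<open>deriv f\<close> is doubly periodic. Such an entire function is bounded by its values on one
  compact parallelogram, and Liouville makes it constant.\<close>

lemma lattice_map_affine:
  assumes hol: "f holomorphic_on UNIV" and inj: "inj f" and im: "Im \<tau> \<noteq> 0" and im': "Im \<tau>' \<noteq> 0"
    and lat: "\<And>z w. z - w \<in> torus_lattice \<tau> \<longleftrightarrow> f z - f w \<in> torus_lattice \<tau>'"
  obtains \<alpha> \<beta> where "\<alpha> \<noteq> 0" "\<And>z. f z = \<alpha> * z + \<beta>"
proof -
  obtain e where e: "e > 0" "\<And>x y. x \<in> torus_lattice \<tau>' \<Longrightarrow> y \<in> torus_lattice \<tau>' \<Longrightarrow> x \<noteq> y \<Longrightarrow> e \<le> cmod (x - y)"
    using torus_lattice_discrete[OF im'] by blast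
  have fd: "(f has_field_derivative deriv f z) (at z)" for z
    using hol holomorphic_derivI[of f UNIV z] by simp
  have cf: "continuous_on UNIV f" using hol by (rule holomorphic_on_imp_continuous_on)
  have per: "deriv f (z + l) = deriv f z" if l: "l \<in> torus_lattice \<tau>" for z l
  proof -
    have mem: "f (z + l) - f z \<in> torus_lattice \<tau>'" for z using lat[of "z + l" z] l by simp
    have "(\<lambda>z. f (z + l) - f z) constant_on UNIV"
    proof (rule continuous_discrete_range_constant)
      show "continuous_on UNIV (\<lambda>z. f (z + l) - f z)"
        by (intro continuous_intros continuous_on_compose2[OF cf]) auto
      show "\<exists>e>0. \<forall>y. y \<in> UNIV \<and> f (y + l) - f y \<noteq> f (x + l) - f x \<longrightarrow>
             e \<le> norm (f (y + l) - f y - (f (x + l) - f x))" for x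
        using e mem by blast
    qed (rule connected_UNIV)
    then obtain c where c: "\<And>z. f (z + l) - f z = c" by (auto simp: constant_on_def)
    have "((\<lambda>z. f (z + l) - f z) has_field_derivative deriv f (z + l) - deriv f z) (at z)"
      by (intro derivative_intros fd[THEN DERIV_shift[THEN iffD1]] fd)
    moreover have "((\<lambda>z. f (z + l) - f z) has_field_derivative 0) (at z)" by (simp add: c)
    ultimately show ?thesis using DERIV_unique by fastforce
  qed
  \<comment> \<open>The closed fundamental parallelogram; taking fractional parts of the coordinates
    with respect to 1 and \<open>\<tau>\<close> moves every point into it.\<close>
  define K where "K = (\<lambda>p. of_real (fst p) + of_real (snd p) * \<tau>) ` (cbox (0,0) (1,1) :: (real \<times> real) set)"
  have "compact K" unfolding K_def
    by (intro compact_continuous_image continuous_intros compact_cbox)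
  moreover have "continuous_on K (deriv f)"
    using holomorphic_on_imp_continuous_on[OF holomorphic_deriv[OF hol open_UNIV]] continuous_on_subset by blast
  ultimately have "bounded (deriv f ` K)"
    using compact_continuous_image compact_imp_bounded by blast
  moreover have "range (deriv f) \<subseteq> deriv f ` K"
  proof
    fix w assume "w \<in> range (deriv f)"
    then obtain z where z: "w = deriv f z" by auto
    define k where "k = \<lfloor>Im z / Im \<tau>\<rfloor>"
    define y where "y = Im z / Im \<tau>"
    define x where "x = Re z - y * Re \<tau>"
    have zz: "z = of_real x + of_real y * \<tau>"
      using im by (auto simp: complex_eq_iff x_def y_def)
    define l where "l = of_int \<lfloor>x\<rfloor> + of_int \<lfloor>y\<rfloor> * \<tau>"
    have "z - l = of_real (frac x) + of_real (frac y) * \<tau>"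
      by (simp add: zz l_def frac_def algebra_simps)
    moreover have "(frac x, frac y) \<in> cbox (0,0) (1,1)"
      by (simp add: frac_ge_0 frac_lt_1 less_imp_le cbox_Pair_eq)
    ultimately have "z - l \<in> K" unfolding K_def by (metis (no_types, lifting) fst_conv image_eqI snd_conv)
    moreover have "deriv f (z - l) = w"
      using per[of l "z - l"] z by (simp add: l_def torus_lattice_I)
    ultimately show "w \<in> deriv f ` K" by blast
  qed
  ultimately have "bounded (range (deriv f))" by (rule bounded_subset)
  then obtain a where a: "\<And>z. deriv f z = a"
    using Liouville_theorem[OF holomorphic_deriv[OF hol open_UNIV]] by (auto simp: constant_on_def)
  have "((\<lambda>z. f z - a * z) has_field_derivative 0) (at z)" for z
    using fd[of z] a by (auto intro!: derivative_eq_intros)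
  then have "\<exists>c. \<forall>z\<in>UNIV. f z - a * z = c"
    using has_field_derivative_zero_constant[of UNIV "\<lambda>z. f z - a * z"] by simp
  then obtain c where c: "\<And>z. f z = a * z + c" by (metis UNIV_I diff_add_cancel add.commute)
  have "a \<noteq> 0" using injD[OF inj, of 0 1] c[of 0] c[of 1] by auto
  with c that show ?thesis by blast
qed

lemma lattice_map_similar:
  assumes hol: "f holomorphic_on UNIV" and bij: "bij f" and im: "Im \<tau> \<noteq> 0" and im': "Im \<tau>' \<noteq> 0"
    and lat: "\<And>z w. z - w \<in> torus_lattice \<tau> \<longleftrightarrow> f z - f w \<in> torus_lattice \<tau>'"
  shows "similar_lattices \<tau> \<tau>'"
proof -
  obtain \<alpha> \<beta> where ab: "\<alpha> \<noteq> 0" "\<And>z. f z = \<alpha> * z + \<beta>"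
    using lattice_map_affine[OF hol bij_is_inj[OF bij] im im' lat] by blast
  have "x \<in> torus_lattice \<tau> \<longleftrightarrow> \<alpha> * x \<in> torus_lattice \<tau>'" for x
    using lat[of x 0] ab by simp
  moreover have "x = \<alpha> * (x / \<alpha>)" for x using ab by simp
  ultimately have "torus_lattice \<tau>' = (*) \<alpha> ` torus_lattice \<tau>"
    by (metis (no_types, lifting) subsetI image_eqI image_subsetI subset_antisym)
  with ab show ?thesis by (auto simp: similar_lattices_def)
qed

lemma bij_cnj: "bij cnj"
  by (rule involuntory_imp_bij) simp

text \<open>An antiholomorphic lift becomes holomorphic after composition with \<open>cnj\<close>,
  at the price of conjugating the target lattice; conjugating the resulting similarity moves the
  conjugate to \<open>\<tau>\<close>.\<close>

lemma conformally_equivalent_tori_iff: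
  assumes im: "Im \<tau> > 0" and im': "Im \<tau>' > 0"
  shows "conformally_equivalent_tori (torus_lattice \<tau>) (torus_lattice \<tau>') \<longleftrightarrow>
    similar_lattices \<tau> \<tau>' \<or> similar_lattices (cnj \<tau>) \<tau>'"
proof
  assume "conformally_equivalent_tori (torus_lattice \<tau>) (torus_lattice \<tau>')"
  then obtain f where f: "bij f" "f holomorphic_on UNIV \<or> (cnj \<circ> f) holomorphic_on UNIV"
      "\<And>z w. z - w \<in> torus_lattice \<tau> \<longleftrightarrow> f z - f w \<in> torus_lattice \<tau>'"
    unfolding conformally_equivalent_tori_def by auto
  from f(2) show "similar_lattices \<tau> \<tau>' \<or> similar_lattices (cnj \<tau>) \<tau>'"
  proof
    assume "f holomorphic_on UNIV"
    then show ?thesis using lattice_map_similar[of f \<tau> \<tau>'] f im im' by auto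
  next
    assume h: "(cnj \<circ> f) holomorphic_on UNIV"
    have "bij (cnj \<circ> f)" using f(1) by (intro bij_comp bij_cnj)
    moreover have "z - w \<in> torus_lattice \<tau> \<longleftrightarrow> (cnj \<circ> f) z - (cnj \<circ> f) w \<in> torus_lattice (cnj \<tau>')" for z w
    proof -
      have "(cnj \<circ> f) z - (cnj \<circ> f) w = cnj (f z - f w)" by simp
      then show ?thesis
        by (simp add: f(3) torus_lattice_cnj inj_image_mem_iff[OF bij_is_inj[OF bij_cnj]] del: complex_cnj_diff)
    qed
    ultimately have "similar_lattices \<tau> (cnj \<tau>')"
      using lattice_map_similar[OF h, of \<tau> "cnj \<tau>'"] im im' by auto
    then show ?thesis using similar_lattices_cnj by fastforce
  qed
next
  have bij: "bij ((*) \<alpha>)" if "\<alpha> \<noteq> 0" for \<alpha> :: complex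
    using that by (intro o_bij[of "(*) (inverse \<alpha>)"]) (auto simp: fun_eq_iff)
  assume "similar_lattices \<tau> \<tau>' \<or> similar_lattices (cnj \<tau>) \<tau>'"
  then show "conformally_equivalent_tori (torus_lattice \<tau>) (torus_lattice \<tau>')"
  proof
    assume "similar_lattices \<tau> \<tau>'"
    then obtain \<alpha> where a: "\<alpha> \<noteq> 0" "torus_lattice \<tau>' = (*) \<alpha> ` torus_lattice \<tau>" by (auto simp: similar_lattices_def)
    show ?thesis unfolding conformally_equivalent_tori_def
    proof (intro exI[of _ "(*) \<alpha>"] conjI disjI1 allI)
      show "(*) \<alpha> holomorphic_on UNIV" by (intro holomorphic_intros)
      show "z - w \<in> torus_lattice \<tau> \<longleftrightarrow> \<alpha> * z - \<alpha> * w \<in> torus_lattice \<tau>'" for z w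
        using a by (simp add: right_diff_distrib[symmetric] image_iff)
    qed (use a bij in auto)
  next
    assume "similar_lattices (cnj \<tau>) \<tau>'"
    then obtain \<alpha> where a: "\<alpha> \<noteq> 0" "torus_lattice \<tau>' = (*) \<alpha> ` cnj ` torus_lattice \<tau>"
      by (auto simp: similar_lattices_def torus_lattice_cnj)
    show ?thesis unfolding conformally_equivalent_tori_def
    proof (intro exI[of _ "(*) \<alpha> \<circ> cnj"] conjI disjI2 allI)
      have "cnj \<circ> ((*) \<alpha> \<circ> cnj) = (*) (cnj \<alpha>)" by (auto simp: fun_eq_iff)
      then show "cnj \<circ> ((*) \<alpha> \<circ> cnj) holomorphic_on UNIV" by (simp add: holomorphic_intros)
      show "bij ((*) \<alpha> \<circ> cnj)" using a bij by (intro bij_comp bij_cnj) auto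
      have "((*) \<alpha> \<circ> cnj) z - ((*) \<alpha> \<circ> cnj) w = \<alpha> * cnj (z - w)" for z w by (simp add: algebra_simps)
      then show "z - w \<in> torus_lattice \<tau> \<longleftrightarrow> ((*) \<alpha> \<circ> cnj) z - ((*) \<alpha> \<circ> cnj) w \<in> torus_lattice \<tau>'" for z w
        using a by (simp add: inj_image_mem_iff[OF bij_is_inj[OF bij]] inj_image_mem_iff[OF bij_is_inj[OF bij_cnj]] del: complex_cnj_diff)
    qed
  qed
qed

lemma conformal_class_eqI:
  assumes im: "Im \<tau> > 0" and im': "Im \<tau>' > 0"
    and sim: "similar_lattices \<tau> \<tau>' \<or> similar_lattices (cnj \<tau>) \<tau>'"
  shows "conformal_class \<tau> = conformal_class \<tau>'"
proof -
  have "similar_lattices \<tau> t \<or> similar_lattices (cnj \<tau>) t \<longleftrightarrow> similar_lattices \<tau>' t \<or> similar_lattices (cnj \<tau>') t" for t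
    using sim by (metis complex_cnj_cnj similar_lattices_cnj similar_lattices_sym similar_lattices_trans)
  then show ?thesis
    using im im' by (auto simp: conformal_class_def conformally_equivalent_tori_iff upper_half_plane_def)
qed

lemma similar_lattices_refl: "similar_lattices \<tau> \<tau>"
  unfolding similar_lattices_def by (intro exI[of _ 1]) (simp add: image_def)

lemma conformal_class_eqD:
  assumes im: "Im \<tau> > 0" and im': "Im \<tau>' > 0" and eq: "conformal_class \<tau> = conformal_class \<tau>'"
  shows "similar_lattices \<tau> \<tau>' \<or> similar_lattices (cnj \<tau>) \<tau>'"
proof -
  have "\<tau>' \<in> conformal_class \<tau>'"
    using im' by (auto simp: conformal_class_def conformally_equivalent_tori_iff upper_half_plane_def similar_lattices_refl)
  then have "\<tau>' \<in> conformal_class \<tau>" using eq by simp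
  then show ?thesis
    using im im' by (simp add: conformal_class_def conformally_equivalent_tori_iff)
qed

text \<open>The equations say that \<open>(p q; r s)\<close> is inverse to
  \<open>(c d; a b)\<close>, so c + d t and a + b t form another basis of the lattice of
  \<open>t\<close>, and dividing by c + d t normalises it. The explicit inverse covers the
  determinants 1 and -1 at once.\<close>

lemma similar_lattices_unimodular:
  fixes a b c d p q r s :: int and t :: complex
  assumes "p * c + q * a = 1" "p * d + q * b = 0" "r * c + s * a = 0" "r * d + s * b = 1"
    and u: "of_int c + of_int d * t \<noteq> 0"
  shows "similar_lattices t ((of_int a + of_int b * t) / (of_int c + of_int d * t))"
proof -
  define u where "u = of_int c + of_int d * t"
  define v where "v = of_int a + of_int b * t"
  have u0: "u \<noteq> 0" using u by (simp add: u_def)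
  have "of_int (p * c + q * a) + of_int (p * d + q * b) * t = of_int p * u + of_int q * v"
     "of_int (r * c + s * a) + of_int (r * d + s * b) * t = of_int r * u + of_int s * v"
    by (simp_all add: u_def v_def algebra_simps)
  then have one: "1 = of_int p * u + of_int q * v" and tt: "t = of_int r * u + of_int s * v"
    using assms(1-4) by simp_all
  have "torus_lattice (v / u) = (*) (inverse u) ` torus_lattice t"
  proof (intro subset_antisym subsetI)
    fix x assume "x \<in> torus_lattice (v / u)"
    then obtain m k where x: "x = of_int m + of_int k * (v / u)" by (auto simp: torus_lattice_def)
    have "of_int m * u + of_int k * v = of_int (m * c + k * a) + of_int (m * d + k * b) * t"
      by (simp add: u_def v_def algebra_simps)
    moreover have "x = inverse u * (of_int m * u + of_int k * v)" using u0 x by (simp add: field_simps)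
    ultimately have "x = inverse u * (of_int (m * c + k * a) + of_int (m * d + k * b) * t)" by metis
    then show "x \<in> (*) (inverse u) ` torus_lattice t" by (rule image_eqI[OF _ torus_lattice_I])
  next
    fix x assume "x \<in> (*) (inverse u) ` torus_lattice t"
    then obtain m k where x: "x = inverse u * (of_int m + of_int k * t)" by (auto simp: torus_lattice_def)
    have "of_int m + of_int k * t = of_int m * 1 + of_int k * t" by simp
    also have "\<dots> = of_int m * (of_int p * u + of_int q * v) + of_int k * (of_int r * u + of_int s * v)"
      using one tt by simp
    also have "\<dots> = of_int (m * p + k * r) * u + of_int (m * q + k * s) * v" by (simp add: algebra_simps)
    finally have "x = of_int (m * p + k * r) + of_int (m * q + k * s) * (v / u)"
      using u0 x by (simp add: field_simps)
    then show "x \<in> torus_lattice (v / u)" using torus_lattice_I by metis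
  qed
  then show ?thesis using u0 unfolding similar_lattices_def u_def v_def
    by (metis inverse_nonzero_iff_nonzero)
qed

section \<open>Openness of the projection onto the moduli space\<close>

lemma int_combination_eq:
  fixes t :: complex
  assumes "Im t \<noteq> 0" "of_int m + of_int k * t = of_int m' + of_int k' * t"
  shows "m = m' \<and> k = k'"
proof -
  have "Im (of_int m + of_int k * t) = Im (of_int m' + of_int k' * t)" using assms by simp
  then have "k = k'" using assms(1) by simp
  then show ?thesis using assms(2) by simp
qed

text \<open>A similarity between \<open>t0\<close> and \<open>\<tau>\<close> amounts to an integer
  matrix with integer inverse. The same matrix acts as a Moebius map on all \<open>t\<close> near
  \<open>t0\<close>, and by continuity its values stay in \<open>N\<close>.\<close>

lemma similar_lattices_nearby:
  assumes im: "Im t0 \<noteq> 0" and sim: "similar_lattices t0 \<tau>" and N: "open N" "\<tau> \<in> N"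
  obtains W where "open W" "t0 \<in> W" "\<And>t. t \<in> W \<Longrightarrow> \<exists>\<tau>'\<in>N. similar_lattices t \<tau>'"
proof -
  obtain \<alpha> where al: "\<alpha> \<noteq> 0" "torus_lattice \<tau> = (*) \<alpha> ` torus_lattice t0"
    using sim by (auto simp: similar_lattices_def)
  have "1 \<in> torus_lattice \<tau>" "\<tau> \<in> torus_lattice \<tau>"
    using torus_lattice_I[of 1 0 \<tau>] torus_lattice_I[of 0 1 \<tau>] by simp_all
  then have "1 \<in> (*) \<alpha> ` torus_lattice t0" "\<tau> \<in> (*) \<alpha> ` torus_lattice t0" using al(2) by simp_all
  then obtain x y where xy: "x \<in> torus_lattice t0" "y \<in> torus_lattice t0" "1 = \<alpha> * x" "\<tau> = \<alpha> * y"
    by blast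
  from xy(1,2) obtain a b c d :: int where "x = of_int c + of_int d * t0" "y = of_int a + of_int b * t0"
    unfolding torus_lattice_def by blast
  with xy have 1: "1 = \<alpha> * (of_int c + of_int d * t0)" and tau: "\<tau> = \<alpha> * (of_int a + of_int b * t0)"
    by simp_all
  have "\<alpha> \<in> torus_lattice \<tau>" "\<alpha> * t0 \<in> torus_lattice \<tau>"
    using torus_lattice_I[of 1 0 t0] torus_lattice_I[of 0 1 t0] unfolding al(2) by auto
  then obtain p q r s :: int where pq: "\<alpha> = of_int p + of_int q * \<tau>"
    and rs: "\<alpha> * t0 = of_int r + of_int s * \<tau>"
    by (auto simp: torus_lattice_def)
  \<comment> \<open>Inserting the expressions of 1 and \<open>\<tau>\<close> into those of
    \<open>\<alpha>\<close> and \<open>\<alpha> * t0\<close> and comparing coefficients of 1 and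
    \<open>t0\<close> shows that the two integer matrices are inverse to each other.\<close>
  have "\<alpha> * 1 = \<alpha> * (of_int (p * c + q * a) + of_int (p * d + q * b) * t0)"
  proof -
    have "\<alpha> = of_int p * 1 + of_int q * \<tau>" using pq by simp
    also have "\<dots> = of_int p * (\<alpha> * (of_int c + of_int d * t0)) + of_int q * (\<alpha> * (of_int a + of_int b * t0))"
      using 1 tau by metis
    finally show ?thesis by (simp add: algebra_simps)
  qed
  then have "of_int 1 + of_int 0 * t0 = of_int (p * c + q * a) + of_int (p * d + q * b) * t0"
    using al(1) by (simp only: mult_cancel_left) simp
  from int_combination_eq[OF im this] have E1: "p * c + q * a = 1" "p * d + q * b = 0" by auto
  have "\<alpha> * t0 = \<alpha> * (of_int (r * c + s * a) + of_int (r * d + s * b) * t0)"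
  proof -
    have "\<alpha> * t0 = of_int r * 1 + of_int s * \<tau>" using rs by simp
    also have "\<dots> = of_int r * (\<alpha> * (of_int c + of_int d * t0)) + of_int s * (\<alpha> * (of_int a + of_int b * t0))"
      using 1 tau by metis
    finally show ?thesis by (simp add: algebra_simps)
  qed
  then have "of_int 0 + of_int 1 * t0 = of_int (r * c + s * a) + of_int (r * d + s * b) * t0"
    using al(1) by (simp only: mult_cancel_left) simp
  from int_combination_eq[OF im this] have E2: "r * c + s * a = 0" "r * d + s * b = 1" by auto
  define g where "g t = (of_int a + of_int b * t) / (of_int c + of_int d * t)" for t :: complex
  define D where "D = {t::complex. of_int c + of_int d * t \<noteq> 0}"
  have oD: "open D" unfolding D_def by (intro open_Collect_neq continuous_intros)
  have t0: "t0 \<in> D" using 1 by (auto simp: D_def)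
  have gt0: "g t0 = \<tau>"
  proof -
    have "of_int c + of_int d * t0 = inverse \<alpha>" using 1 al(1) by (simp add: field_simps)
    then show ?thesis using al(1) by (simp add: g_def tau divide_inverse)
  qed
  have cg: "continuous_on D g" unfolding g_def D_def by (intro continuous_intros) auto
  define W where "W = D \<inter> g -` N"
  have "open W" unfolding W_def using continuous_open_preimage[OF cg oD N(1)] .
  moreover have "t0 \<in> W" using t0 gt0 N by (simp add: W_def)
  moreover have "\<exists>\<tau>'\<in>N. similar_lattices t \<tau>'" if "t \<in> W" for t
    using that similar_lattices_unimodular[OF E1 E2, of t] by (auto simp: W_def D_def g_def)
  ultimately show ?thesis using that by blast
qed

text \<open>The saturation of an open set is open because every similarity, also one with a
  conjugated lattice, extends to all nearby parameters.\<close>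

lemma openin_moduli_space_image:
  assumes N: "open N" "N \<subseteq> upper_half_plane"
  shows "openin moduli_space (conformal_class ` N)"
  unfolding openin_moduli_space
proof
  show "conformal_class ` N \<subseteq> conformal_class ` upper_half_plane" using N by blast
  have op: "open upper_half_plane" unfolding upper_half_plane_def by (simp add: open_halfspace_Im_gt)
  show "open {\<tau> \<in> upper_half_plane. conformal_class \<tau> \<in> conformal_class ` N}"
  proof (subst open_subopen, intro ballI)
    fix \<tau> assume "\<tau> \<in> {\<tau> \<in> upper_half_plane. conformal_class \<tau> \<in> conformal_class ` N}"
    then obtain \<tau>2 where t: "Im \<tau> > 0" "\<tau>2 \<in> N" "Im \<tau>2 > 0" "conformal_class \<tau> = conformal_class \<tau>2"
      using N by (auto simp: upper_half_plane_def)
    from conformal_class_eqD[OF t(1,3,4)]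
    show "\<exists>T. open T \<and> \<tau> \<in> T \<and> T \<subseteq> {\<tau> \<in> upper_half_plane. conformal_class \<tau> \<in> conformal_class ` N}"
    proof
      assume sim: "similar_lattices \<tau> \<tau>2"
      have im: "Im \<tau> \<noteq> 0" using t by simp
      obtain W where W: "open W" "\<tau> \<in> W" "\<And>t. t \<in> W \<Longrightarrow> \<exists>\<tau>'\<in>N. similar_lattices t \<tau>'"
        using similar_lattices_nearby[OF im sim N(1) t(2)] by blast
      have "conformal_class t \<in> conformal_class ` N" if tw: "t \<in> W \<inter> upper_half_plane" for t
        using W(3)[of t] tw N conformal_class_eqI[of t] by (auto simp: upper_half_plane_def image_iff subset_eq)
      then show ?thesis using W t op by (intro exI[of _ "W \<inter> upper_half_plane"]) (auto simp: upper_half_plane_def)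
    next
      assume sim: "similar_lattices (cnj \<tau>) \<tau>2"
      have im: "Im (cnj \<tau>) \<noteq> 0" using t by simp
      obtain W where W: "open W" "cnj \<tau> \<in> W" "\<And>t. t \<in> W \<Longrightarrow> \<exists>\<tau>'\<in>N. similar_lattices t \<tau>'"
        using similar_lattices_nearby[OF im sim N(1) t(2)] by blast
      have "open (cnj -` W)" using W(1) by (intro open_vimage continuous_intros)
      moreover have "conformal_class t \<in> conformal_class ` N" if tw: "t \<in> cnj -` W \<inter> upper_half_plane" for t
        using W(3)[of "cnj t"] tw N conformal_class_eqI[of t] by (auto simp: upper_half_plane_def image_iff subset_eq)
      ultimately show ?thesis using W t op by (intro exI[of _ "cnj -` W \<inter> upper_half_plane"]) (auto simp: upper_half_plane_def)
    qed
  qed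
qed

text \<open>The inversion in the circle \<open>\<bar>\<tau> - 1/2\<bar> = 1/2\<close>, on which the rectangular classes lie here,
  comes from the matrix \<open>(0 1; -1 2)\<close> applied to \<open>cnj \<tau>\<close>, so it does not change the conformal class.\<close>

lemma conformal_class_inversion:
  fixes H L :: real
  assumes L: "L > 0"
  defines "k \<equiv> 4 * pi\<^sup>2 / (H\<^sup>2 + L\<^sup>2)"
  shows "conformal_class (Complex (1/2 + H / (4 * pi)) (L / (4 * pi))) =
         conformal_class (Complex (1/2 + k * H / (4 * pi)) (k * L / (4 * pi)))"
proof -
  define \<tau> where "\<tau> = Complex (1/2 + H / (4 * pi)) (L / (4 * pi))"
  have pos: "H\<^sup>2 + L\<^sup>2 > 0" using L by (simp add: add_nonneg_pos)
  have k: "k > 0" using pos by (simp add: k_def)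
  have eq: "cnj \<tau> / (2 * cnj \<tau> - 1) = Complex (1/2 + k * H / (4 * pi)) (k * L / (4 * pi))"
  proof -
    have n: "2 * cnj \<tau> - 1 = Complex (H / (2 * pi)) (- L / (2 * pi))"
      by (simp add: \<tau>_def complex_eq_iff field_simps)
    have ne: "Complex (H / (2 * pi)) (- L / (2 * pi)) \<noteq> 0" using L by (simp add: complex_eq_iff)
    have kk: "k * H * H + k * L * L = 4 * pi\<^sup>2"
    proof -
      have "k * H * H + k * L * L = k * (H\<^sup>2 + L\<^sup>2)" by (simp add: power2_eq_square algebra_simps)
      then show ?thesis using less_imp_neq[OF pos] by (simp add: k_def)
    qed
    have "(1/2 + k * H / (4 * pi)) * (H / (2 * pi)) + k * L / (4 * pi) * (L / (2 * pi)) =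
        H / (4 * pi) + (k * H * H + k * L * L) / (8 * pi\<^sup>2)"
      by (simp add: field_simps power2_eq_square)
    also have "\<dots> = 1/2 + H / (4 * pi)" unfolding kk by simp
    finally have "Complex (1/2 + k * H / (4 * pi)) (k * L / (4 * pi)) * Complex (H / (2 * pi)) (- L / (2 * pi)) = cnj \<tau>"
      by (simp add: \<tau>_def complex_eq_iff) (simp add: field_simps)
    then show ?thesis unfolding n using ne by (simp add: field_simps)
  qed
  have ne: "of_int (-1) + of_int 2 * cnj \<tau> \<noteq> 0" using L by (simp add: \<tau>_def complex_eq_iff)
  have "similar_lattices (cnj \<tau>) ((of_int 0 + of_int 1 * cnj \<tau>) / (of_int (-1) + of_int 2 * cnj \<tau>))"
    by (rule similar_lattices_unimodular[of "-1" _ 2 _ _ _ 0 1]) (use ne in auto)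
  then have "similar_lattices (cnj \<tau>) (Complex (1/2 + k * H / (4 * pi)) (k * L / (4 * pi)))"
    using eq by simp
  then show ?thesis unfolding \<tau>_def[symmetric]
    using L k by (intro conformal_class_eqI) (auto simp: \<tau>_def)
qed

text \<open>The substitution of t / (1 + t) for t sends i b to a point of the circle on which the
  homogeneous tori lie. The curvature \<open>c\<close> is the solution of b = c + sqrt (1 +
  c^2).\<close>

lemma conformal_class_rectangular:
  fixes b c :: real
  assumes b: "b > 1"
  defines "c \<equiv> (b - 1/b) / 2"
  shows "conformal_class (Complex 0 b) =
     conformal_class (Complex (1/2 + 2 * pi * c / sqrt (1 + c\<^sup>2) / (4 * pi)) (2 * pi / sqrt (1 + c\<^sup>2) / (4 * pi)))"
proof -
  have "1 + c\<^sup>2 = ((b + 1/b) / 2)\<^sup>2" using b by (simp add: c_def power2_eq_square field_simps)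
  then have s: "sqrt (1 + c\<^sup>2) = (b + 1/b) / 2" using b by simp
  have c1: "c / ((b + 1/b) / 2) = (b\<^sup>2 - 1) / (b\<^sup>2 + 1)"
    using b by (simp add: c_def power2_eq_square divide_simps)
  have c2: "1 / ((b + 1/b) / 2) = 2 * b / (b\<^sup>2 + 1)"
    using b by (simp add: power2_eq_square divide_simps)
  have b1: "b\<^sup>2 + 1 > 0" by (simp add: add_nonneg_pos)
  define \<tau> where "\<tau> = Complex (b\<^sup>2 / (b\<^sup>2 + 1)) (b / (b\<^sup>2 + 1))"
  have eq: "Complex (1/2 + 2 * pi * c / sqrt (1 + c\<^sup>2) / (4 * pi)) (2 * pi / sqrt (1 + c\<^sup>2) / (4 * pi)) = \<tau>"
  proof -
    have gen: "2 * pi * x / y / (4 * pi) = x / y / 2" for x y :: real by simp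
    have "1/2 + 2 * pi * c / sqrt (1 + c\<^sup>2) / (4 * pi) = 1/2 + (c / ((b + 1/b) / 2)) / 2"
      unfolding s gen ..
    also have "\<dots> = b\<^sup>2 / (b\<^sup>2 + 1)" unfolding c1 using b1 by (simp add: field_simps)
    finally have 1: "1/2 + 2 * pi * c / sqrt (1 + c\<^sup>2) / (4 * pi) = b\<^sup>2 / (b\<^sup>2 + 1)" .
    have "2 * pi / sqrt (1 + c\<^sup>2) / (4 * pi) = (1 / ((b + 1/b) / 2)) / 2"
      unfolding s using gen[of 1 "(b + 1/b) / 2"] by (simp only: mult_1_right)
    also have "\<dots> = b / (b\<^sup>2 + 1)" unfolding c2 using b1 by (simp only: divide_divide_eq_left mult.commute[of _ 2] mult_divide_mult_cancel_left_if) simp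
    finally show ?thesis using 1 by (simp add: \<tau>_def)
  qed
  have ne: "of_int 1 + of_int 1 * Complex 0 b \<noteq> 0" by (simp add: complex_eq_iff)
  have "\<tau> * (1 + Complex 0 b) = Complex 0 b"
  proof -
    have 1: "b / (b\<^sup>2 + 1) * (b\<^sup>2 + 1) = b" using b1 by simp
    have 2: "b\<^sup>2 / (b\<^sup>2 + 1) = b / (b\<^sup>2 + 1) * b" by (simp add: power2_eq_square)
    show ?thesis unfolding \<tau>_def 2 using 1 by (simp add: complex_eq_iff power2_eq_square distrib_left mult.assoc)
  qed
  then have "\<tau> = (of_int 0 + of_int 1 * Complex 0 b) / (of_int 1 + of_int 1 * Complex 0 b)"
    using ne by (simp add: field_simps)
  moreover have "similar_lattices (Complex 0 b) ((of_int 0 + of_int 1 * Complex 0 b) / (of_int 1 + of_int 1 * Complex 0 b))"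
    by (rule similar_lattices_unimodular[of 1 _ "-1" _ _ _ 0 1]) (use ne in auto)
  ultimately have "similar_lattices (Complex 0 b) \<tau>" by simp
  then show ?thesis unfolding eq using b b1 by (intro conformal_class_eqI) (auto simp: \<tau>_def)
qed

text \<open>Realising the points on and outside the circle suffices: the inversion multiplies
  \<open>(H, L)\<close> by 4 pi^2 / (H^2 + L^2), which keeps \<open>H / L\<close> and exchanges
  inside and outside without changing the class.\<close>

lemma rectangular_class_neighbourhood:
  fixes b c \<xi> a :: real
  assumes b: "b > 1" and \<xi>: "\<xi> > 0" and a: "a > 0"
  defines "c \<equiv> (b - 1/b) / 2"
  assumes X: "\<And>H L. L > 0 \<Longrightarrow> 4 * pi\<^sup>2 \<le> H\<^sup>2 + L\<^sup>2 \<Longrightarrow> H\<^sup>2 + L\<^sup>2 \<le> 4 * pi\<^sup>2 + \<xi> \<Longrightarrow> \<bar>H / L - c\<bar> \<le> a \<Longrightarrow>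
     conformal_class (Complex (1/2 + H / (4 * pi)) (L / (4 * pi))) \<in> X"
  shows "\<exists>V. openin moduli_space V \<and> conformal_class (Complex 0 b) \<in> V \<and> V \<subseteq> X"
proof -
  define h where "h \<tau> = 4 * pi * Re \<tau> - 2 * pi" for \<tau>
  define l where "l \<tau> = 4 * pi * Im \<tau>" for \<tau>
  \<comment> \<open>The lower bound is the image of \<open>4 * pi\<^sup>2 + \<xi>\<close> under the
    inversion, and the sector is invariant under scaling, so \<open>N\<close> is symmetric.\<close>
  define N where "N = {\<tau>. 0 < Im \<tau>} \<inter> {\<tau>. 16 * pi^4 / (4 * pi\<^sup>2 + \<xi>) < (h \<tau>)\<^sup>2 + (l \<tau>)\<^sup>2} \<inter>
     {\<tau>. (h \<tau>)\<^sup>2 + (l \<tau>)\<^sup>2 < 4 * pi\<^sup>2 + \<xi>} \<inter> {\<tau>. \<bar>h \<tau> - c * l \<tau>\<bar> < a * l \<tau>}"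
  have q: "4 * pi\<^sup>2 + \<xi> > 0" using \<xi> by (simp add: add_pos_pos)
  have oN: "open N" unfolding N_def h_def l_def
    by (intro open_Int open_Collect_less continuous_intros)
  have NU: "N \<subseteq> upper_half_plane" by (auto simp: N_def upper_half_plane_def)
  have rep: "\<tau> = Complex (1/2 + h \<tau> / (4 * pi)) (l \<tau> / (4 * pi))" for \<tau>
    by (simp add: h_def l_def complex_eq_iff field_simps)
  have "conformal_class \<tau> \<in> X" if "\<tau> \<in> N" for \<tau>
  proof -
    define H where "H = h \<tau>"
    define L where "L = l \<tau>"
    have L: "L > 0" and R1: "16 * pi^4 / (4 * pi\<^sup>2 + \<xi>) < H\<^sup>2 + L\<^sup>2" and R2: "H\<^sup>2 + L\<^sup>2 < 4 * pi\<^sup>2 + \<xi>"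
      and hl: "\<bar>H - c * L\<bar> < a * L"
      using that by (auto simp: N_def H_def L_def l_def)
    have "H / L - c = (H - c * L) / L" using L by (simp add: field_simps)
    then have "\<bar>H / L - c\<bar> = \<bar>H - c * L\<bar> / L" using L by (simp add: abs_divide)
    then have hl': "\<bar>H / L - c\<bar> \<le> a" using L hl by (simp add: pos_divide_le_eq)
    have \<tau>: "\<tau> = Complex (1/2 + H / (4 * pi)) (L / (4 * pi))" unfolding H_def L_def by (rule rep)
    show ?thesis
    proof (cases "4 * pi\<^sup>2 \<le> H\<^sup>2 + L\<^sup>2")
      case True
      then show ?thesis unfolding \<tau> using X[OF L True] R2 hl' by simp
    next
      case False
      have pos: "H\<^sup>2 + L\<^sup>2 > 0" using L by (simp add: add_nonneg_pos)
      define k where "k = 4 * pi\<^sup>2 / (H\<^sup>2 + L\<^sup>2)"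
      have k: "k > 0" using pos by (simp add: k_def)
      have kk: "(k * H)\<^sup>2 + (k * L)\<^sup>2 = 16 * pi^4 / (H\<^sup>2 + L\<^sup>2)"
      proof -
        have "(k * H)\<^sup>2 + (k * L)\<^sup>2 = k * (k * (H\<^sup>2 + L\<^sup>2))" by (simp add: power2_eq_square algebra_simps)
        also have "k * (H\<^sup>2 + L\<^sup>2) = 4 * pi\<^sup>2" using less_imp_neq[OF pos] by (simp add: k_def)
        finally show ?thesis by (simp add: k_def)
      qed
      have "16 * pi^4 < (4 * pi\<^sup>2 + \<xi>) * (H\<^sup>2 + L\<^sup>2)" using R1 q by (simp add: pos_divide_less_eq mult.commute)
      then have "(k * H)\<^sup>2 + (k * L)\<^sup>2 \<le> 4 * pi\<^sup>2 + \<xi>" unfolding kk using pos by (simp only: pos_divide_le_eq)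
      moreover have "4 * pi\<^sup>2 \<le> (k * H)\<^sup>2 + (k * L)\<^sup>2"
      proof -
        have "4 * pi\<^sup>2 * (H\<^sup>2 + L\<^sup>2) \<le> 4 * pi\<^sup>2 * (4 * pi\<^sup>2)" using False by (intro mult_left_mono) auto
        also have "\<dots> = 16 * pi^4" by simp
        finally show ?thesis unfolding kk using pos by (simp only: pos_le_divide_eq)
      qed
      moreover have "\<bar>(k * H) / (k * L) - c\<bar> \<le> a" using k hl' by simp
      moreover have "k * L > 0" using k L by simp
      ultimately have "conformal_class (Complex (1/2 + k * H / (4 * pi)) (k * L / (4 * pi))) \<in> X"
        by (intro X)
      then show ?thesis unfolding \<tau> k_def using conformal_class_inversion[OF L, of H] by simp
    qed
  qed
  then have sub: "conformal_class ` N \<subseteq> X" by blast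
  define S where "S = sqrt (1 + c\<^sup>2)"
  have S: "S > 0" "S\<^sup>2 = 1 + c\<^sup>2" by (simp_all add: S_def add_pos_nonneg)
  define \<tau>0 where "\<tau>0 = Complex (1/2 + 2 * pi * c / S / (4 * pi)) (2 * pi / S / (4 * pi))"
  have h0: "h \<tau>0 = 2 * pi * c / S" and l0: "l \<tau>0 = 2 * pi / S"
    using S by (simp_all add: h_def l_def \<tau>0_def field_simps)
  have "(h \<tau>0)\<^sup>2 + (l \<tau>0)\<^sup>2 = ((2 * pi * c)\<^sup>2 + (2 * pi)\<^sup>2) / S\<^sup>2"
    unfolding h0 l0 by (simp only: power_divide add_divide_distrib)
  also have "\<dots> = 4 * pi\<^sup>2 * (1 + c\<^sup>2) / S\<^sup>2"
    by (simp add: power_mult_distrib distrib_left)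
  also have "\<dots> = 4 * pi\<^sup>2" unfolding S(2) using S by (metis S(2) nonzero_mult_div_cancel_right less_irrefl zero_less_power)
  finally have r0: "(h \<tau>0)\<^sup>2 + (l \<tau>0)\<^sup>2 = 4 * pi\<^sup>2" .
  have "16 * pi^4 < 4 * pi\<^sup>2 * (4 * pi\<^sup>2 + \<xi>)" using \<xi> by (simp add: distrib_left)
  then have "16 * pi^4 / (4 * pi\<^sup>2 + \<xi>) < 4 * pi\<^sup>2" using q by (simp only: pos_divide_less_eq mult.commute)
  moreover have "\<bar>h \<tau>0 - c * l \<tau>0\<bar> < a * l \<tau>0" unfolding h0 l0 using a S by simp
  moreover have "0 < Im \<tau>0" using S by (simp add: \<tau>0_def)
  ultimately have "\<tau>0 \<in> N" using \<xi> r0 by (simp add: N_def)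
  moreover have "conformal_class (Complex 0 b) = conformal_class \<tau>0"
    unfolding \<tau>0_def S_def c_def by (rule conformal_class_rectangular[OF b])
  ultimately have "conformal_class (Complex 0 b) \<in> conformal_class ` N" by (metis imageI)
  with sub openin_moduli_space_image[OF oN NU] show ?thesis by (intro exI[of _ "conformal_class ` N"]) simp
qed

section \<open>The lattice of a Hopf torus\<close>

lemma inner_mult_left_complex: "(C * u) \<bullet> (C * v) = (cmod C)\<^sup>2 * (u \<bullet> v)" for C u v :: complex
  by (simp add: inner_complex_def cmod_power2) (simp add: power2_eq_square algebra_simps)

lemma cis_eq_iff_ex: "cis x = cis y \<longleftrightarrow> (\<exists>k::int. x = y + 2 * pi * of_int k)"
  using sin_cos_eq_iff[of x y] by (auto simp: complex_eq_iff)

text \<open>Here \<open>(x1, x2, h)\<close> is a point of the curve, \<open>(y1, y2, k)\<close> its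
  velocity, \<open>(p + \<i> q, b)\<close> the section over it, and \<open>\<beta>\<close> the
  derivative of the phase. The conclusions mean speed 1/2 of the lift (the Hopf map doubles
  horizontal lengths), orthogonality to the fibre, and unit norm. After scaling by
  \<open>2 * b\<close> everything is polynomial in \<open>g\<close>, reduced by 2 g (1 - h) =
  1.\<close>

lemma horizontal_lift_identity:
  fixes x1 x2 h y1 y2 k b p q p' q' b' \<beta> D :: real
  assumes "x1\<^sup>2 + x2\<^sup>2 + h\<^sup>2 = 1" "x1 * y1 + x2 * y2 + h * k = 0" "y1\<^sup>2 + y2\<^sup>2 + k\<^sup>2 = 1"
    and b: "b > 0" "h = 1 - 2 * b\<^sup>2" and D: "D = x1 * y2 - x2 * y1"
    and "p = x1 / (2 * b)" "q = x2 / (2 * b)" "b' = - k / (4 * b)" "\<beta> = - D / (4 * b\<^sup>2)"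
    and "p' = y1 / (2 * b) - x1 * b' / (2 * b\<^sup>2)" "q' = y2 / (2 * b) - x2 * b' / (2 * b\<^sup>2)"
  shows "(p' - \<beta> * q)\<^sup>2 + (q' + \<beta> * p)\<^sup>2 + b'\<^sup>2 + (\<beta> * b)\<^sup>2 = 1/4"
    and "p * q' - q * p' + \<beta> * (p\<^sup>2 + q\<^sup>2 + b\<^sup>2) = 0"
    and "p\<^sup>2 + q\<^sup>2 + b\<^sup>2 = 1"
proof -
  define g where "g = 1 / (4 * b\<^sup>2)"
  have gb: "4 * b\<^sup>2 * g = 1" using b by (simp add: g_def)
  have gh: "2 * g * (1 - h) = 1" proof -
    have "2 * g * (1 - h) = 4 * b\<^sup>2 * g" unfolding b(2) by (simp add: algebra_simps)
    then show ?thesis using gb by simp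
  qed
  have gH: "g * (1 - h\<^sup>2) = (1 + h) / 2"
  proof -
    have "g * (1 - h\<^sup>2) = (2 * g * (1 - h)) * (1 + h) / 2" by (simp add: power2_eq_square algebra_simps)
    then show ?thesis unfolding gh by simp
  qed
  have bne: "b \<noteq> 0" using b(1) by simp
  have xx: "x1\<^sup>2 + x2\<^sup>2 = 1 - h\<^sup>2" and yy: "y1\<^sup>2 + y2\<^sup>2 = 1 - k\<^sup>2" and xy: "x1 * y1 + x2 * y2 = - (h * k)"
    using assms(1-3) by linarith+
  have DD: "D\<^sup>2 = 1 - h\<^sup>2 - k\<^sup>2"
  proof -
    have "D\<^sup>2 = (x1\<^sup>2 + x2\<^sup>2) * (y1\<^sup>2 + y2\<^sup>2) - (x1 * y1 + x2 * y2)\<^sup>2"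
      unfolding D by (simp add: power2_eq_square algebra_simps)
    then show ?thesis unfolding xx yy xy by (simp add: power2_eq_square algebra_simps)
  qed
  have kD: "k\<^sup>2 + D\<^sup>2 = 1 - h\<^sup>2" using DD by simp
  have e1: "2 * b * (p' - \<beta> * q) = y1 + x1 * k * g + D * g * x2"
    and e2: "2 * b * (q' + \<beta> * p) = y2 + x2 * k * g - D * g * x1"
    and e3: "2 * b * b' = - k / 2" and e4: "2 * b * (\<beta> * b) = - D / 2"
    using bne by (simp_all add: assms(7-12) g_def field_simps power2_eq_square)
  have "(2 * b)\<^sup>2 * ((p' - \<beta> * q)\<^sup>2 + (q' + \<beta> * p)\<^sup>2 + b'\<^sup>2 + (\<beta> * b)\<^sup>2) =
      (2 * b * (p' - \<beta> * q))\<^sup>2 + (2 * b * (q' + \<beta> * p))\<^sup>2 + (2 * b * b')\<^sup>2 + (2 * b * (\<beta> * b))\<^sup>2"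
    by (simp only: power_mult_distrib[of "2 * b"] distrib_left[of "(2 * b)\<^sup>2"])
  also have "\<dots> = (y1\<^sup>2 + y2\<^sup>2) + 2 * g * k * (x1 * y1 + x2 * y2) - 2 * g * D\<^sup>2
      + g\<^sup>2 * (k\<^sup>2 + D\<^sup>2) * (x1\<^sup>2 + x2\<^sup>2) + (k\<^sup>2 + D\<^sup>2) / 4"
    unfolding e1 e2 e3 e4 unfolding D by (simp add: power2_eq_square field_simps)
  also have "\<dots> = (1 - k\<^sup>2) - 2 * g * k\<^sup>2 * h - 2 * g * (1 - h\<^sup>2 - k\<^sup>2) + (g * (1 - h\<^sup>2))\<^sup>2 + (1 - h\<^sup>2) / 4"
    unfolding xx yy xy kD DD by (simp add: power2_eq_square algebra_simps)
  also have "\<dots> = 1 - k\<^sup>2 + k\<^sup>2 * (2 * g * (1 - h)) - 2 * (g * (1 - h\<^sup>2)) + (g * (1 - h\<^sup>2))\<^sup>2 + (1 - h\<^sup>2) / 4"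
    by (simp add: algebra_simps)
  also have "\<dots> = (1 - h) / 2" unfolding gh gH by (simp add: power2_eq_square field_simps)
  also have "\<dots> = b\<^sup>2" using b(2) by simp
  finally show "(p' - \<beta> * q)\<^sup>2 + (q' + \<beta> * p)\<^sup>2 + b'\<^sup>2 + (\<beta> * b)\<^sup>2 = 1/4"
    using b(1) by (simp add: power_mult_distrib)
  have "p\<^sup>2 = g * x1\<^sup>2" "q\<^sup>2 = g * x2\<^sup>2" unfolding assms(7,8) g_def by (simp_all add: power_divide power_mult_distrib)
  then have "p\<^sup>2 + q\<^sup>2 = g * (x1\<^sup>2 + x2\<^sup>2)" by (simp add: distrib_left)
  also have "\<dots> = 1 - b\<^sup>2" unfolding xx gH using b(2) by simp
  finally show 1: "p\<^sup>2 + q\<^sup>2 + b\<^sup>2 = 1" by simp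
  have "p * q' - q * p' = D * g" unfolding assms(7,8,11,12) g_def D using bne by (simp add: field_simps power2_eq_square)
  moreover have "\<beta> = - (D * g)" unfolding assms(10) g_def by simp
  ultimately show "p * q' - q * p' + \<beta> * (p\<^sup>2 + q\<^sup>2 + b\<^sup>2) = 0" unfolding 1 by simp
qed

text \<open>Away from the pole \<open>e\<^sub>3\<close> the Hopf fibration has the section with positive second component;
  \<open>\<beta>\<close> is the phase that makes the lift of the curve horizontal.\<close>

lemma hopf_torus_lattice:
  fixes \<gamma> \<gamma>' :: "real \<Rightarrow> real^3" and \<beta> :: "real \<Rightarrow> real"
  assumes d: "\<And>s. (\<gamma> has_vector_derivative \<gamma>' s) (at s)" and cont': "continuous_on UNIV \<gamma>'"
    and n: "\<And>s. norm (\<gamma> s) = 1" and n': "\<And>s. norm (\<gamma>' s) = 1"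
    and lt: "\<And>s. \<gamma> s $ 3 < 1" and per: "\<And>s. \<gamma> (s + L) = \<gamma> s" and L: "L > 0"
    and \<beta>: "\<And>s. (\<beta> has_real_derivative
          - (\<gamma> s $ 1 * \<gamma>' s $ 2 - \<gamma> s $ 2 * \<gamma>' s $ 1) / (2 * (1 - \<gamma> s $ 3))) (at s)"
    and \<beta>per: "\<And>s. \<beta> (s + L) = \<beta> s - X"
  shows "hopf_torus_conformal_to \<gamma> L (torus_lattice (Complex (X / (2 * pi)) (L / (4 * pi))))"
proof -
  define b where "b s = sqrt ((1 - \<gamma> s $ 3) / 2)" for s
  define b' where "b' s = - \<gamma>' s $ 3 / (4 * b s)" for s
  define \<beta>' where "\<beta>' s = - (\<gamma> s $ 1 * \<gamma>' s $ 2 - \<gamma> s $ 2 * \<gamma>' s $ 1) / (4 * (b s)\<^sup>2)" for s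
  define zc where "zc s = of_real (\<gamma> s $ 1) + \<i> * of_real (\<gamma> s $ 2)" for s
  define zc' where "zc' s = of_real (\<gamma>' s $ 1) + \<i> * of_real (\<gamma>' s $ 2)" for s
  define a where "a s = zc s / of_real (2 * b s)" for s
  define a' where "a' s = zc' s / of_real (2 * b s) - zc s * of_real (b' s / (2 * (b s)\<^sup>2))" for s
  have b0: "b s > 0" and b2: "(b s)\<^sup>2 = (1 - \<gamma> s $ 3) / 2" for s using lt[of s] by (simp_all add: b_def)
  have dc: "((\<lambda>s. \<gamma> s $ i) has_real_derivative \<gamma>' s $ i) (at s)" for i s
    using bounded_linear.has_vector_derivative[OF bounded_linear_vec_nth d]
    by (simp add: has_real_derivative_iff_has_vector_derivative)
  have db: "(b has_real_derivative b' s) (at s)" for s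
    unfolding b_def b'_def using lt[of s]
    by (auto intro!: derivative_eq_intros dc simp: field_simps)
  have d\<beta>: "(\<beta> has_real_derivative \<beta>' s) (at s)" for s
  proof -
    have "4 * (b s)\<^sup>2 = 2 * (1 - \<gamma> s $ 3)" unfolding b2 by simp
    then show ?thesis using \<beta>[of s] unfolding \<beta>'_def by simp
  qed
  have dz: "(zc has_vector_derivative zc' s) (at s)" for s
    unfolding zc_def zc'_def
    by (intro derivative_intros has_vector_derivative_add has_vector_derivative_mult_right has_vector_derivative_of_real dc)
  have dinv: "((\<lambda>s. of_real (inverse (2 * b s)) :: complex) has_vector_derivative of_real (- b' s / (2 * (b s)\<^sup>2))) (at s)" for s
    using b0[of s] by (intro has_vector_derivative_of_real)
      (auto intro!: derivative_eq_intros db simp: field_simps power2_eq_square)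
  have a_alt: "a = (\<lambda>s. zc s * of_real (inverse (2 * b s)))" by (auto simp: a_def fun_eq_iff field_simps)
  have da: "(a has_vector_derivative a' s) (at s)" for s
    unfolding a_alt using has_vector_derivative_mult[OF dz dinv]
    by (simp add: a'_def field_simps)
  have cg: "continuous_on UNIV \<gamma>" using d by (meson continuous_at_imp_continuous_on has_vector_derivative_continuous)
  have c1: "continuous_on UNIV (\<lambda>s. \<gamma> s $ i)" "continuous_on UNIV (\<lambda>s. \<gamma>' s $ i)" for i
    by (intro continuous_intros cg cont')+
  have cb: "continuous_on UNIV b" unfolding b_def by (intro continuous_intros cg) auto
  have b0': "b s \<noteq> 0" for s using b0[of s] by simp
  have cb': "continuous_on UNIV b'" unfolding b'_def by (intro continuous_intros cont' cb) (auto simp: b0')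
  have c\<beta>': "continuous_on UNIV \<beta>'" unfolding \<beta>'_def by (intro continuous_intros c1 cb) (auto simp: b0')
  have ca: "continuous_on UNIV a" unfolding a_def zc_def by (intro continuous_intros c1 cb) (auto simp: b0')
  have ca': "continuous_on UNIV a'" unfolding a'_def zc_def zc'_def by (intro continuous_intros c1 cb cb') (auto simp: b0')
  have c\<beta>: "continuous_on UNIV \<beta>" using d\<beta> by (meson DERIV_isCont continuous_at_imp_continuous_on)
  have sph: "(\<gamma> s $ 1)\<^sup>2 + (\<gamma> s $ 2)\<^sup>2 + (\<gamma> s $ 3)\<^sup>2 = 1" and sph': "(\<gamma>' s $ 1)\<^sup>2 + (\<gamma>' s $ 2)\<^sup>2 + (\<gamma>' s $ 3)\<^sup>2 = 1" for s
    using n[of s] n'[of s] by (simp_all add: norm_eq_1 inner_vec_def sum_3 power2_eq_square)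
  have orth: "\<gamma> s $ 1 * \<gamma>' s $ 1 + \<gamma> s $ 2 * \<gamma>' s $ 2 + \<gamma> s $ 3 * \<gamma>' s $ 3 = 0" for s
  proof -
    have "((\<lambda>s. (\<gamma> s $ 1)\<^sup>2 + (\<gamma> s $ 2)\<^sup>2 + (\<gamma> s $ 3)\<^sup>2) has_real_derivative
      2 * (\<gamma> s $ 1 * \<gamma>' s $ 1 + \<gamma> s $ 2 * \<gamma>' s $ 2 + \<gamma> s $ 3 * \<gamma>' s $ 3)) (at s)"
      by (auto intro!: derivative_eq_intros dc)
    moreover have "((\<lambda>s. (\<gamma> s $ 1)\<^sup>2 + (\<gamma> s $ 2)\<^sup>2 + (\<gamma> s $ 3)\<^sup>2) has_real_derivative 0) (at s)"
      unfolding sph by simp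
    ultimately show ?thesis using DERIV_unique by fastforce
  qed
  have comp: "Re (a s) = \<gamma> s $ 1 / (2 * b s)" "Im (a s) = \<gamma> s $ 2 / (2 * b s)"
    "Re (a' s) = \<gamma>' s $ 1 / (2 * b s) - \<gamma> s $ 1 * b' s / (2 * (b s)\<^sup>2)"
    "Im (a' s) = \<gamma>' s $ 2 / (2 * b s) - \<gamma> s $ 2 * b' s / (2 * (b s)\<^sup>2)" for s
    unfolding a_def a'_def zc_def zc'_def by (simp_all add: Re_divide_of_real Im_divide_of_real flip: of_real_mult)
  have hb: "\<gamma> s $ 3 = 1 - 2 * (b s)\<^sup>2" for s using b2[of s] by simp
  note key = horizontal_lift_identity[OF sph orth sph' b0 hb refl comp(1,2) b'_def \<beta>'_def comp(3,4)]
  have k1: "(Re (a' s) - \<beta>' s * Im (a s))\<^sup>2 + (Im (a' s) + \<beta>' s * Re (a s))\<^sup>2 + (b' s)\<^sup>2 + (\<beta>' s * b s)\<^sup>2 = 1/4"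
    and k2: "Re (a s) * Im (a' s) - Im (a s) * Re (a' s) + \<beta>' s * ((Re (a s))\<^sup>2 + (Im (a s))\<^sup>2 + (b s)\<^sup>2) = 0"
    and k3: "(Re (a s))\<^sup>2 + (Im (a s))\<^sup>2 + (b s)\<^sup>2 = 1" for s
    by (rule key)+

  \<comment> \<open>The factor 4 pi compensates the speed 1/2 of the horizontal lift against the
    factor 2 pi along the fibre: both partial derivatives get norm 2 pi.\<close>
  define S where "S z = 4 * pi * Im z" for z
  define E where "E z = cis (2 * pi * Re z + \<beta> (S z))" for z
  define F where "F z = (E z * a (S z), E z * of_real (b (S z)))" for z
  \<comment> \<open>The first component records the parameter modulo \<open>L\<close>, so
    self-intersections of the curve identify nothing and the period lattice can be read off.\<close>
  define \<Phi> where "\<Phi> z = (cis (2 * pi * S z / L), F z)" for z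
  define Fx where "Fx z = (E z * (of_real (2 * pi) * (\<i> * a (S z))), E z * (of_real (2 * pi) * (\<i> * of_real (b (S z)))))" for z
  define Fy where "Fy z = (E z * (of_real (4 * pi) * (a' (S z) + \<i> * of_real (\<beta>' (S z)) * a (S z))),
      E z * (of_real (4 * pi) * (of_real (b' (S z)) + \<i> * of_real (\<beta>' (S z)) * of_real (b (S z)))))" for z
  have nE: "cmod (E z) = 1" for z by (simp add: E_def)
  have cS: "continuous_on UNIV S" unfolding S_def by (intro continuous_intros)
  note cc = continuous_on_compose2[OF ca cS] continuous_on_compose2[OF ca' cS] continuous_on_compose2[OF cb cS]
    continuous_on_compose2[OF cb' cS] continuous_on_compose2[OF c\<beta> cS] continuous_on_compose2[OF c\<beta>' cS]
  have cE: "continuous_on UNIV E" unfolding E_def by (intro continuous_intros cc) auto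
  have cF: "continuous_on UNIV F" "continuous_on UNIV Fx" "continuous_on UNIV Fy"
    unfolding F_def Fx_def Fy_def by (intro continuous_intros cc cE; auto)+
  have c\<Phi>: "continuous_on UNIV \<Phi>" unfolding \<Phi>_def by (intro continuous_intros cF cS) (use L in auto)
  have dS: "(S has_derivative (\<lambda>h. 4 * pi * Im h)) (at z)" for z
    unfolding S_def by (intro derivative_intros bounded_linear_imp_has_derivative bounded_linear_Im)
  have compS: "((\<lambda>z. f (S z)) has_derivative (\<lambda>h. (4 * pi * Im h) *\<^sub>R f' (S z))) (at z)"
    if "\<And>s. (f has_vector_derivative f' s) (at s)" for f f' :: "real \<Rightarrow> complex" and z
    using has_derivative_compose[OF dS that[unfolded has_vector_derivative_def]] .
  have dE: "(E has_derivative (\<lambda>h. E z * (\<i> * of_real (2 * pi * Re h + 4 * pi * Im h * \<beta>' (S z))))) (at z)" for z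
  proof -
    have "((\<lambda>z. \<beta> (S z)) has_derivative (\<lambda>h. (4 * pi * Im h) * \<beta>' (S z))) (at z)"
      using has_derivative_compose[OF dS d\<beta>[unfolded has_field_derivative_def]] by (simp add: mult.commute)
    then have "((\<lambda>z. \<i> * of_real (2 * pi * Re z + \<beta> (S z)) :: complex) has_derivative
       (\<lambda>h. \<i> * of_real (2 * pi * Re h + 4 * pi * Im h * \<beta>' (S z)))) (at z)"
      by (intro derivative_intros bounded_linear_imp_has_derivative bounded_linear_Re)
    moreover have "(exp has_derivative (*) (exp w)) (at w)" for w :: complex
      using DERIV_exp[of w] by (simp add: has_field_derivative_def)
    ultimately show ?thesis
      unfolding E_def cis_conv_exp using has_derivative_compose[of _ _ z UNIV exp] by fast
  qed
  have dF: "(F has_derivative (\<lambda>h. Re h *\<^sub>R Fx z + Im h *\<^sub>R Fy z)) (at z)" for z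
  proof -
    have dbc: "((\<lambda>s. of_real (b s) :: complex) has_vector_derivative of_real (b' s)) (at s)" for s
      by (intro has_vector_derivative_of_real db)
    have 1: "((\<lambda>z. E z * a (S z)) has_derivative (\<lambda>h. Re h *\<^sub>R fst (Fx z) + Im h *\<^sub>R fst (Fy z))) (at z)"
      by (rule has_derivative_eq_rhs[OF has_derivative_mult[OF dE compS[OF da]]])
        (auto simp: fun_eq_iff Fx_def Fy_def scaleR_conv_of_real algebra_simps)
    have 2: "((\<lambda>z. E z * of_real (b (S z))) has_derivative (\<lambda>h. Re h *\<^sub>R snd (Fx z) + Im h *\<^sub>R snd (Fy z))) (at z)"
      by (rule has_derivative_eq_rhs[OF has_derivative_mult[OF dE compS[OF dbc]]])
        (auto simp: fun_eq_iff Fx_def Fy_def scaleR_conv_of_real algebra_simps)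
    show ?thesis unfolding F_def
      by (rule has_derivative_eq_rhs[OF has_derivative_Pair[OF 1 2]]) (auto simp: fun_eq_iff prod_eq_iff)
  qed
  have nF: "norm (F z) = 1" for z
    using k3[of "S z"] by (simp add: F_def norm_Pair norm_mult nE cmod_power2)
  have nFx: "norm (Fx z) = 2 * pi" for z
  proof -
    have "(norm (Fx z))\<^sup>2 = (2 * pi)\<^sup>2 * ((Re (a (S z)))\<^sup>2 + (Im (a (S z)))\<^sup>2 + (b (S z))\<^sup>2)"
      by (simp add: Fx_def norm_Pair norm_mult nE cmod_power2 power_mult_distrib algebra_simps)
    then have "(norm (Fx z))\<^sup>2 = (2 * pi)\<^sup>2" unfolding k3 by simp
    then show ?thesis by (rule power2_eq_imp_eq) auto
  qed
  have nP: "(norm (E z * (of_real r * u), E z * (of_real r * v)))\<^sup>2 = r\<^sup>2 * ((cmod u)\<^sup>2 + (cmod v)\<^sup>2)" for z r u v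
    by (simp add: norm_Pair norm_mult nE power_mult_distrib distrib_left)
  have nFy: "norm (Fy z) = 2 * pi" for z
  proof -
    have "(norm (Fy z))\<^sup>2 = (4 * pi)\<^sup>2 * ((cmod (a' (S z) + \<i> * of_real (\<beta>' (S z)) * a (S z)))\<^sup>2 +
       (cmod (of_real (b' (S z)) + \<i> * of_real (\<beta>' (S z)) * of_real (b (S z))))\<^sup>2)"
      unfolding Fy_def by (rule nP)
    also have "\<dots> = (4 * pi)\<^sup>2 * (1/4)"
      unfolding k1[of "S z", symmetric] by (simp add: cmod_power2 algebra_simps)
    also have "\<dots> = (2 * pi)\<^sup>2" by (simp add: power2_eq_square)
    finally show ?thesis by (rule power2_eq_imp_eq) auto
  qed
  have ortho: "Fx z \<bullet> Fy z = 0" for z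
  proof -
    have "Fx z \<bullet> Fy z = 2 * pi * (4 * pi) * (Re (a (S z)) * Im (a' (S z)) - Im (a (S z)) * Re (a' (S z))
        + \<beta>' (S z) * ((Re (a (S z)))\<^sup>2 + (Im (a (S z)))\<^sup>2 + (b (S z))\<^sup>2))"
      by (simp add: Fx_def Fy_def inner_mult_left_complex nE)
        (simp add: inner_complex_def power2_eq_square algebra_simps)
    then show ?thesis unfolding k2 by simp
  qed
  have "conformal_immersion F" unfolding conformal_immersion_def
  proof (rule exI[of _ Fx], rule exI[of _ Fy], intro conjI cF allI dF)
    fix z
    show "Fx z \<noteq> 0" using nFx[of z] by force
    show "norm (Fx z) = norm (Fy z)" by (simp only: nFx nFy)
    show "Fx z \<bullet> Fy z = 0" by (rule ortho)
  qed
  then have ci: "conformal_immersion (snd \<circ> \<Phi>)" by (simp add: \<Phi>_def comp_def)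

  have hopfF: "hopf_map (C * a s, C * of_real (b s)) = \<gamma> s" if "cmod C = 1" for C s
  proof -
    have CC: "C * cnj C = 1" using that by (simp add: complex_norm_square[symmetric])
    have "C * a s * cnj (C * of_real (b s)) = a s * of_real (b s) * (C * cnj C)" by simp
    also have "\<dots> = zc s / 2" using b0'[of s] by (simp add: CC a_def)
    finally have 1: "C * a s * cnj (C * of_real (b s)) = zc s / 2" .
    have 2: "(cmod (C * a s))\<^sup>2 - (cmod (C * of_real (b s)))\<^sup>2 = \<gamma> s $ 3"
      using k3[of s] by (simp add: norm_mult that cmod_power2 hb)
    have "2 * Re (C * a s * cnj (C * of_real (b s))) = \<gamma> s $ 1" "2 * Im (C * a s * cnj (C * of_real (b s))) = \<gamma> s $ 2"
      unfolding 1 by (simp_all add: zc_def)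
    then show ?thesis using 2 by (simp add: hopf_map_def Let_def vec_eq_iff forall_3)
  qed
  have fibre: "\<exists>C. cmod C = 1 \<and> p = (C * a s, C * of_real (b s))" if p: "norm p = 1" "hopf_map p = \<gamma> s" for p s
  proof -
    obtain z w where zw: "p = (z, w)" by (cases p)
    have eqs: "2 * Re (z * cnj w) = \<gamma> s $ 1" "2 * Im (z * cnj w) = \<gamma> s $ 2" "(cmod z)\<^sup>2 - (cmod w)\<^sup>2 = \<gamma> s $ 3"
      using p(2) by (auto simp: zw hopf_map_def Let_def vec_eq_iff forall_3)
    have "(cmod z)\<^sup>2 + (cmod w)\<^sup>2 = 1" using p(1) by (simp add: zw norm_Pair)
    then have "(cmod w)\<^sup>2 = (b s)\<^sup>2" using eqs(3) b2[of s] by simp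
    then have cw: "cmod w = b s" using b0[of s] by (simp add: power2_eq_iff_nonneg)
    have zcw: "z * cnj w = zc s / 2" using eqs by (auto simp: zc_def complex_eq_iff)
    define C where "C = w / of_real (b s)"
    have "cmod C = 1" using cw b0[of s] by (simp add: C_def norm_divide)
    moreover have w: "w = C * of_real (b s)" using b0'[of s] by (simp add: C_def)
    moreover have "z = C * a s"
    proof -
      have "z * (cnj w * w) = zc s / 2 * w" using zcw by (metis mult.assoc)
      moreover have "cnj w * w = of_real ((b s)\<^sup>2)" using cw by (metis complex_norm_square mult.commute)
      ultimately have "z * of_real ((b s)\<^sup>2) = zc s / 2 * w" by metis
      then have "z * of_real ((b s)\<^sup>2) = zc s / 2 * (C * of_real (b s))" using w by metis
      then show ?thesis using b0'[of s] by (simp add: a_def power2_eq_square field_simps)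
    qed
    ultimately show ?thesis using zw by blast
  qed
  have rng: "range \<Phi> = hopf_torus \<gamma> L"
  proof (intro subset_antisym subsetI)
    fix x assume "x \<in> range \<Phi>"
    then obtain z where "x = \<Phi> z" by auto
    then show "x \<in> hopf_torus \<gamma> L"
      using nF[of z] hopfF[OF nE[of z], of "S z"] by (auto simp: hopf_torus_def \<Phi>_def F_def)
  next
    fix x assume "x \<in> hopf_torus \<gamma> L"
    then obtain s p where sp: "x = (cis (2 * pi * s / L), p)" "norm p = 1" "hopf_map p = \<gamma> s"
      by (auto simp: hopf_torus_def)
    obtain C where C: "cmod C = 1" "p = (C * a s, C * of_real (b s))" using fibre sp by blast
    define z where "z = Complex ((Arg C - \<beta> s) / (2 * pi)) (s / (4 * pi))"
    have "S z = s" by (simp add: S_def z_def)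
    moreover have "cis (Arg C) = C" using cis_Arg[of C] C(1) by (cases "C = 0") (auto simp: sgn_div_norm)
    then have "E z = C" unfolding E_def \<open>S z = s\<close> by (simp add: z_def)
    ultimately have "\<Phi> z = x" using sp C by (simp add: \<Phi>_def F_def)
    then show "x \<in> range \<Phi>" by blast
  qed
  have perk: "\<gamma> (s + of_int k * L) = \<gamma> s \<and> \<beta> (s + of_int k * L) = \<beta> s - of_int k * X" for s k
  proof (induction k arbitrary: s rule: int_induct[of _ 0])
    case base show ?case by simp
  next
    case (step1 i)
    have "s + of_int (i + 1) * L = (s + of_int i * L) + L" by (simp add: algebra_simps)
    then show ?case using per[of "s + of_int i * L"] \<beta>per[of "s + of_int i * L"] step1(2)[of s] by (simp add: algebra_simps)
  next
    case (step2 i)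
    have "s + of_int i * L = (s + of_int (i - 1) * L) + L" by (simp add: algebra_simps)
    then show ?case using per[of "s + of_int (i - 1) * L"] \<beta>per[of "s + of_int (i - 1) * L"] step2(2)[of s] by (simp add: algebra_simps)
  qed
  \<comment> \<open>One turn along the base curve lowers the phase by \<open>X\<close>; rotating the
    fibre by \<open>X\<close> compensates this, which is the second generator.\<close>
  define \<tau> where "\<tau> = Complex (X / (2 * pi)) (L / (4 * pi))"
  have inj: "\<Phi> z = \<Phi> w \<longleftrightarrow> z - w \<in> torus_lattice \<tau>" for z w
  proof
    assume eq: "\<Phi> z = \<Phi> w"
    have "cis (2 * pi * S z / L) = cis (2 * pi * S w / L)" using eq by (simp add: \<Phi>_def)
    then obtain k :: int where "2 * pi * S z / L = 2 * pi * S w / L + 2 * pi * of_int k"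
      using cis_eq_iff_ex by blast
    then have "2 * pi * S z = 2 * pi * (S w + of_int k * L)" using L by (simp add: field_simps)
    then have Sz: "S z = S w + of_int k * L" by simp
    have "\<gamma> (S z) = \<gamma> (S w)" using perk Sz by simp
    then have "b (S z) = b (S w)" by (simp add: b_def)
    moreover have "E z * of_real (b (S z)) = E w * of_real (b (S w))" using eq by (simp add: \<Phi>_def F_def)
    ultimately have "E z = E w" using b0'[of "S w"] by simp
    then obtain m :: int where "2 * pi * Re z + \<beta> (S z) = 2 * pi * Re w + \<beta> (S w) + 2 * pi * of_int m"
      unfolding E_def using cis_eq_iff_ex by blast
    moreover have "\<beta> (S z) = \<beta> (S w) - of_int k * X" using perk Sz by simp
    ultimately have "Re z - Re w = of_int m + of_int k * (X / (2 * pi))" by (simp add: field_simps)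
    moreover have "Im z - Im w = of_int k * (L / (4 * pi))" using Sz by (simp add: S_def field_simps)
    ultimately have "z - w = of_int m + of_int k * \<tau>" by (simp add: complex_eq_iff \<tau>_def)
    then show "z - w \<in> torus_lattice \<tau>" by (auto simp: torus_lattice_def)
  next
    assume "z - w \<in> torus_lattice \<tau>"
    then obtain m k where mk: "z - w = of_int m + of_int k * \<tau>" by (auto simp: torus_lattice_def)
    have re: "Re z = Re w + of_int m + of_int k * (X / (2 * pi))" and im: "Im z = Im w + of_int k * (L / (4 * pi))"
      using arg_cong[OF mk, of Re] arg_cong[OF mk, of Im] by (simp_all add: \<tau>_def)
    have Sz: "S z = S w + of_int k * L" by (simp add: S_def im field_simps)
    have g: "\<gamma> (S z) = \<gamma> (S w)" and \<beta>z: "\<beta> (S z) = \<beta> (S w) - of_int k * X" using perk Sz by simp_all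
    have ab: "a (S z) = a (S w)" "b (S z) = b (S w)" using g by (simp_all add: a_def b_def zc_def)
    have "2 * pi * Re z + \<beta> (S z) = 2 * pi * Re w + \<beta> (S w) + 2 * pi * of_int m"
      unfolding re \<beta>z by (simp add: field_simps)
    then have "E z = E w" unfolding E_def using cis_eq_iff_ex by blast
    moreover have "2 * pi * S z / L = 2 * pi * S w / L + 2 * pi * of_int k" using L by (simp add: Sz field_simps)
    then have "cis (2 * pi * S z / L) = cis (2 * pi * S w / L)" using cis_eq_iff_ex by blast
    ultimately show "\<Phi> z = \<Phi> w" by (simp add: \<Phi>_def F_def ab)
  qed
  show ?thesis unfolding hopf_torus_conformal_to_def \<tau>_def[symmetric]
    by (intro exI[of _ \<Phi>] conjI allI c\<Phi> rng inj ci)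
qed

section \<open>Curvature functions\<close>

lemma antiderivative_on_reals:
  fixes g :: "real \<Rightarrow> real"
  assumes "continuous_on UNIV g"
  obtains G where "\<And>x. (G has_real_derivative g x) (at x)" "G 0 = 0"
proof -
  have "\<exists>F. \<forall>x. (- \<infinity> :: ereal) < ereal x \<longrightarrow> ereal x < \<infinity> \<longrightarrow> (F has_vector_derivative g x) (at x)"
    using assms by (intro einterval_antiderivative) (auto simp: continuous_on_eq_continuous_at)
  then obtain F where F: "\<And>x. (F has_vector_derivative g x) (at x)" by auto
  show ?thesis
  proof
    show "((\<lambda>x. F x - F 0) has_real_derivative g x) (at x)" for x
      using F[of x] by (auto intro!: derivative_eq_intros simp: has_real_derivative_iff_has_vector_derivative)
  qed simp
qed

lemma periodic_antiderivative:
  fixes g G :: "real \<Rightarrow> real"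
  assumes G: "\<And>x. (G has_real_derivative g x) (at x)" and per: "\<And>x. g (x + p) = g x" and p: "p \<ge> 0"
  shows "G (x + real k * p) = G x + real k * integral {0..p} g"
proof -
  have "(g has_integral (G p - G 0)) {0..p}"
    using p G by (intro fundamental_theorem_of_calculus)
      (auto simp: has_real_derivative_iff_has_vector_derivative has_vector_derivative_at_within)
  then have I: "integral {0..p} g = G p - G 0" by (rule integral_unique)
  have "((\<lambda>x. G (x + p) - G x) has_real_derivative 0) (at x)" for x
    using G[of x] G[of "x + p"] per[of x] by (auto intro!: derivative_eq_intros simp: DERIV_shift)
  then have step: "G (x + p) - G x = G (0 + p) - G 0" for x
    using DERIV_isconst_all[of "\<lambda>x. G (x + p) - G x" x 0] by blast
  show ?thesis
  proof (induction k)
    case (Suc k)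
    have "G (x + real (Suc k) * p) = G ((x + real k * p) + p)" by (simp add: algebra_simps)
    then show ?case using step[of "x + real k * p"] Suc by (simp add: I algebra_simps)
  qed simp
qed

text \<open>With \<open>\<kappa> = c + e cos \<phi>\<close> the quartic becomes \<open>(\<kappa>')\<^sup>2 = e\<^sup>2 sin\<^sup>2 \<phi> speed\<^sup>2\<close>, i.e.
  \<open>(\<phi>')\<^sup>2 = speed\<^sup>2\<close>; the roots of the quartic are \<open>c \<plusminus> e\<close> and \<open>- c \<plusminus> \<i> sqrt r\<close>.\<close>

definition speed_sq :: "real \<Rightarrow> real \<Rightarrow> real \<Rightarrow> real \<Rightarrow> real" where
  "speed_sq c e r x = ((2 * c + e * cos x)\<^sup>2 + r) / 4"

text \<open>The time in which the phase advances by 2 pi, by substitution in ds = d\<phi> / speed.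
  It keeps its meaning at \<open>e = 0\<close>, where the curvature itself is constant.\<close>

definition curvature_period :: "real \<Rightarrow> real \<Rightarrow> real \<Rightarrow> real" where
  "curvature_period c e r = integral {0..2 * pi} (\<lambda>x. 1 / sqrt (speed_sq c e r x))"

lemma speed_sq_pos: "r > 0 \<Longrightarrow> speed_sq c e r x > 0"
  by (simp add: speed_sq_def add_nonneg_pos)

lemma speed_sq_periodic: "speed_sq c e r (x + 2 * pi) = speed_sq c e r x"
  by (simp add: speed_sq_def)

lemma continuous_on_speed_sq: "continuous_on A (speed_sq c e r)"
  unfolding speed_sq_def by (intro continuous_intros) auto

text \<open>Separation of variables: \<open>\<phi>\<close> is the inverse of an antiderivative
  \<open>G\<close> of 1 / speed, and the shift of \<open>G\<close> over one period of the speed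
  becomes the shift of \<open>\<phi>\<close>.\<close>

lemma phase_function:
  assumes r: "r > 0"
  obtains \<phi> where "\<phi> 0 = 0" "\<And>s. (\<phi> has_real_derivative sqrt (speed_sq c e r (\<phi> s))) (at s)"
    "strict_mono \<phi>" "surj \<phi>" "\<And>s. \<phi> (s + curvature_period c e r) = \<phi> s + 2 * pi"
    "curvature_period c e r > 0"
proof -
  define g where "g x = 1 / sqrt (speed_sq c e r x)" for x
  define T where "T = curvature_period c e r"
  have Tg: "T = integral {0..2 * pi} g" by (simp add: T_def curvature_period_def g_def[abs_def])
  have Q: "speed_sq c e r x > 0" for x using r by (rule speed_sq_pos)
  have g0: "g x > 0" for x using Q[of x] by (simp add: g_def)
  have "continuous_on UNIV g" unfolding g_def
    by (intro continuous_intros continuous_on_speed_sq) (use Q in \<open>auto simp: less_imp_neq[THEN not_sym]\<close>)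
  then obtain G where G: "\<And>x. (G has_real_derivative g x) (at x)" "G 0 = 0"
    using antiderivative_on_reals by blast
  have mono: "strict_mono G"
  proof (rule strict_monoI)
    fix x y :: real assume "x < y"
    then show "G x < G y" by (rule DERIV_pos_imp_increasing) (use G(1) g0 in blast)
  qed
  have gper: "g (x + 2 * pi) = g x" for x by (simp add: g_def speed_sq_periodic)
  have Gk: "G (x + real k * (2 * pi)) = G x + real k * T" for x k
    unfolding Tg by (rule periodic_antiderivative[OF G(1) gper]) simp
  have T0: "T > 0" using strict_monoD[OF mono, of 0 "2 * pi"] Gk[of 0 1] G(2) by simp
  have cG: "continuous_on UNIV G" using G(1) by (meson DERIV_isCont continuous_at_imp_continuous_on)
  have "\<exists>x. G x = y" for y
  proof -
    obtain k :: nat where k: "\<bar>y\<bar> < real k * T" using T0 reals_Archimedean3 by blast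
    have a: "G (real k * (2 * pi)) = real k * T" using Gk[of 0 k] G(2) by simp
    have b: "G (- (real k * (2 * pi))) = - (real k * T)" using Gk[of "- (real k * (2 * pi))" k] G(2) by simp
    have "\<exists>x\<ge>- (real k * (2 * pi)). x \<le> real k * (2 * pi) \<and> G x = y"
      by (rule IVT') (use a b k in \<open>auto intro: continuous_on_subset[OF cG]\<close>)
    then show ?thesis by blast
  qed
  then have surj: "surj G" unfolding surj_def by metis
  have inj: "inj G" using mono by (rule strict_mono_imp_inj_on)
  define \<phi> where "\<phi> = inv G"
  have Gp: "G (\<phi> s) = s" and pG: "\<phi> (G x) = x" for s x
    using surj inj by (simp_all add: \<phi>_def surj_f_inv_f)
  have isC: "isCont \<phi> s" for s
    using isCont_inverse_function[of 1 "\<phi> s" \<phi> G] pG Gp DERIV_isCont[OF G(1)] by simp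
  have d: "(\<phi> has_real_derivative sqrt (speed_sq c e r (\<phi> s))) (at s)" for s
  proof -
    have "(\<phi> has_real_derivative inverse (g (\<phi> s))) (at s)"
      by (rule DERIV_inverse_function[of G _ _ _ "s - 1" "s + 1"]) (use G(1) g0[of "\<phi> s"] Gp isC in auto)
    then show ?thesis by (simp add: g_def)
  qed
  show ?thesis
  proof
    show "\<phi> 0 = 0" using pG[of 0] G(2) by simp
    show "strict_mono \<phi>" by (rule strict_monoI) (metis Gp mono strict_mono_less)
    show "surj \<phi>" by (metis pG surjI)
    show "\<phi> (s + curvature_period c e r) = \<phi> s + 2 * pi" for s
      using Gk[of "\<phi> s" 1] pG[of "\<phi> s + 2 * pi"] by (simp add: Gp T_def)
    show "curvature_period c e r > 0" using T0 by (simp add: T_def)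
  qed (rule d)
qed

text \<open>The damped energy (D^2 + D'^2) exp (- C s) cannot increase: the derivative of the
  undamped energy is 2 D D' (1 + a), at most C (D^2 + D'^2) when \<open>C\<close> bounds
  \<open>\<bar>1 + a\<bar>\<close> on the compact interval.\<close>

lemma linear_ode_zero_forward:
  fixes D D' a :: "real \<Rightarrow> real"
  assumes D: "\<And>s. (D has_real_derivative D' s) (at s)" and D': "\<And>s. (D' has_real_derivative a s * D s) (at s)"
    and a: "continuous_on UNIV a" and init: "D 0 = 0" "D' 0 = 0" and S: "S \<ge> 0"
  shows "D S = 0"
proof -
  have "compact ((\<lambda>s. 1 + a s) ` {0..S})"
    by (intro compact_continuous_image continuous_intros continuous_on_subset[OF a]) auto
  then obtain C where C: "\<And>s. s \<in> {0..S} \<Longrightarrow> \<bar>1 + a s\<bar> \<le> C"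
    using compact_imp_bounded by (force simp: bounded_iff)
  define E where "E s = ((D s)\<^sup>2 + (D' s)\<^sup>2) * exp (- C * s)" for s
  have dE: "(E has_real_derivative (2 * D s * D' s * (1 + a s) - C * ((D s)\<^sup>2 + (D' s)\<^sup>2)) * exp (- C * s)) (at s)" for s
    unfolding E_def by (auto intro!: derivative_eq_intros D D' simp: algebra_simps power2_eq_square)
  have "E S \<le> E 0"
  proof (rule DERIV_nonpos_imp_nonincreasing[OF S])
    fix s assume s: "0 \<le> s" "s \<le> S"
    have "2 * D s * D' s * (1 + a s) \<le> \<bar>2 * D s * D' s\<bar> * \<bar>1 + a s\<bar>"
      by (metis abs_ge_self abs_mult)
    also have "\<dots> \<le> ((D s)\<^sup>2 + (D' s)\<^sup>2) * C"
    proof (rule mult_mono)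
      show "\<bar>2 * D s * D' s\<bar> \<le> (D s)\<^sup>2 + (D' s)\<^sup>2"
        using zero_le_power2[of "D s - D' s"] zero_le_power2[of "D s + D' s"]
        by (simp add: power2_eq_square algebra_simps abs_if)
    qed (use C s in auto)
    finally have "(2 * D s * D' s * (1 + a s) - C * ((D s)\<^sup>2 + (D' s)\<^sup>2)) * exp (- C * s) \<le> 0"
      by (intro mult_nonpos_nonneg) (auto simp: algebra_simps)
    then show "\<exists>y. DERIV E s :> y \<and> y \<le> 0" using dE by blast
  qed
  then have "(D S)\<^sup>2 + (D' S)\<^sup>2 \<le> 0" using init by (simp add: E_def mult_le_0_iff)
  then show ?thesis by (simp add: sum_power2_le_zero_iff)
qed

lemma linear_ode_zero:
  fixes D D' a :: "real \<Rightarrow> real"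
  assumes D: "\<And>s. (D has_real_derivative D' s) (at s)" and D': "\<And>s. (D' has_real_derivative a s * D s) (at s)"
    and a: "continuous_on UNIV a" and init: "D 0 = 0" "D' 0 = 0"
  shows "D s = 0"
proof (cases "s \<ge> 0")
  case True
  then show ?thesis using linear_ode_zero_forward assms by blast
next
  case False
  have ca: "continuous_on UNIV (\<lambda>s. a (- s))"
    by (intro continuous_on_compose2[OF a] continuous_intros) auto
  have 1: "((\<lambda>s. D (- s)) has_real_derivative - D' (- s)) (at s)" for s
    using DERIV_mirror[of D "D' (- s)" s] D by simp
  have 2: "((\<lambda>s. - D' (- s)) has_real_derivative a (- s) * D (- s)) (at s)" for s
    using DERIV_mirror[of D' "a (- s) * D (- s)" s] D'[of "- s"] by (auto intro!: derivative_eq_intros)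
  have "D (- (- s)) = 0"
    using linear_ode_zero_forward[of "\<lambda>s. D (- s)" "\<lambda>s. - D' (- s)" "\<lambda>s. a (- s)" "- s"] 1 2 ca init False by simp
  then show ?thesis by simp
qed

text \<open>The difference of the cubes contains the difference of the solutions as a factor, so the
  latter solves a linear equation with continuous coefficient. This identifies the curvature of a
  family member with the explicit \<open>c + e * cos \<phi>\<close>.\<close>

lemma constrained_elastic_curvature_unique:
  assumes "constrained_elastic_curvature \<mu> lam \<kappa>\<^sub>0 \<kappa>" "constrained_elastic_curvature \<mu> lam \<kappa>\<^sub>0 \<eta>"
  shows "\<kappa> = \<eta>"
proof
  fix s
  obtain \<kappa>' \<kappa>'' where k: "\<kappa> 0 = \<kappa>\<^sub>0" "\<kappa>' 0 = 0" "\<And>s. (\<kappa> has_real_derivative \<kappa>' s) (at s)"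
      "\<And>s. (\<kappa>' has_real_derivative \<kappa>'' s) (at s)" "\<And>s. \<kappa>'' s + 1/2 * \<kappa> s ^ 3 + (\<mu> + 1/2) * \<kappa> s + lam = 0"
    using assms(1) unfolding constrained_elastic_curvature_def by blast
  obtain \<eta>' \<eta>'' where h: "\<eta> 0 = \<kappa>\<^sub>0" "\<eta>' 0 = 0" "\<And>s. (\<eta> has_real_derivative \<eta>' s) (at s)"
      "\<And>s. (\<eta>' has_real_derivative \<eta>'' s) (at s)" "\<And>s. \<eta>'' s + 1/2 * \<eta> s ^ 3 + (\<mu> + 1/2) * \<eta> s + lam = 0"
    using assms(2) unfolding constrained_elastic_curvature_def by blast
  define a where "a s = - ((\<kappa> s)\<^sup>2 + \<kappa> s * \<eta> s + (\<eta> s)\<^sup>2) / 2 - (\<mu> + 1/2)" for s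
  have ck: "continuous_on UNIV \<kappa>" "continuous_on UNIV \<eta>"
    using k(3) h(3) by (meson DERIV_isCont continuous_at_imp_continuous_on)+
  have "continuous_on UNIV a" unfolding a_def by (intro continuous_intros ck) auto
  moreover have "((\<lambda>s. \<kappa> s - \<eta> s) has_real_derivative \<kappa>' s - \<eta>' s) (at s)" for s
    by (intro derivative_intros k h)
  moreover have "((\<lambda>s. \<kappa>' s - \<eta>' s) has_real_derivative a s * (\<kappa> s - \<eta> s)) (at s)" for s
  proof -
    have "\<kappa>'' s - \<eta>'' s = - (\<kappa> s ^ 3 - \<eta> s ^ 3) / 2 - (\<mu> + 1/2) * (\<kappa> s - \<eta> s)"
      using k(5)[of s] h(5)[of s] by (simp add: right_diff_distrib diff_divide_distrib)
    moreover have "\<kappa> s ^ 3 - \<eta> s ^ 3 = ((\<kappa> s)\<^sup>2 + \<kappa> s * \<eta> s + (\<eta> s)\<^sup>2) * (\<kappa> s - \<eta> s)"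
      by (simp add: power2_eq_square power3_eq_cube algebra_simps)
    ultimately have "\<kappa>'' s - \<eta>'' s = a s * (\<kappa> s - \<eta> s)"
      by (simp only: a_def left_diff_distrib)
    then show ?thesis using DERIV_diff[OF k(4)[of s] h(4)[of s]] by simp
  qed
  ultimately have "\<kappa> s - \<eta> s = 0"
    using linear_ode_zero[of "\<lambda>s. \<kappa> s - \<eta> s" "\<lambda>s. \<kappa>' s - \<eta>' s" a s] k(1,2) h(1,2) by simp
  then show "\<kappa> s = \<eta> s" by simp
qed

text \<open>Comparison of coefficients in \<open>P(\<kappa>) = 1/4 ((\<kappa> - c)\<^sup>2 -
  e\<^sup>2) ((\<kappa> + c)\<^sup>2 + r)\<close>: the sum of the four roots vanishes, which fixes
  the real part of the complex pair as \<open>- c\<close>.\<close>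

definition elastic_parameters :: "real \<Rightarrow> real \<Rightarrow> real \<Rightarrow> real \<Rightarrow> real \<Rightarrow> real \<Rightarrow> bool" where
  "elastic_parameters c e r \<mu> lam \<kappa>\<^sub>0 \<longleftrightarrow>
     \<kappa>\<^sub>0 = c + e \<and> lam = - c * (r + e\<^sup>2) / 4 \<and> \<mu> + 1/2 = (r - e\<^sup>2 - 2 * c\<^sup>2) / 4"

lemma phase_curvature:
  assumes r: "r > 0" and par: "elastic_parameters c e r \<mu> lam \<kappa>\<^sub>0"
    and \<phi>: "\<phi> 0 = 0" "\<And>s. (\<phi> has_real_derivative sqrt (speed_sq c e r (\<phi> s))) (at s)"
  shows "constrained_elastic_curvature \<mu> lam \<kappa>\<^sub>0 (\<lambda>s. c + e * cos (\<phi> s))"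
    and "((\<lambda>s. c + e * cos (\<phi> s)) has_real_derivative - e * sin (\<phi> s) * sqrt (speed_sq c e r (\<phi> s))) (at s)"
proof -
  let ?Q = "speed_sq c e r"
  have Q: "?Q x > 0" for x using r by (rule speed_sq_pos)
  show d1: "((\<lambda>s. c + e * cos (\<phi> s)) has_real_derivative - e * sin (\<phi> s) * sqrt (?Q (\<phi> s))) (at s)" for s
    by (auto intro!: derivative_eq_intros \<phi>(2))
  have dQ: "((\<lambda>s. sqrt (?Q (\<phi> s))) has_real_derivative - (2 * c + e * cos (\<phi> s)) * e * sin (\<phi> s) / 4) (at s)" for s
  proof -
    have "(?Q has_real_derivative - (2 * c + e * cos x) * e * sin x / 2) (at x)" for x
      unfolding speed_sq_def by (auto intro!: derivative_eq_intros simp: field_simps)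
    from DERIV_chain2[OF this \<phi>(2)]
    have d: "((\<lambda>s. ?Q (\<phi> s)) has_real_derivative - (2 * c + e * cos (\<phi> s)) * e * sin (\<phi> s) / 2 * sqrt (?Q (\<phi> s))) (at s)" .
    have w: "sqrt (?Q (\<phi> s)) \<noteq> 0" using Q[of "\<phi> s"] by simp
    show ?thesis
      by (rule DERIV_cong[OF DERIV_chain2[OF DERIV_real_sqrt[OF Q] d]]) (use w in \<open>simp add: field_simps\<close>)
  qed
  have d2: "((\<lambda>s. - e * sin (\<phi> s) * sqrt (?Q (\<phi> s))) has_real_derivative
     - e * cos (\<phi> s) * ?Q (\<phi> s) + e\<^sup>2 * (sin (\<phi> s))\<^sup>2 * (2 * c + e * cos (\<phi> s)) / 4) (at s)" for s
  proof -
    have "((\<lambda>s. - e * sin (\<phi> s) * sqrt (?Q (\<phi> s))) has_real_derivative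
       (- e * (cos (\<phi> s) * sqrt (?Q (\<phi> s)))) * sqrt (?Q (\<phi> s))
        + (- (2 * c + e * cos (\<phi> s)) * e * sin (\<phi> s) / 4) * (- e * sin (\<phi> s))) (at s)"
      by (rule DERIV_mult[OF _ dQ]) (auto intro!: derivative_eq_intros \<phi>(2))
    moreover have "sqrt (?Q (\<phi> s)) * sqrt (?Q (\<phi> s)) = ?Q (\<phi> s)" using Q[of "\<phi> s"] by simp
    ultimately show ?thesis by (simp add: power2_eq_square algebra_simps)
  qed
  have lam: "lam = - c * (r + e\<^sup>2) / 4" and mu: "\<mu> + 1/2 = (r - e\<^sup>2 - 2 * c\<^sup>2) / 4" and k0: "\<kappa>\<^sub>0 = c + e"
    using par by (auto simp: elastic_parameters_def)
  have ode: "- e * cos x * ?Q x + e\<^sup>2 * (sin x)\<^sup>2 * (2 * c + e * cos x) / 4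
     + 1/2 * (c + e * cos x) ^ 3 + (\<mu> + 1/2) * (c + e * cos x) + lam = 0" for x
    unfolding speed_sq_def mu lam sin_squared_eq
    by (simp add: power2_eq_square power3_eq_cube field_simps)
  show "constrained_elastic_curvature \<mu> lam \<kappa>\<^sub>0 (\<lambda>s. c + e * cos (\<phi> s))"
    unfolding constrained_elastic_curvature_def
    using d1 d2 ode \<phi>(1) k0
    by (intro conjI exI[of _ "\<lambda>s. - e * sin (\<phi> s) * sqrt (?Q (\<phi> s))"]
       exI[of _ "\<lambda>s. - e * cos (\<phi> s) * ?Q (\<phi> s) + e\<^sup>2 * (sin (\<phi> s))\<^sup>2 * (2 * c + e * cos (\<phi> s)) / 4"] allI) auto
qed

text \<open>Minimality gives one inequality. For the other, a period \<open>P\<close> makes cos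
  (\<phi> P) = 1, so \<open>\<phi> P\<close> is a positive multiple of 2 pi. For
  \<open>e = 0\<close> nothing of this kind holds, which is why circles are treated apart.\<close>

lemma minimal_curvature_period:
  fixes c e T :: real and \<phi> \<kappa> :: "real \<Rightarrow> real"
  assumes e: "e \<noteq> 0" and \<phi>: "\<phi> 0 = 0" "strict_mono \<phi>" "surj \<phi>" "\<And>s. \<phi> (s + T) = \<phi> s + 2 * pi"
    and T: "T > 0" and \<kappa>: "\<And>s. \<kappa> s = c + e * cos (\<phi> s)"
    and P: "P > 0" "\<And>s. \<kappa> (s + P) = \<kappa> s"
      "\<not> \<kappa> constant_on UNIV \<Longrightarrow> \<forall>T'. 0 < T' \<and> T' < P \<longrightarrow> (\<exists>s. \<kappa> (s + T') \<noteq> \<kappa> s)"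
  shows "P = T"
proof -
  have "\<not> \<kappa> constant_on UNIV"
  proof
    assume "\<kappa> constant_on UNIV"
    then obtain d where "\<And>s. \<kappa> s = d" by (auto simp: constant_on_def)
    moreover obtain s where "\<phi> s = pi" using \<phi>(3) by (metis surjD)
    ultimately show False using \<kappa>[of 0] \<kappa>[of s] \<phi>(1) e by simp
  qed
  then have "\<not> T < P" using P(3) T by (auto simp: \<kappa> \<phi>(4))
  moreover have "T \<le> P"
  proof -
    have "cos (\<phi> P) = 1" using P(2)[of 0] e by (simp add: \<kappa> \<phi>(1))
    then obtain k :: int where k: "\<phi> P = of_int k * 2 * pi" using cos_one_2pi_int by auto
    have "0 < \<phi> P" using strict_monoD[OF \<phi>(2) P(1)] \<phi>(1) by simp
    then have "k > 0" using k by (simp add: zero_less_mult_iff)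
    then have "1 * (2 * pi) \<le> of_int k * (2 * pi)" by (intro mult_right_mono) auto
    then have "\<phi> T \<le> \<phi> P" using k \<phi>(4)[of 0] \<phi>(1) by simp
    then show ?thesis using strict_monoD[OF \<phi>(2), of P T] by (cases "T \<le> P") auto
  qed
  ultimately show ?thesis by simp
qed

section \<open>The geometry of a lobed elastic curve\<close>

lemma cross_orthonormal_expand:
  fixes a b x :: "real^3"
  assumes "norm a = 1" "norm b = 1" "a \<bullet> b = 0"
  shows "x = (x \<bullet> a) *\<^sub>R a + (x \<bullet> b) *\<^sub>R b + (x \<bullet> cross3 a b) *\<^sub>R cross3 a b"
proof -
  have aa: "a \<bullet> a = 1" and bb: "b \<bullet> b = 1" using assms by (simp_all add: norm_eq_1)
  have cc: "cross3 a b \<bullet> cross3 a b = 1" using aa bb assms(3) by (simp add: dot_cross inner_commute)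
  define d where "d = x - ((x \<bullet> a) *\<^sub>R a + (x \<bullet> b) *\<^sub>R b + (x \<bullet> cross3 a b) *\<^sub>R cross3 a b)"
  have "d \<bullet> a = 0" "d \<bullet> b = 0" "d \<bullet> cross3 a b = 0"
    using aa bb cc assms(3)
    by (simp_all add: d_def inner_diff_left inner_add_left dot_cross_self inner_commute[of b a])
  moreover from this have "cross3 d (cross3 a b) = 0" by (simp add: Lagrange)
  ultimately have "d = 0 \<or> cross3 a b = 0" using norm_and_cross_eq_0 by blast
  then have "d = 0" using cc by auto
  then show ?thesis by (simp add: d_def)
qed

lemma inner_orthonormal_expand:
  fixes a b x y :: "real^3"
  assumes "norm a = 1" "norm b = 1" "a \<bullet> b = 0"
  shows "x \<bullet> y = (x \<bullet> a) * (y \<bullet> a) + (x \<bullet> b) * (y \<bullet> b) + (x \<bullet> cross3 a b) * (y \<bullet> cross3 a b)"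
  using arg_cong[OF cross_orthonormal_expand[OF assms, of x], of "\<lambda>v. v \<bullet> y"]
  by (simp add: inner_add_left inner_commute[of a y] inner_commute[of b y] inner_commute[of "cross3 a b" y])

text \<open>Differentiating the constant inner products of \<open>\<gamma>\<close> and
  \<open>t\<close> determines two components of the second derivative; the third is the
  curvature.\<close>

lemma spherical_curve_frame:
  assumes "spherical_curve_with_curvature \<gamma> \<kappa>"
  obtains t where "\<And>s. norm (\<gamma> s) = 1" "\<And>s. norm (t s) = 1" "\<And>s. \<gamma> s \<bullet> t s = 0"
    "\<And>s. (\<gamma> has_vector_derivative t s) (at s)"
    "\<And>s. (t has_vector_derivative - \<gamma> s + \<kappa> s *\<^sub>R cross3 (\<gamma> s) (t s)) (at s)"
    "\<And>s. ((\<lambda>s. cross3 (\<gamma> s) (t s)) has_vector_derivative - \<kappa> s *\<^sub>R t s) (at s)"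
proof -
  obtain t t' where g: "\<And>s. norm (\<gamma> s) = 1" and t: "\<And>s. norm (t s) = 1"
    and dg: "\<And>s. (\<gamma> has_vector_derivative t s) (at s)" and dt: "\<And>s. (t has_vector_derivative t' s) (at s)"
    and k: "\<And>s. \<kappa> s = t' s \<bullet> cross3 (\<gamma> s) (t s)"
    using assms unfolding spherical_curve_with_curvature_def by blast
  note di = bounded_bilinear.has_vector_derivative[OF bounded_bilinear_inner]
  have gt: "\<gamma> s \<bullet> t s = 0" for s
  proof -
    have "((\<lambda>s. \<gamma> s \<bullet> \<gamma> s) has_vector_derivative \<gamma> s \<bullet> t s + t s \<bullet> \<gamma> s) (at s)"
      by (rule di[OF dg dg])
    moreover have "(\<lambda>s. \<gamma> s \<bullet> \<gamma> s) = (\<lambda>s. 1)" using g by (simp add: fun_eq_iff norm_eq_1)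
    ultimately have "\<gamma> s \<bullet> t s + t s \<bullet> \<gamma> s = 0"
      using vector_derivative_unique_at[of "\<lambda>s. 1::real"] has_vector_derivative_const by fastforce
    then show ?thesis by (simp add: inner_commute)
  qed
  have tt: "t s \<bullet> t' s = 0" for s
  proof -
    have "((\<lambda>s. t s \<bullet> t s) has_vector_derivative t s \<bullet> t' s + t' s \<bullet> t s) (at s)"
      by (rule di[OF dt dt])
    moreover have "(\<lambda>s. t s \<bullet> t s) = (\<lambda>s. 1)" using t by (simp add: fun_eq_iff norm_eq_1)
    ultimately have "t s \<bullet> t' s + t' s \<bullet> t s = 0"
      using vector_derivative_unique_at[of "\<lambda>s. 1::real"] has_vector_derivative_const by fastforce
    then show ?thesis by (simp add: inner_commute)
  qed
  have gt': "\<gamma> s \<bullet> t' s = - 1" for s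
  proof -
    have "((\<lambda>s. \<gamma> s \<bullet> t s) has_vector_derivative \<gamma> s \<bullet> t' s + t s \<bullet> t s) (at s)"
      by (rule di[OF dg dt])
    moreover have "(\<lambda>s. \<gamma> s \<bullet> t s) = (\<lambda>s. 0)" using gt by (simp add: fun_eq_iff)
    ultimately have "\<gamma> s \<bullet> t' s + t s \<bullet> t s = 0"
      using vector_derivative_unique_at[of "\<lambda>s. 0::real"] has_vector_derivative_const by fastforce
    then show ?thesis using t[of s] by (simp add: norm_eq_1)
  qed
  have t': "t' s = - \<gamma> s + \<kappa> s *\<^sub>R cross3 (\<gamma> s) (t s)" for s
    using cross_orthonormal_expand[OF g[of s] t[of s] gt[of s], of "t' s"] gt'[of s] tt[of s] k[of s]
    by (simp add: inner_commute)
  have bc: "bounded_bilinear cross3" using bilinear_cross bilinear_conv_bounded_bilinear by blast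
  have "((\<lambda>s. cross3 (\<gamma> s) (t s)) has_vector_derivative cross3 (\<gamma> s) (t' s) + cross3 (t s) (t s)) (at s)" for s
    by (rule bounded_bilinear.has_vector_derivative[OF bc dg dt])
  moreover have "cross3 (\<gamma> s) (t' s) + cross3 (t s) (t s) = - \<kappa> s *\<^sub>R t s" for s
    unfolding t' using g[of s] gt[of s]
    by (simp add: Cross3.right_diff_distrib cross_add_right cross_mult_right Lagrange norm_eq_1)
  ultimately show ?thesis using that[OF g t gt dg] dt t' by simp
qed

text \<open>The vector \<open>axis_height \<gamma> + \<kappa>' \<gamma>' - axis_speed (\<gamma> \<times> \<gamma>')\<close>, where \<open>\<kappa>'\<^sup>2 = tangent_sq\<close>, is constant along
  an elastic curve; it spans the axis of the rotation that maps a lobe to the next one.\<close>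

definition axis_height :: "real \<Rightarrow> real \<Rightarrow> real \<Rightarrow> real \<Rightarrow> real" where
  "axis_height c e r x = c + e * cos x - c * (r + e\<^sup>2) / 4"

definition axis_speed :: "real \<Rightarrow> real \<Rightarrow> real \<Rightarrow> real \<Rightarrow> real" where
  "axis_speed c e r x = (r - e\<^sup>2 - 2 * c\<^sup>2) / 4 - 1 + (c + e * cos x)\<^sup>2 / 2"

definition tangent_sq :: "real \<Rightarrow> real \<Rightarrow> real \<Rightarrow> real \<Rightarrow> real" where
  "tangent_sq c e r x = e\<^sup>2 * (sin x)\<^sup>2 * speed_sq c e r x"

definition axis_norm :: "real \<Rightarrow> real \<Rightarrow> real \<Rightarrow> real" where
  "axis_norm c e r = sqrt ((axis_height c e r 0)\<^sup>2 + (axis_speed c e r 0)\<^sup>2)"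

text \<open>The squared length of the constant axis vector. With sin^2 = 1 - cos^2 the left side is
  a polynomial in cos x of which only the constant term survives.\<close>

lemma axis_norm_eq:
  "(axis_height c e r x)\<^sup>2 + tangent_sq c e r x + (axis_speed c e r x)\<^sup>2 = (axis_norm c e r)\<^sup>2"
proof -
  have "(axis_height c e r x)\<^sup>2 + tangent_sq c e r x + (axis_speed c e r x)\<^sup>2
     = (axis_height c e r 0)\<^sup>2 + (axis_speed c e r 0)\<^sup>2"
    unfolding axis_height_def axis_speed_def tangent_sq_def speed_sq_def sin_squared_eq
    by (simp add: power2_eq_square field_simps)
  then show ?thesis by (simp add: axis_norm_def)
qed

text \<open>The hypothesis says that the curve avoids the axis: its left side is the squared
  distance from the axis, scaled by \<open>axis_norm\<close> squared.\<close>

lemma axis_height_less: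
  assumes "tangent_sq c e r x + (axis_speed c e r x)\<^sup>2 > 0"
  shows "\<bar>axis_height c e r x\<bar> < axis_norm c e r"
proof -
  have "\<bar>axis_height c e r x\<bar>\<^sup>2 < (axis_norm c e r)\<^sup>2" using axis_norm_eq[of c e r x] assms by simp
  then show ?thesis by (rule power2_less_imp_less) (simp add: axis_norm_def)
qed

lemma axis_periodic:
  "axis_height c e r (x + 2 * pi) = axis_height c e r x"
  "axis_speed c e r (x + 2 * pi) = axis_speed c e r x"
  "tangent_sq c e r (x + 2 * pi) = tangent_sq c e r x"
  by (simp_all add: axis_height_def axis_speed_def tangent_sq_def speed_sq_def)

text \<open>Angular velocity about the axis per unit of phase: the moment
  \<open>axis_speed / axis_norm\<close> divided by the squared distance from the axis and by the
  speed of the phase.\<close>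

definition angle_density :: "real \<Rightarrow> real \<Rightarrow> real \<Rightarrow> real \<Rightarrow> real" where
  "angle_density c e r x = axis_norm c e r * axis_speed c e r x /
     ((tangent_sq c e r x + (axis_speed c e r x)\<^sup>2) * sqrt (speed_sq c e r x))"

text \<open>Minus twice the rate, per unit of phase, at which the fibre phase of the horizontal lift
  changes once the axis is turned to the third coordinate direction.\<close>

definition phase_density :: "real \<Rightarrow> real \<Rightarrow> real \<Rightarrow> real \<Rightarrow> real" where
  "phase_density c e r x = axis_speed c e r x / ((axis_norm c e r + axis_height c e r x) * sqrt (speed_sq c e r x))"

locale lobed_elastic_curve =
  fixes n :: nat and \<gamma> t :: "real \<Rightarrow> real^3" and \<phi> :: "real \<Rightarrow> real" and c e r :: real
  assumes n2: "n \<ge> 2" and r0: "r > 0" and e0: "e \<noteq> 0" and ec: "\<bar>e\<bar> < c"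
    and \<phi>0: "\<phi> 0 = 0" and d\<phi>: "\<And>s. (\<phi> has_real_derivative sqrt (speed_sq c e r (\<phi> s))) (at s)"
    and surj\<phi>: "surj \<phi>" and per\<phi>: "\<And>s. \<phi> (s + curvature_period c e r) = \<phi> s + 2 * pi"
    and ng: "\<And>s. norm (\<gamma> s) = 1" and nt: "\<And>s. norm (t s) = 1" and gt: "\<And>s. \<gamma> s \<bullet> t s = 0"
    and dg: "\<And>s. (\<gamma> has_vector_derivative t s) (at s)"
    and dt: "\<And>s. (t has_vector_derivative - \<gamma> s + (c + e * cos (\<phi> s)) *\<^sub>R cross3 (\<gamma> s) (t s)) (at s)"
    and dN: "\<And>s. ((\<lambda>s. cross3 (\<gamma> s) (t s)) has_vector_derivative - (c + e * cos (\<phi> s)) *\<^sub>R t s) (at s)"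
    and lobed: "n_lobed n \<gamma> (\<lambda>s. c + e * cos (\<phi> s)) (curvature_period c e r)"
begin

abbreviation "T \<equiv> curvature_period c e r"
abbreviation "\<kappa> s \<equiv> c + e * cos (\<phi> s)"
abbreviation "N s \<equiv> cross3 (\<gamma> s) (t s)"
abbreviation "M \<equiv> axis_height c e r"
abbreviation "P \<equiv> axis_speed c e r"
abbreviation "S \<equiv> tangent_sq c e r"
abbreviation "W \<equiv> axis_norm c e r"
abbreviation "Q \<equiv> speed_sq c e r"
definition "\<kappa>' s = - e * sin (\<phi> s) * sqrt (Q (\<phi> s))"
definition "V s = M (\<phi> s) *\<^sub>R \<gamma> s + \<kappa>' s *\<^sub>R t s - P (\<phi> s) *\<^sub>R N s"

lemma T_pos: "T > 0" and closed: "\<gamma> (s + real n * T) = \<gamma> s"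
  using lobed by (auto simp: n_lobed_def)

lemma Q_pos: "Q x > 0" using r0 by (rule speed_sq_pos)

lemma gg: "\<gamma> s \<bullet> \<gamma> s = 1" and tt: "t s \<bullet> t s = 1" and gN: "\<gamma> s \<bullet> N s = 0" and tN: "t s \<bullet> N s = 0"
  and NN: "N s \<bullet> N s = 1"
  using ng[of s] nt[of s] gt[of s] by (simp_all add: norm_eq_1 dot_cross_self dot_cross inner_commute)

lemma \<kappa>_pos: "\<kappa> s > 0"
proof -
  have "\<bar>e * cos (\<phi> s)\<bar> \<le> \<bar>e\<bar>" using abs_cos_le_one mult_left_le by (simp add: abs_mult mult_left_le)
  then show ?thesis using ec by linarith
qed

lemma \<kappa>'_sq: "(\<kappa>' s)\<^sup>2 = S (\<phi> s)"
  using Q_pos[of "\<phi> s"] by (simp add: \<kappa>'_def tangent_sq_def power_mult_distrib)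

lemma d_inner: "((\<lambda>s. f s \<bullet> v) has_real_derivative f' \<bullet> v) (at s)"
  if "(f has_vector_derivative f') (at s)" for f :: "real \<Rightarrow> real^3"
  using bounded_linear.has_vector_derivative[OF bounded_linear_inner_left that]
  by (simp add: has_real_derivative_iff_has_vector_derivative)

text \<open>By the frame equations the derivative of \<open>V\<close> is a multiple of
  \<open>t\<close>, and the factor is the left side of the elastic equation.\<close>

lemma V_const: "V s = V 0"
proof -
  have par: "elastic_parameters c e r ((r - e\<^sup>2 - 2 * c\<^sup>2) / 4 - 1/2) (- c * (r + e\<^sup>2) / 4) (c + e)"
    by (simp add: elastic_parameters_def)
  note pc = phase_curvature[OF r0 par \<phi>0 d\<phi>]
  have d\<kappa>: "(\<kappa> has_real_derivative \<kappa>' s) (at s)" for s using pc(2)[of s] by (simp add: \<kappa>'_def)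
  obtain k1 k2 where k: "\<And>s. (\<kappa> has_real_derivative k1 s) (at s)" "\<And>s. (k1 has_real_derivative k2 s) (at s)"
     "\<And>s. k2 s + 1/2 * \<kappa> s ^ 3 + (((r - e\<^sup>2 - 2 * c\<^sup>2) / 4 - 1/2) + 1/2) * \<kappa> s + (- c * (r + e\<^sup>2) / 4) = 0"
    using pc(1) unfolding constrained_elastic_curvature_def by blast
  have "k1 = \<kappa>'" using k(1) d\<kappa> DERIV_unique by blast
  then have d\<kappa>': "(\<kappa>' has_real_derivative k2 s) (at s)" for s using k(2) by simp
  have dM: "((\<lambda>s. M (\<phi> s)) has_real_derivative \<kappa>' s) (at s)" for s
    unfolding axis_height_def by (rule DERIV_cong[OF DERIV_diff[OF d\<kappa> DERIV_const]]) simp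
  have dP: "((\<lambda>s. P (\<phi> s)) has_real_derivative \<kappa> s * \<kappa>' s) (at s)" for s
    unfolding axis_speed_def
    by (rule DERIV_cong[OF DERIV_add[OF DERIV_const DERIV_cdivide[OF DERIV_power[OF d\<kappa>, of 2]]]]) simp
  have ode: "M (\<phi> s) + k2 s + P (\<phi> s) * \<kappa> s = 0" for s
  proof -
    define K where "K = \<kappa> s"
    define A where "A = (r - e\<^sup>2 - 2 * c\<^sup>2) / 4"
    define L where "L = - c * (r + e\<^sup>2) / 4"
    have "k2 s + 1/2 * K ^ 3 + ((A - 1/2) + 1/2) * K + L = 0"
      using k(3)[of s] unfolding K_def A_def L_def .
    moreover have M: "M (\<phi> s) = K + L" and P: "P (\<phi> s) = A - 1 + K\<^sup>2 / 2"
      by (simp_all add: axis_height_def axis_speed_def K_def A_def L_def)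
    moreover have "P (\<phi> s) * K = A * K - K + K ^ 3 / 2"
      unfolding P by (simp add: power2_eq_square power3_eq_cube algebra_simps)
    ultimately show ?thesis unfolding K_def[symmetric] by simp
  qed
  have gen: "(m *\<^sub>R u + k *\<^sub>R g) + (k *\<^sub>R (- g + K *\<^sub>R v) + k2 *\<^sub>R u) - (p *\<^sub>R (- K *\<^sub>R u) + (K * k) *\<^sub>R v)
      = (m + k2 + p * K) *\<^sub>R u" for m k k2 p K :: real and g u v :: "real^3"
    by (simp add: algebra_simps)
  have "(V has_vector_derivative 0) (at s)" for s
  proof -
    have "(V has_vector_derivative
       (M (\<phi> s) *\<^sub>R t s + \<kappa>' s *\<^sub>R \<gamma> s) + (\<kappa>' s *\<^sub>R (- \<gamma> s + \<kappa> s *\<^sub>R N s) + k2 s *\<^sub>R t s)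
       - (P (\<phi> s) *\<^sub>R (- \<kappa> s *\<^sub>R t s) + (\<kappa> s * \<kappa>' s) *\<^sub>R N s)) (at s)"
      unfolding V_def[abs_def]
      by (intro has_vector_derivative_add has_vector_derivative_diff has_vector_derivative_scaleR dM dP d\<kappa>' dg dt dN)
    moreover have "(M (\<phi> s) *\<^sub>R t s + \<kappa>' s *\<^sub>R \<gamma> s) + (\<kappa>' s *\<^sub>R (- \<gamma> s + \<kappa> s *\<^sub>R N s) + k2 s *\<^sub>R t s)
       - (P (\<phi> s) *\<^sub>R (- \<kappa> s *\<^sub>R t s) + (\<kappa> s * \<kappa>' s) *\<^sub>R N s) = (M (\<phi> s) + k2 s + P (\<phi> s) * \<kappa> s) *\<^sub>R t s"
      by (rule gen)
    ultimately show ?thesis by (simp only: ode scaleR_zero_left)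
  qed
  then obtain v where "\<And>s. V s = v"
    using has_vector_derivative_zero_constant[of UNIV V] by auto
  then show ?thesis by simp
qed

lemma V_inner: "V 0 \<bullet> \<gamma> s = M (\<phi> s)" "V 0 \<bullet> t s = \<kappa>' s" "V 0 \<bullet> N s = - P (\<phi> s)"
proof -
  have "V s \<bullet> \<gamma> s = M (\<phi> s)" "V s \<bullet> t s = \<kappa>' s" "V s \<bullet> N s = - P (\<phi> s)"
    unfolding V_def by (simp_all add: inner_diff_left inner_add_left gg tt NN gt gN tN inner_commute[of "t s" "\<gamma> s"]
       inner_commute[of "N s" "\<gamma> s"] inner_commute[of "N s" "t s"])
  then show "V 0 \<bullet> \<gamma> s = M (\<phi> s)" "V 0 \<bullet> t s = \<kappa>' s" "V 0 \<bullet> N s = - P (\<phi> s)"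
    using V_const[of s] by simp_all
qed

lemma V_norm: "V 0 \<bullet> V 0 = W\<^sup>2"
  using inner_orthonormal_expand[OF ng[of 0] nt[of 0] gt[of 0], of "V 0" "V 0"]
    axis_norm_eq[of c e r "\<phi> 0"]
  by (simp add: V_inner \<kappa>'_sq[symmetric] power2_eq_square)

text \<open>If the axis vector were zero, \<open>axis_height\<close> would vanish identically; but
  it contains the term \<open>e * cos x\<close>.\<close>

lemma W_pos: "W > 0"
proof -
  have "W \<noteq> 0"
  proof
    assume "W = 0"
    then have "V 0 = 0" using V_norm by simp
    then have m: "M (\<phi> s) = 0" for s using V_inner(1)[of s] by simp
    obtain s where "\<phi> s = pi" using surj\<phi> by (metis surjD)
    then show False using m[of 0] m[of s] e0 by (simp add: axis_height_def \<phi>0)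
  qed
  then show ?thesis by (simp add: axis_norm_def less_le)
qed

lemma not_periodic: "\<exists>s. \<gamma> (s + T) \<noteq> \<gamma> s"
proof -
  have "1 \<in> {1..<n}" using n2 by simp
  then have "\<exists>s. \<gamma> (s + real 1 * T) \<noteq> \<gamma> s" using lobed unfolding n_lobed_def by blast
  then show ?thesis by simp
qed

text \<open>The axis \<open>e3\<close> in \<open>n_lobed\<close> is only known through the
  invariance of \<open>\<gamma> s \<bullet> e3\<close>. If it were not parallel to
  \<open>V 0\<close>, the products of \<open>\<gamma>\<close> with \<open>e3\<close>,
  \<open>V 0\<close> and their cross product would all have period \<open>T\<close>; then
  \<open>\<gamma>\<close> itself would close after one lobe, contradicting
  \<open>n \<ge> 2\<close>.\<close>

lemma axis_obtain:
  obtains e1 e2 e3 \<delta> \<sigma> where "norm e1 = 1" "norm e2 = 1" "norm e3 = 1" "e1 \<bullet> e2 = 0" "e1 \<bullet> e3 = 0" "e2 \<bullet> e3 = 0"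
    "\<And>s. Complex (\<gamma> s \<bullet> e1) (\<gamma> s \<bullet> e2) \<noteq> 0" "\<And>s. \<gamma> (s + T) \<bullet> e3 = \<gamma> s \<bullet> e3"
    "winding_number (\<lambda>x. Complex (\<gamma> (real n * T * x) \<bullet> e1) (\<gamma> (real n * T * x) \<bullet> e2)) 0 = 1"
    "V 0 = \<sigma> *\<^sub>R e3" "\<sigma>\<^sup>2 = W\<^sup>2" "cross3 e1 e2 = \<delta> *\<^sub>R e3" "\<delta>\<^sup>2 = 1"
proof -
  obtain e1 e2 e3 where E: "norm e1 = 1" "norm e2 = 1" "norm e3 = 1" "e1 \<bullet> e2 = 0" "e1 \<bullet> e3 = 0" "e2 \<bullet> e3 = 0"
    and e3: "\<And>s. \<gamma> (s + T) \<bullet> e3 = \<gamma> s \<bullet> e3" and z: "\<And>s. Complex (\<gamma> s \<bullet> e1) (\<gamma> s \<bullet> e2) \<noteq> 0"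
    and w: "winding_number (\<lambda>x. Complex (\<gamma> (real n * T * x) \<bullet> e1) (\<gamma> (real n * T * x) \<bullet> e2)) 0 = 1"
    using lobed unfolding n_lobed_def by blast
  have k: "\<kappa> (s + T) = \<kappa> s" for s by (simp add: per\<phi>)
  have shift: "((\<lambda>s. f (s + T)) has_real_derivative f') (at s)" if "(f has_real_derivative f') (at (s + T))" for f f' s
    using that DERIV_shift[of f f' s T] by simp
  \<comment> \<open>Differentiating the invariance once gives it for \<open>t\<close>, and twice for
    the normal; the second step divides by the curvature, which is positive because
    \<open>\<bar>e\<bar> < c\<close>.\<close>
  have t3: "t (s + T) \<bullet> e3 = t s \<bullet> e3" for s
  proof -
    have "((\<lambda>s. \<gamma> (s + T) \<bullet> e3) has_real_derivative t (s + T) \<bullet> e3) (at s)"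
      by (rule shift[of "\<lambda>s. \<gamma> s \<bullet> e3"]) (rule d_inner[OF dg])
    then show ?thesis unfolding e3 using d_inner[OF dg] DERIV_unique by blast
  qed
  have N3: "N (s + T) \<bullet> e3 = N s \<bullet> e3" for s
  proof -
    have "((\<lambda>s. t (s + T) \<bullet> e3) has_real_derivative (- \<gamma> (s + T) + \<kappa> (s + T) *\<^sub>R N (s + T)) \<bullet> e3) (at s)"
      by (rule shift[of "\<lambda>s. t s \<bullet> e3"]) (rule d_inner[OF dt])
    then have "(- \<gamma> (s + T) + \<kappa> (s + T) *\<^sub>R N (s + T)) \<bullet> e3 = (- \<gamma> s + \<kappa> s *\<^sub>R N s) \<bullet> e3"
      unfolding t3 using d_inner[OF dt] DERIV_unique by blast
    then have "\<kappa> s * (N (s + T) \<bullet> e3) = \<kappa> s * (N s \<bullet> e3)"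
      unfolding k by (simp add: inner_add_left inner_diff_left e3)
    then show ?thesis using \<kappa>_pos[of s] by simp
  qed
  have cross0: "cross3 e3 (V 0) = 0"
  proof (rule ccontr)
    assume ne: "cross3 e3 (V 0) \<noteq> 0"
    have gcross: "\<gamma> s = cross3 (t s) (N s)" for s by (simp add: Lagrange tt gt[unfolded inner_commute[of "\<gamma> s"]] inner_commute[of "t s" "\<gamma> s"])
    have gX: "\<gamma> s \<bullet> cross3 e3 (V 0) = (t s \<bullet> e3) * (- P (\<phi> s)) - \<kappa>' s * (N s \<bullet> e3)" for s
      by (subst gcross) (simp add: dot_cross V_inner(2,3)[unfolded inner_commute[of "V 0"]])
    have "\<gamma> (s + T) = \<gamma> s" for s
    proof -
      define d where "d = \<gamma> (s + T) - \<gamma> s"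
      have "d \<bullet> e3 = 0" by (simp add: d_def inner_diff_left e3)
      moreover have "d \<bullet> V 0 = 0"
        using V_inner(1)[of s] V_inner(1)[of "s + T"] by (simp add: d_def inner_diff_right inner_commute[of _ "V 0"] per\<phi> axis_periodic)
      moreover have "d \<bullet> cross3 e3 (V 0) = 0"
        unfolding d_def inner_diff_left gX by (simp add: t3 N3 per\<phi> axis_periodic \<kappa>'_def speed_sq_periodic)
      moreover have "cross3 d (cross3 e3 (V 0)) = 0" using calculation by (simp add: Lagrange)
      ultimately have "d = 0" using ne norm_and_cross_eq_0 by blast
      then show ?thesis by (simp add: d_def)
    qed
    then show False using not_periodic by blast
  qed
  define \<sigma> where "\<sigma> = e3 \<bullet> V 0"
  have e33: "e3 \<bullet> e3 = 1" using E by (simp add: norm_eq_1)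
  have V: "V 0 = \<sigma> *\<^sub>R e3"
    using arg_cong[OF cross0, of "cross3 e3"] by (simp add: Lagrange e33 \<sigma>_def)
  have s2: "\<sigma>\<^sup>2 = W\<^sup>2" using V_norm unfolding V by (simp add: e33 power2_eq_square)
  define \<delta> where "\<delta> = e3 \<bullet> cross3 e1 e2"
  have "cross3 e3 (cross3 e1 e2) = 0" using E by (simp add: Lagrange inner_commute)
  then have "cross3 e3 (cross3 e3 (cross3 e1 e2)) = 0" by simp
  then have c12: "cross3 e1 e2 = \<delta> *\<^sub>R e3" by (simp add: Lagrange[of e3 e3] e33 \<delta>_def)
  have "cross3 e1 e2 \<bullet> cross3 e1 e2 = 1" using E by (simp add: dot_cross norm_eq_1 inner_commute)
  then have d2: "\<delta>\<^sup>2 = 1" unfolding c12 by (simp add: e33 power2_eq_square)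
  show ?thesis by (rule that[OF E z e3 w V s2 c12 d2])
qed

lemma phase_shift: "\<phi> (s + real k * T) = \<phi> s + real k * (2 * pi)"
proof (induction k)
  case (Suc k)
  have "s + real (Suc k) * T = (s + real k * T) + T" by (simp add: algebra_simps)
  then show ?case using per\<phi>[of "s + real k * T"] Suc by (simp add: algebra_simps)
qed simp

lemma continuous_on_axis: "continuous_on A M" "continuous_on A P" "continuous_on A S" "continuous_on A (\<lambda>x. sqrt (Q x))"
  unfolding axis_height_def[abs_def] axis_speed_def[abs_def] tangent_sq_def[abs_def]
  by (intro continuous_intros continuous_on_speed_sq; simp)+

text \<open>The projection \<open>z\<close> of the curve along its axis has the explicit logarithm
  \<open>Lg\<close>, whose increment over \<open>n\<close> lobes is 2 pi i times the winding number.
  All lobes contribute equally, so one lobe turns by 2 pi / n; this gives the angle integral up to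
  the orientation of the axis, and a lower bound for the chord from one lobe to the next.\<close>

lemma lobe_rotation_facts:
  "S x + (P x)\<^sup>2 > 0"
  "real n * \<bar>integral {0..2 * pi} (angle_density c e r)\<bar> = 2 * pi"
  "cmod (cis (2 * pi / real n) - 1) ^ 2 * ((S (\<phi> s) + (P (\<phi> s))\<^sup>2) / W\<^sup>2) \<le> (norm (\<gamma> (s + T) - \<gamma> s))\<^sup>2"
proof -
  obtain e1 e2 e3 \<delta> \<sigma> where E: "norm e1 = 1" "norm e2 = 1" "norm e3 = 1" "e1 \<bullet> e2 = 0" "e1 \<bullet> e3 = 0" "e2 \<bullet> e3 = 0"
    and z0: "\<And>s. Complex (\<gamma> s \<bullet> e1) (\<gamma> s \<bullet> e2) \<noteq> 0" and p3: "\<And>s. \<gamma> (s + T) \<bullet> e3 = \<gamma> s \<bullet> e3"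
    and w: "winding_number (\<lambda>x. Complex (\<gamma> (real n * T * x) \<bullet> e1) (\<gamma> (real n * T * x) \<bullet> e2)) 0 = 1"
    and V: "V 0 = \<sigma> *\<^sub>R e3" and \<sigma>: "\<sigma>\<^sup>2 = W\<^sup>2" and c12: "cross3 e1 e2 = \<delta> *\<^sub>R e3" and \<delta>: "\<delta>\<^sup>2 = 1"
    by (rule axis_obtain, rule that)
  have \<sigma>0: "\<sigma> \<noteq> 0" using \<sigma> W_pos by auto
  define z where "z s = Complex (\<gamma> s \<bullet> e1) (\<gamma> s \<bullet> e2)" for s
  define z' where "z' s = Complex (t s \<bullet> e1) (t s \<bullet> e2)" for s
  \<comment> \<open>A sign: it compares the orientation of \<open>e1\<close>, \<open>e2\<close> with
    the direction of \<open>V 0\<close>, and disappears in the absolute value.\<close>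
  define \<eta> where "\<eta> = - \<delta> * \<sigma> / W"
  have \<eta>2: "\<eta>\<^sup>2 = 1" using \<delta> \<sigma> W_pos by (simp add: \<eta>_def power_divide power_mult_distrib)
  have plane: "x \<bullet> y = (x \<bullet> e1) * (y \<bullet> e1) + (x \<bullet> e2) * (y \<bullet> e2) + (x \<bullet> e3) * (y \<bullet> e3)" for x y
  proof -
    have "(x \<bullet> cross3 e1 e2) * (y \<bullet> cross3 e1 e2) = \<delta>\<^sup>2 * ((x \<bullet> e3) * (y \<bullet> e3))"
      unfolding c12 by (simp add: power2_eq_square)
    then show ?thesis using inner_orthonormal_expand[OF E(1,2,4), of x y] \<delta> by simp
  qed
  have g3: "(\<gamma> s \<bullet> e3)\<^sup>2 = (M (\<phi> s))\<^sup>2 / W\<^sup>2" for s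
  proof -
    have m: "M (\<phi> s) = \<sigma> * (\<gamma> s \<bullet> e3)" using V_inner(1)[of s] unfolding V by (simp add: inner_commute)
    show ?thesis unfolding m \<sigma>[symmetric] power_mult_distrib using \<sigma>0 by simp
  qed
  have nz: "(cmod (z s))\<^sup>2 = (S (\<phi> s) + (P (\<phi> s))\<^sup>2) / W\<^sup>2" for s
  proof -
    have "(cmod (z s))\<^sup>2 = 1 - (\<gamma> s \<bullet> e3)\<^sup>2"
    proof -
      have "(cmod (z s))\<^sup>2 = (\<gamma> s \<bullet> e1)\<^sup>2 + (\<gamma> s \<bullet> e2)\<^sup>2" by (simp add: z_def cmod_power2)
      then show ?thesis using plane[of "\<gamma> s" "\<gamma> s"] gg[of s] by (simp add: power2_eq_square)
    qed
    also have "\<dots> = (W\<^sup>2 - (M (\<phi> s))\<^sup>2) / W\<^sup>2" unfolding g3 using W_pos by (simp add: diff_divide_distrib)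
    also have "W\<^sup>2 - (M (\<phi> s))\<^sup>2 = S (\<phi> s) + (P (\<phi> s))\<^sup>2" using axis_norm_eq[of c e r "\<phi> s"] by simp
    finally show ?thesis .
  qed
  \<comment> \<open>The nonvanishing of the projection, needed for its winding number, says that the
    curve does not meet its axis; this makes all denominators positive.\<close>
  have zne: "z s \<noteq> 0" for s using z0 by (simp add: z_def)
  have SP': "S (\<phi> s) + (P (\<phi> s))\<^sup>2 > 0" for s
  proof -
    have "(cmod (z s))\<^sup>2 > 0" using zne by simp
    then show ?thesis unfolding nz using W_pos by (simp add: zero_less_divide_iff)
  qed
  then show SP: "S x + (P x)\<^sup>2 > 0" for x using surj\<phi> by (metis surjD)
  have cont: "continuous_on UNIV (angle_density c e r)"
    unfolding angle_density_def[abs_def]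
    by (intro continuous_intros continuous_on_axis) (use SP Q_pos in \<open>auto simp: less_imp_neq[THEN not_sym]\<close>)
  obtain J where J: "\<And>x. (J has_real_derivative angle_density c e r x) (at x)"
    using antiderivative_on_reals[OF cont] by blast
  define I where "I = integral {0..2 * pi} (angle_density c e r)"
  have Jk: "J (x + real k * (2 * pi)) = J x + real k * I" for x k
    unfolding I_def by (rule periodic_antiderivative[OF J]) (simp_all add: angle_density_def axis_periodic speed_sq_periodic)
  define Lg where "Lg s = of_real (ln ((cmod (z s))\<^sup>2) / 2) + \<i> * of_real (\<eta> * J (\<phi> s))" for s
  have dz: "(z has_vector_derivative z' s) (at s)" for s
  proof -
    have "((\<lambda>s. of_real (\<gamma> s \<bullet> e1) + \<i> * of_real (\<gamma> s \<bullet> e2)) has_vector_derivative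
        (of_real (t s \<bullet> e1) + \<i> * of_real (t s \<bullet> e2))) (at s)"
      by (intro derivative_intros has_vector_derivative_add has_vector_derivative_mult_right has_vector_derivative_of_real d_inner dg)
    then show ?thesis unfolding z_def[abs_def] z'_def Complex_eq by simp
  qed
  have cross_z: "Re (z s) * Im (z' s) - Im (z s) * Re (z' s) = \<eta> * P (\<phi> s) / W" for s
  proof -
    have "Re (z s) * Im (z' s) - Im (z s) * Re (z' s) = N s \<bullet> cross3 e1 e2"
      by (simp add: z_def z'_def dot_cross)
    also have "\<dots> = \<delta> * (e3 \<bullet> N s)" unfolding c12 by (simp add: inner_commute)
    also have "e3 \<bullet> N s = - P (\<phi> s) / \<sigma>" using V_inner(3)[of s] \<sigma>0 unfolding V by (simp add: field_simps)
    also have "\<delta> * (- P (\<phi> s) / \<sigma>) = - \<delta> * \<sigma> * P (\<phi> s) / \<sigma>\<^sup>2" using \<sigma>0 by (simp add: power2_eq_square)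
    also have "\<dots> = \<eta> * P (\<phi> s) / W" unfolding \<sigma> \<eta>_def by (simp add: power2_eq_square)
    finally show ?thesis .
  qed
  have dLg: "(Lg has_vector_derivative z' s / z s) (at s)" for s
  proof -
    have dRe: "((\<lambda>s. Re (z s)) has_real_derivative Re (z' s)) (at s)" "((\<lambda>s. Im (z s)) has_real_derivative Im (z' s)) (at s)"
      unfolding z_def z'_def by (simp_all add: d_inner dg)
    have pos: "(Re (z s))\<^sup>2 + (Im (z s))\<^sup>2 > 0" using zne[of s] by (simp flip: cmod_power2)
    have d1: "((\<lambda>s. ln ((cmod (z s))\<^sup>2) / 2) has_real_derivative
       (Re (z s) * Re (z' s) + Im (z s) * Im (z' s)) / (cmod (z s))\<^sup>2) (at s)"
    proof -
      have gen: "inverse q * (2 * x) / 2 = x / q" for q x :: real by (simp add: inverse_eq_divide)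
      have dsq: "((\<lambda>s. (Re (z s))\<^sup>2 + (Im (z s))\<^sup>2) has_real_derivative 2 * (Re (z s) * Re (z' s) + Im (z s) * Im (z' s))) (at s)"
        by (rule DERIV_cong[OF DERIV_add[OF DERIV_power[OF dRe(1), of 2] DERIV_power[OF dRe(2), of 2]]]) simp
      show ?thesis unfolding cmod_power2
        by (rule DERIV_cong[OF DERIV_cdivide[OF DERIV_chain2[where f = ln and g = "\<lambda>s. (Re (z s))\<^sup>2 + (Im (z s))\<^sup>2", OF DERIV_ln[OF pos] dsq], of 2] gen])
    qed
    have "((\<lambda>s. \<eta> * J (\<phi> s)) has_real_derivative \<eta> * (angle_density c e r (\<phi> s) * sqrt (Q (\<phi> s)))) (at s)"
      by (intro DERIV_cmult DERIV_chain2[OF J d\<phi>])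
    moreover have "\<eta> * (angle_density c e r (\<phi> s) * sqrt (Q (\<phi> s))) = (\<eta> * P (\<phi> s) / W) / (cmod (z s))\<^sup>2"
      unfolding nz angle_density_def using Q_pos[of "\<phi> s"] W_pos SP'[of s]
      by (simp add: power2_eq_square)
    ultimately have d2: "((\<lambda>s. \<eta> * J (\<phi> s)) has_real_derivative (Re (z s) * Im (z' s) - Im (z s) * Re (z' s)) / (cmod (z s))\<^sup>2) (at s)"
      by (simp add: cross_z)
    have "(Lg has_vector_derivative of_real ((Re (z s) * Re (z' s) + Im (z s) * Im (z' s)) / (cmod (z s))\<^sup>2)
        + \<i> * of_real ((Re (z s) * Im (z' s) - Im (z s) * Re (z' s)) / (cmod (z s))\<^sup>2)) (at s)"
      unfolding Lg_def[abs_def]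
      by (intro has_vector_derivative_add has_vector_derivative_mult_right has_vector_derivative_of_real d1 d2)
    moreover have "of_real ((Re (z s) * Re (z' s) + Im (z s) * Im (z' s)) / (cmod (z s))\<^sup>2)
        + \<i> * of_real ((Re (z s) * Im (z' s) - Im (z s) * Re (z' s)) / (cmod (z s))\<^sup>2) = z' s / z s"
      unfolding complex_div_cnj[of "z' s" "z s"]
      by (simp add: complex_eq_iff mult.commute flip: of_real_power)
    ultimately show ?thesis by simp
  qed
  \<comment> \<open>\<open>z * exp (- Lg)\<close> has derivative zero, so quotients of values of
    \<open>z\<close> are exponentials of differences of \<open>Lg\<close>.\<close>
  have ratio: "z (s + a) = z s * exp (Lg (s + a) - Lg s)" for s a
  proof -
    have "((\<lambda>s. z s * exp (- Lg s)) has_vector_derivative 0) (at s)" for s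
    proof -
      have "((\<lambda>s. - Lg s) has_vector_derivative - (z' s / z s)) (at s)"
        by (intro derivative_intros dLg)
      then have "((exp \<circ> (\<lambda>s. - Lg s)) has_vector_derivative (- (z' s / z s)) * exp (- Lg s)) (at s)"
        by (rule field_vector_diff_chain_at) (rule DERIV_exp)
      then have "((\<lambda>s. z s * exp (- Lg s)) has_vector_derivative z s * ((- (z' s / z s)) * exp (- Lg s)) + z' s * exp (- Lg s)) (at s)"
        by (intro has_vector_derivative_mult dz) (simp add: comp_def)
      then show ?thesis using zne[of s] by simp
    qed
    then obtain d where d: "\<And>s. z s * exp (- Lg s) = d"
      using has_vector_derivative_zero_constant[of UNIV "\<lambda>s. z s * exp (- Lg s)"] by auto
    have "z (s + a) * exp (- Lg (s + a)) = z s * exp (- Lg s)" unfolding d ..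
    then have "z (s + a) * (exp (- Lg (s + a)) * exp (Lg (s + a))) = z s * (exp (- Lg s) * exp (Lg (s + a)))"
      by (metis mult.assoc)
    then show ?thesis by (simp add: exp_add[symmetric])
  qed
  have Lgk: "Lg (s + real k * T) - Lg s = \<i> * of_real (\<eta> * (real k * I))" for s k
  proof -
    \<comment> \<open>Whole lobes preserve the distance from the axis, so the real part of
      \<open>Lg\<close> drops out and the increment is purely imaginary.\<close>
    have "cmod (z (s + real k * T)) ^ 2 = cmod (z s) ^ 2"
    proof -
      have per: "f (x + real k * (2 * pi)) = f x" if "\<And>x. f (x + 2 * pi) = f x" for f :: "real \<Rightarrow> real" and x
      proof (induction k)
        case (Suc k)
        have "x + real (Suc k) * (2 * pi) = (x + real k * (2 * pi)) + 2 * pi" by (simp add: algebra_simps)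
        then have "f (x + real (Suc k) * (2 * pi)) = f ((x + real k * (2 * pi)) + 2 * pi)" by (simp only:)
        also have "\<dots> = f (x + real k * (2 * pi))" by (rule that)
        also have "\<dots> = f x" by (rule Suc)
        finally show ?case .
      qed simp
      show ?thesis unfolding nz phase_shift by (simp only: per[of P, OF axis_periodic(2)] per[of S, OF axis_periodic(3)])
    qed
    then show ?thesis unfolding Lg_def phase_shift Jk by (simp add: algebra_simps)
  qed
  have closing: "real n * \<eta> * I = 2 * pi"
  proof -
    define L where "L = real n * T"
    define p where "p x = z (L * x)" for x
    have dp: "(p has_vector_derivative of_real L * z' (L * x)) (at x)" for x
    proof -
      have "((z \<circ> (\<lambda>x. L * x)) has_vector_derivative L *\<^sub>R z' (L * x)) (at x)"
        by (rule vector_diff_chain_at) (auto intro!: derivative_eq_intros dz)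
      then show ?thesis by (simp add: p_def[abs_def] comp_def scaleR_conv_of_real)
    qed
    have cz': "continuous_on UNIV (\<lambda>x. of_real L * z' (L * x))"
    proof -
      have ct: "continuous_on UNIV t" using dt by (meson continuous_at_imp_continuous_on has_vector_derivative_continuous)
      have "continuous_on UNIV z'" unfolding z'_def[abs_def] Complex_eq by (intro continuous_intros ct)
      then have "continuous_on UNIV (\<lambda>x. z' (L * x))"
        by (rule continuous_on_compose2) (auto intro!: continuous_intros)
      then show ?thesis by (intro continuous_intros)
    qed
    have vp: "valid_path p"
      unfolding valid_path_def
      by (rule C1_differentiable_imp_piecewise)
        (use dp cz' in \<open>auto simp: C1_differentiable_on_def intro!: exI[of _ "\<lambda>x. of_real L * z' (L * x)"] continuous_on_subset[OF cz']\<close>)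
    have img: "0 \<notin> path_image p" using zne by (auto simp: path_image_def p_def)
    have "((\<lambda>w. 1 / (w - 0)) has_contour_integral (Lg L - Lg 0)) p"
      unfolding has_contour_integral
    proof -
      have dLp: "((\<lambda>x. Lg (L * x)) has_vector_derivative of_real L * z' (L * x) / z (L * x)) (at x)" for x
      proof -
        have "((Lg \<circ> (\<lambda>x. L * x)) has_vector_derivative L *\<^sub>R (z' (L * x) / z (L * x))) (at x)"
          by (rule vector_diff_chain_at) (auto intro!: derivative_eq_intros dLg)
        then show ?thesis by (simp add: comp_def scaleR_conv_of_real)
      qed
      have "((\<lambda>x. of_real L * z' (L * x) / z (L * x)) has_integral (Lg (L * 1) - Lg (L * 0))) {0..1}"
        by (rule fundamental_theorem_of_calculus) (auto intro: has_vector_derivative_at_within dLp)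
      moreover have "1 / (p x - 0) * vector_derivative p (at x) = of_real L * z' (L * x) / z (L * x)" for x
        using vector_derivative_at[OF dp[of x]] by (simp add: p_def)
      ultimately show "((\<lambda>x. 1 / (p x - 0) * vector_derivative p (at x)) has_integral (Lg L - Lg 0)) {0..1}" by simp
    qed
    then have "contour_integral p (\<lambda>w. 1 / (w - 0)) = Lg L - Lg 0" by (rule contour_integral_unique)
    also have "\<dots> = \<i> * of_real (\<eta> * (real n * I))" using Lgk[of 0 n] by (simp add: L_def)
    finally have "winding_number p 0 = 1 / (2 * of_real pi * \<i>) * (\<i> * of_real (\<eta> * (real n * I)))"
      using winding_number_valid_path[OF vp img] by simp
    moreover have "winding_number p 0 = 1" using w by (simp add: p_def[abs_def] z_def L_def)
    ultimately have "of_real (\<eta> * (real n * I)) = (2 * of_real pi :: complex)" by (simp add: field_simps)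
    then have "\<eta> * (real n * I) = 2 * pi" by (metis of_real_eq_iff of_real_mult of_real_numeral)
    then show ?thesis by (simp add: algebra_simps)
  qed
  have "\<bar>\<eta>\<bar> = 1" using \<eta>2 by (metis abs_1 power2_eq_iff abs_minus_cancel one_power2)
  then have "\<bar>real n * \<eta> * I\<bar> = real n * \<bar>I\<bar>" by (simp add: abs_mult)
  then show "real n * \<bar>integral {0..2 * pi} (angle_density c e r)\<bar> = 2 * pi"
    unfolding closing I_def[symmetric] by simp
  have "\<eta> * I = 2 * pi / real n" using closing n2 by (simp add: field_simps)
  then have "exp (Lg (s + T) - Lg s) = cis (2 * pi / real n)"
    using Lgk[of s 1] by (simp add: cis_conv_exp)
  then have "z (s + T) - z s = z s * (cis (2 * pi / real n) - 1)" using ratio[of s T] by (simp add: algebra_simps)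
  then have "cmod (z (s + T) - z s) ^ 2 = cmod (cis (2 * pi / real n) - 1) ^ 2 * cmod (z s) ^ 2"
    by (simp add: norm_mult power_mult_distrib)
  moreover have "cmod (z (s + T) - z s) ^ 2 \<le> (norm (\<gamma> (s + T) - \<gamma> s))\<^sup>2"
  proof -
    define d where "d = \<gamma> (s + T) - \<gamma> s"
    have "(cmod (z (s + T) - z s))\<^sup>2 = (d \<bullet> e1)\<^sup>2 + (d \<bullet> e2)\<^sup>2"
      by (simp add: z_def cmod_power2 d_def inner_diff_left)
    moreover have "(norm d)\<^sup>2 = (d \<bullet> e1)\<^sup>2 + (d \<bullet> e2)\<^sup>2 + (d \<bullet> e3)\<^sup>2"
      unfolding power2_norm_eq_inner using plane[of d d] by (simp only: power2_eq_square)
    ultimately show ?thesis by (simp add: d_def)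
  qed
  ultimately show "cmod (cis (2 * pi / real n) - 1) ^ 2 * ((S (\<phi> s) + (P (\<phi> s))\<^sup>2) / W\<^sup>2) \<le> (norm (\<gamma> (s + T) - \<gamma> s))\<^sup>2"
    by (simp add: nz)
qed

text \<open>Compared with the circle of curvature \<open>c\<close>: \<open>\<gamma> - c N\<close> and \<open>\<Omega> t\<close> rotate into each other with angular
  velocity \<open>\<Omega>\<close>, up to an error of the size of \<open>\<kappa> - c\<close>.\<close>

definition "\<Omega> = sqrt (1 + c\<^sup>2)"

lemma \<Omega>: "\<Omega>\<^sup>2 = 1 + c\<^sup>2" "\<Omega> \<ge> 1" "c \<le> \<Omega>" "\<Omega> > 0" "c > 0"
proof -
  show 1: "\<Omega>\<^sup>2 = 1 + c\<^sup>2" by (simp add: \<Omega>_def)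
  show 2: "\<Omega> \<ge> 1" by (simp add: \<Omega>_def)
  show "c \<le> \<Omega>" by (rule power2_le_imp_le) (use 1 2 in auto)
  show "\<Omega> > 0" using 2 by simp
  show "c > 0" using ec by simp
qed

lemma curvature_deviation: "\<bar>\<kappa> s - c\<bar> \<le> \<bar>e\<bar>"
  using abs_cos_le_one[of "\<phi> s"] by (simp add: abs_mult mult_left_le)

lemma lipschitz_curve:
  fixes f :: "real \<Rightarrow> real^3"
  assumes "\<And>x. (f has_vector_derivative f' x) (at x)" "\<And>x. norm (f' x) \<le> B"
  shows "norm (f x - f y) \<le> B * \<bar>x - y\<bar>"
proof -
  have "norm (f x - f y) \<le> B * norm (x - y)"
  proof (rule differentiable_bound[of UNIV f "\<lambda>x h. h *\<^sub>R f' x"])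
    show "onorm (\<lambda>h. h *\<^sub>R f' x) \<le> B" for x
      using onorm_scaleR_left[OF bounded_linear_ident, of "f' x"] assms(2)[of x] by (simp add: onorm_id)
  qed (use assms(1) in \<open>auto simp: has_vector_derivative_def\<close>)
  then show ?thesis by simp
qed

text \<open>The rotation by \<open>\<Omega> * \<tau>\<close> is undone: for constant curvature
  \<open>c\<close> the moved vector would not depend on \<open>\<tau>\<close>. In general its
  derivative is \<open>\<kappa> - c\<close> times a vector of norm at most
  \<open>c + \<Omega>\<close>.\<close>

lemma frame_estimate:
  "norm (cos (\<Omega> * \<tau>) *\<^sub>R (\<gamma> (s + \<tau>) - c *\<^sub>R N (s + \<tau>)) - (\<Omega> * sin (\<Omega> * \<tau>)) *\<^sub>R t (s + \<tau>) - (\<gamma> s - c *\<^sub>R N s))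
     \<le> \<bar>e\<bar> * (c + \<Omega>) * \<bar>\<tau>\<bar>"
proof -
  define y where "y \<tau> = cos (\<Omega> * \<tau>) *\<^sub>R (\<gamma> (s + \<tau>) - c *\<^sub>R N (s + \<tau>)) - (\<Omega> * sin (\<Omega> * \<tau>)) *\<^sub>R t (s + \<tau>)" for \<tau>
  define y' where "y' \<tau> = (\<kappa> (s + \<tau>) - c) *\<^sub>R ((c * cos (\<Omega> * \<tau>)) *\<^sub>R t (s + \<tau>) - (\<Omega> * sin (\<Omega> * \<tau>)) *\<^sub>R N (s + \<tau>))" for \<tau>
  have sh: "((\<lambda>\<tau>. f (s + \<tau>)) has_vector_derivative f' (s + \<tau>)) (at \<tau>)"
    if "\<And>x. (f has_vector_derivative f' x) (at x)" for f f' :: "real \<Rightarrow> real^3" and \<tau>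
  proof -
    have "((f \<circ> (\<lambda>\<tau>. s + \<tau>)) has_vector_derivative 1 *\<^sub>R f' (s + \<tau>)) (at \<tau>)"
      by (rule vector_diff_chain_at) (auto intro!: derivative_eq_intros that)
    then show ?thesis by (simp add: comp_def)
  qed
  have dc: "((\<lambda>\<tau>. cos (\<Omega> * \<tau>)) has_real_derivative - \<Omega> * sin (\<Omega> * \<tau>)) (at \<tau>)"
    "((\<lambda>\<tau>. \<Omega> * sin (\<Omega> * \<tau>)) has_real_derivative \<Omega> * (\<Omega> * cos (\<Omega> * \<tau>))) (at \<tau>)" for \<tau>
    by (auto intro!: derivative_eq_intros)
  have d: "(y has_vector_derivative y' \<tau>) (at \<tau>)" for \<tau>
  proof -
    have gen: "C *\<^sub>R (v - c *\<^sub>R (- k *\<^sub>R v)) + (- \<Omega> * Z) *\<^sub>R (g - c *\<^sub>R m)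
       - ((\<Omega> * Z) *\<^sub>R (- g + k *\<^sub>R m) + (\<Omega> * (\<Omega> * C)) *\<^sub>R v)
       = (k - c) *\<^sub>R ((c * C) *\<^sub>R v - (\<Omega> * Z) *\<^sub>R m)" for C Z k :: real and v g m :: "real^3"
    proof -
      have "\<Omega> * (\<Omega> * C) = C + c * (c * C)" using \<Omega>(1) by (metis distrib_right mult.assoc mult_1 power2_eq_square)
      then show ?thesis by (simp only:) (simp add: algebra_simps)
    qed
    have "(y has_vector_derivative cos (\<Omega> * \<tau>) *\<^sub>R (t (s + \<tau>) - c *\<^sub>R (- \<kappa> (s + \<tau>) *\<^sub>R t (s + \<tau>)))
         + (- \<Omega> * sin (\<Omega> * \<tau>)) *\<^sub>R (\<gamma> (s + \<tau>) - c *\<^sub>R N (s + \<tau>))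
       - ((\<Omega> * sin (\<Omega> * \<tau>)) *\<^sub>R (- \<gamma> (s + \<tau>) + \<kappa> (s + \<tau>) *\<^sub>R N (s + \<tau>)) + (\<Omega> * (\<Omega> * cos (\<Omega> * \<tau>))) *\<^sub>R t (s + \<tau>))) (at \<tau>)"
      unfolding y_def[abs_def]
      by (intro has_vector_derivative_diff has_vector_derivative_scaleR dc sh[OF dg] sh[OF dt] sh[OF dN]
          bounded_linear.has_vector_derivative[OF bounded_linear_scaleR_right])
    then show ?thesis unfolding gen y'_def .
  qed
  have b: "norm (y' \<tau>) \<le> \<bar>e\<bar> * (c + \<Omega>)" for \<tau>
  proof -
    have nN: "norm (N x) = 1" for x using NN[of x] by (simp add: norm_eq_1)
    have "norm ((c * cos (\<Omega> * \<tau>)) *\<^sub>R t (s + \<tau>) - (\<Omega> * sin (\<Omega> * \<tau>)) *\<^sub>R N (s + \<tau>))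
       \<le> norm ((c * cos (\<Omega> * \<tau>)) *\<^sub>R t (s + \<tau>)) + norm ((\<Omega> * sin (\<Omega> * \<tau>)) *\<^sub>R N (s + \<tau>))"
      by (rule norm_triangle_ineq4)
    also have "\<dots> = c * \<bar>cos (\<Omega> * \<tau>)\<bar> + \<Omega> * \<bar>sin (\<Omega> * \<tau>)\<bar>"
      using \<Omega> by (simp add: nt nN abs_mult)
    also have "\<dots> \<le> c * 1 + \<Omega> * 1" using \<Omega> by (intro add_mono mult_left_mono) auto
    finally have 1: "norm ((c * cos (\<Omega> * \<tau>)) *\<^sub>R t (s + \<tau>) - (\<Omega> * sin (\<Omega> * \<tau>)) *\<^sub>R N (s + \<tau>)) \<le> c + \<Omega>" by simp
    have "norm (y' \<tau>) = \<bar>\<kappa> (s + \<tau>) - c\<bar> * norm ((c * cos (\<Omega> * \<tau>)) *\<^sub>R t (s + \<tau>) - (\<Omega> * sin (\<Omega> * \<tau>)) *\<^sub>R N (s + \<tau>))"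
      unfolding y'_def by (rule norm_scaleR)
    also have "\<dots> \<le> \<bar>e\<bar> * (c + \<Omega>)" using curvature_deviation 1 by (intro mult_mono) auto
    finally show ?thesis .
  qed
  have "norm (y \<tau> - y 0) \<le> \<bar>e\<bar> * (c + \<Omega>) * \<bar>\<tau> - 0\<bar>" by (rule lipschitz_curve[OF d b])
  then show ?thesis by (simp add: y_def)
qed

text \<open>Over the full length the frame returns to itself, and the component along
  \<open>t\<close> of the preceding estimate isolates the sine. Thus the length is, up to O(e), a
  multiple of pi / \<open>\<Omega>\<close>.\<close>

lemma total_turning_estimate: "\<bar>sin (\<Omega> * (real n * T))\<bar> \<le> 2 * \<bar>e\<bar> * (real n * T)"
proof -
  define L where "L = real n * T"
  have L0: "L > 0" using T_pos n2 by (simp add: L_def)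
  have cl: "\<gamma> (s + L) = \<gamma> s" for s using closed by (simp add: L_def)
  have tL: "t (s + L) = t s" for s
  proof -
    have "((\<gamma> \<circ> (\<lambda>s. s + L)) has_vector_derivative 1 *\<^sub>R t (s + L)) (at s)"
      by (rule vector_diff_chain_at) (auto intro!: derivative_eq_intros dg)
    then have "(\<gamma> has_vector_derivative t (s + L)) (at s)" by (simp add: comp_def cl)
    then show ?thesis using dg vector_derivative_unique_at by blast
  qed
  have "norm (cos (\<Omega> * L) *\<^sub>R (\<gamma> 0 - c *\<^sub>R N 0) - (\<Omega> * sin (\<Omega> * L)) *\<^sub>R t 0 - (\<gamma> 0 - c *\<^sub>R N 0)) \<le> \<bar>e\<bar> * (c + \<Omega>) * L"
    (is "norm ?v \<le> _") using frame_estimate[of L 0] cl[of 0] tL[of 0] L0 by simp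
  moreover have "?v \<bullet> t 0 = - (\<Omega> * sin (\<Omega> * L))"
    using tt[of 0] gt[of 0] by (simp add: inner_diff_left dot_cross_self)
  then have "\<bar>\<Omega> * sin (\<Omega> * L)\<bar> \<le> norm ?v"
    using Cauchy_Schwarz_ineq2[of ?v "t 0"] by (simp add: nt)
  ultimately have "\<Omega> * \<bar>sin (\<Omega> * L)\<bar> \<le> \<bar>e\<bar> * (c + \<Omega>) * L" using \<Omega>(4) by (simp add: abs_mult)
  also have "\<dots> \<le> \<bar>e\<bar> * (\<Omega> + \<Omega>) * L" using \<Omega> L0 by (intro mult_right_mono mult_left_mono) auto
  finally have "\<Omega> * \<bar>sin (\<Omega> * L)\<bar> \<le> \<Omega> * (2 * \<bar>e\<bar> * L)" by (simp add: algebra_simps)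
  then show ?thesis using \<Omega>(4) by (simp add: L_def)
qed

text \<open>Splitting \<open>\<Omega>\<^sup>2 \<gamma> = c a + u\<close> separates the almost
  constant \<open>a = c \<gamma> + N\<close> from the rotating \<open>u = \<gamma> - c N\<close>. If
  \<open>\<Omega> * T\<close> is close to 2 pi and \<open>e\<close> is small, a lobe hardly
  displaces the curve; together with the chord bound this rules out \<open>r = 4\<close>
  later.\<close>

lemma lobe_displacement_estimate:
  "norm (\<gamma> (s + T) - \<gamma> s) \<le> 3 * \<bar>e\<bar> * T + \<bar>1 - cos (\<Omega> * T)\<bar> + \<bar>sin (\<Omega> * T)\<bar>"
proof -
  define u where "u x = \<gamma> x - c *\<^sub>R N x" for x
  define a where "a x = c *\<^sub>R \<gamma> x + N x" for x
  have nu: "norm (u x) = \<Omega>" for x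
  proof -
    have "u x \<bullet> u x = 1 + c\<^sup>2"
      by (simp add: u_def inner_diff_left inner_diff_right gg NN gN dot_cross_self power2_eq_square)
    then have "(norm (u x))\<^sup>2 = \<Omega>\<^sup>2" unfolding \<Omega>(1) power2_norm_eq_inner .
    then show ?thesis by (rule power2_eq_imp_eq) (use \<Omega>(4) in auto)
  qed
  have da: "(a has_vector_derivative c *\<^sub>R t x + - \<kappa> x *\<^sub>R t x) (at x)" for x
    unfolding a_def[abs_def]
    by (intro has_vector_derivative_add dN bounded_linear.has_vector_derivative[OF bounded_linear_scaleR_right] dg)
  have na: "norm (c *\<^sub>R t x + - \<kappa> x *\<^sub>R t x) \<le> \<bar>e\<bar>" for x
  proof -
    have "c *\<^sub>R t x + - \<kappa> x *\<^sub>R t x = (c - \<kappa> x) *\<^sub>R t x" by (simp only: scaleR_left.add[symmetric]) simp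
    then show ?thesis using curvature_deviation[of x] by (simp add: nt abs_minus_commute)
  qed
  have 1: "norm (a (s + T) - a s) \<le> \<bar>e\<bar> * T"
    using lipschitz_curve[OF da na, of "s + T" s] T_pos by simp
  define D where "D = cos (\<Omega> * T) *\<^sub>R u (s + T) - (\<Omega> * sin (\<Omega> * T)) *\<^sub>R t (s + T) - u s"
  have 2: "norm D \<le> \<bar>e\<bar> * (c + \<Omega>) * T"
    using frame_estimate[of T s] T_pos by (simp add: u_def D_def)
  have uu: "u (s + T) - u s = D + ((1 - cos (\<Omega> * T)) *\<^sub>R u (s + T) + (\<Omega> * sin (\<Omega> * T)) *\<^sub>R t (s + T))"
    by (simp add: D_def algebra_simps)
  have "norm (u (s + T) - u s) \<le> norm D + (norm ((1 - cos (\<Omega> * T)) *\<^sub>R u (s + T)) + norm ((\<Omega> * sin (\<Omega> * T)) *\<^sub>R t (s + T)))"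
    unfolding uu using norm_triangle_ineq[of D "(1 - cos (\<Omega> * T)) *\<^sub>R u (s + T) + (\<Omega> * sin (\<Omega> * T)) *\<^sub>R t (s + T)"]
      norm_triangle_ineq[of "(1 - cos (\<Omega> * T)) *\<^sub>R u (s + T)" "(\<Omega> * sin (\<Omega> * T)) *\<^sub>R t (s + T)"] by linarith
  then have 3: "norm (u (s + T) - u s) \<le> \<bar>e\<bar> * (c + \<Omega>) * T + \<bar>1 - cos (\<Omega> * T)\<bar> * \<Omega> + \<Omega> * \<bar>sin (\<Omega> * T)\<bar>"
    using 2 \<Omega>(4) by (simp add: nu nt abs_mult)
  have "\<Omega>\<^sup>2 *\<^sub>R \<gamma> x = c *\<^sub>R a x + u x" for x
    unfolding \<Omega>(1) a_def u_def by (simp add: algebra_simps power2_eq_square)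
  then have "\<Omega>\<^sup>2 *\<^sub>R (\<gamma> (s + T) - \<gamma> s) = c *\<^sub>R (a (s + T) - a s) + (u (s + T) - u s)"
    by (simp add: scaleR_right_diff_distrib algebra_simps)
  then have "\<Omega>\<^sup>2 * norm (\<gamma> (s + T) - \<gamma> s) = norm (c *\<^sub>R (a (s + T) - a s) + (u (s + T) - u s))"
    by (metis norm_scaleR abs_power2)
  also have "\<dots> \<le> norm (c *\<^sub>R (a (s + T) - a s)) + norm (u (s + T) - u s)" by (rule norm_triangle_ineq)
  also have "\<dots> \<le> c * (\<bar>e\<bar> * T) + (\<bar>e\<bar> * (c + \<Omega>) * T + \<bar>1 - cos (\<Omega> * T)\<bar> * \<Omega> + \<Omega> * \<bar>sin (\<Omega> * T)\<bar>)"
    using 1 3 \<Omega>(5) by (intro add_mono) (auto intro!: mult_left_mono)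
  also have "\<dots> \<le> \<Omega> * (\<bar>e\<bar> * T) + (\<bar>e\<bar> * (\<Omega> + \<Omega>) * T + \<bar>1 - cos (\<Omega> * T)\<bar> * \<Omega> + \<Omega> * \<bar>sin (\<Omega> * T)\<bar>)"
    using \<Omega> T_pos by (intro add_mono mult_right_mono mult_left_mono) auto
  also have "\<dots> = \<Omega> * (3 * \<bar>e\<bar> * T + \<bar>1 - cos (\<Omega> * T)\<bar> + \<bar>sin (\<Omega> * T)\<bar>)" by (simp add: algebra_simps)
  finally have "\<Omega>\<^sup>2 * norm (\<gamma> (s + T) - \<gamma> s) \<le> \<Omega> * (3 * \<bar>e\<bar> * T + \<bar>1 - cos (\<Omega> * T)\<bar> + \<bar>sin (\<Omega> * T)\<bar>)" .
  then have "\<Omega> * norm (\<gamma> (s + T) - \<gamma> s) \<le> 3 * \<bar>e\<bar> * T + \<bar>1 - cos (\<Omega> * T)\<bar> + \<bar>sin (\<Omega> * T)\<bar>"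
    using \<Omega>(4) by (simp add: power2_eq_square mult.assoc)
  moreover have "1 * norm (\<gamma> (s + T) - \<gamma> s) \<le> \<Omega> * norm (\<gamma> (s + T) - \<gamma> s)"
    using \<Omega>(2) by (intro mult_right_mono) auto
  ultimately show ?thesis by simp
qed

text \<open>Rotating the axis to \<open>e\<^sub>3\<close> makes the horizontal lift explicit.\<close>

lemma standard_position:
  obtains g where "spherical_curve_with_curvature g (\<lambda>s. \<kappa> s)" "n_lobed n g (\<lambda>s. \<kappa> s) T"
    "hopf_torus_conformal_to g (real n * T) (torus_lattice
       (Complex (real n * integral {0..2 * pi} (phase_density c e r) / (4 * pi)) (real n * T / (4 * pi))))"
proof -
  obtain e1 e2 e3 \<delta> \<sigma> where E: "norm e1 = 1" "norm e2 = 1" "norm e3 = 1" "e1 \<bullet> e2 = 0" "e1 \<bullet> e3 = 0" "e2 \<bullet> e3 = 0"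
    and z0: "\<And>s. Complex (\<gamma> s \<bullet> e1) (\<gamma> s \<bullet> e2) \<noteq> 0" and p3: "\<And>s. \<gamma> (s + T) \<bullet> e3 = \<gamma> s \<bullet> e3"
    and w: "winding_number (\<lambda>x. Complex (\<gamma> (real n * T * x) \<bullet> e1) (\<gamma> (real n * T * x) \<bullet> e2)) 0 = 1"
    and V: "V 0 = \<sigma> *\<^sub>R e3" and \<sigma>: "\<sigma>\<^sup>2 = W\<^sup>2" and c12': "cross3 e1 e2 = \<delta> *\<^sub>R e3" and \<delta>: "\<delta>\<^sup>2 = 1"
    by (rule axis_obtain, rule that)
  \<comment> \<open>The minus sign puts the circles with \<open>c > 0\<close> and
    \<open>r > 4\<close> in the upper half, as in \<open>circle_hopf_torus\<close>.\<close>
  define E3 where "E3 = - V 0 /\<^sub>R W"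
  define E2 where "E2 = cross3 E3 e1"
  have E3n: "E3 \<bullet> E3 = 1" using V_norm W_pos by (simp add: E3_def power2_eq_square field_simps)
  have E31: "E3 \<bullet> e1 = 0" using E(5) by (simp add: E3_def V inner_commute)
  have e11: "e1 \<bullet> e1 = 1" using E by (simp add: norm_eq_1)
  have E2n: "E2 \<bullet> E2 = 1" using E3n E31 e11 by (simp add: E2_def dot_cross inner_commute)
  have E12: "e1 \<bullet> E2 = 0" by (simp add: E2_def dot_cross_self)
  have c12: "cross3 e1 E2 = E3" using e11 E31 by (simp add: E2_def Lagrange inner_commute)
  have c23: "cross3 E2 E3 = e1"
  proof -
    have "cross3 E2 E3 = - cross3 E3 E2" by (rule cross_skew)
    also have "\<dots> = e1" unfolding E2_def using E3n E31 by (simp add: Lagrange)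
    finally show ?thesis .
  qed
  have c31: "cross3 E3 e1 = E2" by (simp add: E2_def)
  \<comment> \<open>Since \<open>cross3 e1 E2 = E3\<close>, this isometry preserves the orientation
    and hence the sign of the curvature.\<close>
  define A where "A x = (vector [x \<bullet> e1, x \<bullet> E2, x \<bullet> E3] :: real^3)" for x :: "real^3"
  have Ac: "A x $ 1 = x \<bullet> e1" "A x $ 2 = x \<bullet> E2" "A x $ 3 = x \<bullet> E3" for x by (simp_all add: A_def)
  have nE2: "norm E2 = 1" using E2n by (simp add: norm_eq_1)
  have Ai: "A x \<bullet> A y = x \<bullet> y" for x y
    using inner_orthonormal_expand[OF E(1) nE2 E12, of x y] by (simp add: inner_vec_def sum_3 Ac c12)
  have An: "norm (A x) = norm x" for x by (simp add: norm_eq_sqrt_inner Ai)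
  have Across: "cross3 (A x) (A y) = A (cross3 x y)" for x y
    unfolding vec_eq_iff forall_3 cross_components Ac
  proof (intro conjI)
    show "x \<bullet> E2 * (y \<bullet> E3) - y \<bullet> E2 * (x \<bullet> E3) = cross3 x y \<bullet> e1"
      by (subst c23[symmetric]) (simp only: dot_cross mult.commute)
    show "x \<bullet> E3 * (y \<bullet> e1) - y \<bullet> E3 * (x \<bullet> e1) = cross3 x y \<bullet> E2"
      by (subst c31[symmetric]) (simp only: dot_cross mult.commute)
    show "x \<bullet> e1 * (y \<bullet> E2) - y \<bullet> e1 * (x \<bullet> E2) = cross3 x y \<bullet> E3"
      by (subst c12[symmetric]) (simp only: dot_cross mult.commute)
  qed
  have lin: "linear A"
    by (rule linearI) (simp_all add: vec_eq_iff forall_3 Ac inner_add_left)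
  then have bl: "bounded_linear A" by (simp add: linear_conv_bounded_linear)
  define g where "g s = A (\<gamma> s)" for s
  define g' where "g' s = A (t s)" for s
  have dg': "(g has_vector_derivative g' s) (at s)" for s
    unfolding g_def[abs_def] g'_def by (rule bounded_linear.has_vector_derivative[OF bl dg])
  have dt': "(g' has_vector_derivative A (- \<gamma> s + \<kappa> s *\<^sub>R N s)) (at s)" for s
    unfolding g'_def[abs_def] by (rule bounded_linear.has_vector_derivative[OF bl dt])
  have gcross: "cross3 (g s) (g' s) = A (N s)" for s by (simp add: g_def g'_def Across)
  have 1: "spherical_curve_with_curvature g (\<lambda>s. \<kappa> s)"
  proof -
    have a: "\<forall>s. norm (g s) = 1" by (simp add: g_def An ng)
    have b: "\<forall>s. (g has_vector_derivative g' s) (at s) \<and> (g' has_vector_derivative A (- \<gamma> s + \<kappa> s *\<^sub>R N s)) (at s) \<and>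
       norm (g' s) = 1 \<and> \<kappa> s = A (- \<gamma> s + \<kappa> s *\<^sub>R N s) \<bullet> cross3 (g s) (g' s)"
      unfolding gcross Ai by (intro allI conjI dg' dt') (simp_all add: g'_def An nt inner_add_left gN NN inner_diff_left)
    show ?thesis unfolding spherical_curve_with_curvature_def
      by (intro conjI a, rule exI[of _ g'], rule exI[of _ "\<lambda>s. A (- \<gamma> s + \<kappa> s *\<^sub>R N s)"], rule b)
  qed
  have inj: "A x = A y \<longleftrightarrow> x = y" for x y
  proof
    assume "A x = A y"
    then have "A (x - y) = 0" using lin by (simp add: linear_diff)
    then show "x = y" using An[of "x - y"] by simp
  qed simp
  have 2: "n_lobed n g (\<lambda>s. \<kappa> s) T"
    unfolding n_lobed_def
  proof (intro conjI)
    show "\<exists>a b d. norm a = 1 \<and> norm b = 1 \<and> norm d = 1 \<and> a \<bullet> b = 0 \<and> a \<bullet> d = 0 \<and> b \<bullet> d = 0 \<and>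
      (\<forall>s. g (s + T) \<bullet> d = g s \<bullet> d) \<and> (\<forall>s. Complex (g s \<bullet> a) (g s \<bullet> b) \<noteq> 0) \<and>
      winding_number (\<lambda>x. Complex (g (real n * T * x) \<bullet> a) (g (real n * T * x) \<bullet> b)) 0 = 1"
      by (rule exI[of _ "A e1"], rule exI[of _ "A e2"], rule exI[of _ "A e3"])
        (use E z0 p3 w in \<open>simp add: g_def Ai An\<close>)
  qed (use lobed in \<open>auto simp: n_lobed_def g_def inj\<close>)
  have lt: "\<bar>M x\<bar> < W" for x by (rule axis_height_less[OF lobe_rotation_facts(1)])
  have g3: "g s $ 3 = - M (\<phi> s) / W" for s
    using V_inner(1)[of s] by (simp add: g_def Ac E3_def inner_commute divide_inverse)
  have WM: "W + M x > 0" for x using lt[of x] by linarith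
  have g12: "g s $ 1 * g' s $ 2 - g s $ 2 * g' s $ 1 = P (\<phi> s) / W" for s
  proof -
    have "g s $ 1 * g' s $ 2 - g s $ 2 * g' s $ 1 = cross3 (g s) (g' s) $ 3" by (simp add: cross_components mult.commute)
    also have "\<dots> = N s \<bullet> E3" unfolding gcross by (simp add: Ac)
    also have "\<dots> = P (\<phi> s) / W" using V_inner(3)[of s] by (simp add: E3_def inner_commute divide_inverse)
    finally show ?thesis .
  qed
  have cont: "continuous_on UNIV (phase_density c e r)"
    unfolding phase_density_def[abs_def]
    by (intro continuous_intros continuous_on_axis) (use WM Q_pos in \<open>auto simp: less_imp_neq[THEN not_sym]\<close>)
  obtain J where J: "\<And>x. (J has_real_derivative phase_density c e r x) (at x)"
    using antiderivative_on_reals[OF cont] by blast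
  define I where "I = integral {0..2 * pi} (phase_density c e r)"
  have Jk: "J (x + real k * (2 * pi)) = J x + real k * I" for x k
    unfolding I_def by (rule periodic_antiderivative[OF J]) (simp_all add: phase_density_def axis_periodic speed_sq_periodic)
  have "hopf_torus_conformal_to g (real n * T) (torus_lattice (Complex ((real n * I / 2) / (2 * pi)) (real n * T / (4 * pi))))"
  proof (rule hopf_torus_lattice[of g g' _ "\<lambda>s. - J (\<phi> s) / 2"])
    show "(g has_vector_derivative g' s) (at s)" for s by (rule dg')
    show "continuous_on UNIV g'" using dt' by (meson continuous_at_imp_continuous_on has_vector_derivative_continuous)
    show "norm (g s) = 1" "norm (g' s) = 1" for s by (simp_all add: g_def g'_def An ng nt)
    show "g s $ 3 < 1" for s unfolding g3 using lt[of "\<phi> s"] W_pos by (simp add: field_simps)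
    show "g (s + real n * T) = g s" for s by (simp add: g_def closed)
    show "real n * T > 0" using T_pos n2 by simp
    show "- J (\<phi> (s + real n * T)) / 2 = - J (\<phi> s) / 2 - real n * I / 2" for s
      unfolding phase_shift Jk by (simp add: field_simps)
    show "((\<lambda>s. - J (\<phi> s) / 2) has_real_derivative - (g s $ 1 * g' s $ 2 - g s $ 2 * g' s $ 1) / (2 * (1 - g s $ 3))) (at s)" for s
    proof -
      have "((\<lambda>s. - J (\<phi> s) / 2) has_real_derivative - (phase_density c e r (\<phi> s) * sqrt (Q (\<phi> s))) / 2) (at s)"
        by (intro DERIV_cdivide DERIV_minus DERIV_chain2[OF J d\<phi>])
      moreover have "- (phase_density c e r (\<phi> s) * sqrt (Q (\<phi> s))) / 2 = - (g s $ 1 * g' s $ 2 - g s $ 2 * g' s $ 1) / (2 * (1 - g s $ 3))"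
      proof -
        have "1 - g s $ 3 = (W + M (\<phi> s)) / W" unfolding g3 using W_pos by (simp add: field_simps)
        then show ?thesis unfolding g12 phase_density_def using Q_pos[of "\<phi> s"] W_pos WM[of "\<phi> s"] by simp
      qed
      ultimately show ?thesis by simp
    qed
  qed
  then have "hopf_torus_conformal_to g (real n * T) (torus_lattice (Complex (real n * I / (4 * pi)) (real n * T / (4 * pi))))"
    by simp
  then show ?thesis by (intro that[OF 1 2]) (simp add: I_def)
qed

end

text \<open>The height \<open>- axis_height / axis_norm\<close> of the curve times
  \<open>angle_density\<close>. Its integral over all lobes is the \<open>H\<close> of the
  overview.\<close>

definition height_density :: "real \<Rightarrow> real \<Rightarrow> real \<Rightarrow> real \<Rightarrow> real" where
  "height_density c e r x = - axis_height c e r x * axis_speed c e r x /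
     ((tangent_sq c e r x + (axis_speed c e r x)\<^sup>2) * sqrt (speed_sq c e r x))"

text \<open>With h the height and d\<theta> the angle element this is the area element (1 + h)
  d\<theta>. In the sum the factor W - M cancels, since the squared distance from the axis is
  proportional to (W - M) (W + M).\<close>

lemma phase_density_split:
  assumes "tangent_sq c e r x + (axis_speed c e r x)\<^sup>2 > 0"
  shows "phase_density c e r x = angle_density c e r x + height_density c e r x"
proof -
  define M P q W where "M = axis_height c e r x" and "P = axis_speed c e r x" and "q = sqrt (speed_sq c e r x)"
    and "W = axis_norm c e r"
  have lt: "\<bar>M\<bar> < W" using axis_height_less[OF assms] by (simp add: M_def W_def)
  have eq: "tangent_sq c e r x + P\<^sup>2 = (W - M) * (W + M)"
    using axis_norm_eq[of c e r x] by (simp add: M_def P_def W_def power2_eq_square algebra_simps)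
  have gen: "W * P / z + - M * P / z = ((W - M) * P) / z" for z
    by (simp add: diff_divide_distrib left_diff_distrib)
  have "angle_density c e r x + height_density c e r x = ((W - M) * P) / (((W - M) * (W + M)) * q)"
    unfolding angle_density_def height_density_def M_def[symmetric] P_def[symmetric] q_def[symmetric] W_def[symmetric] eq
    by (rule gen)
  also have "\<dots> = P / ((W + M) * q)" using lt by (simp add: mult.assoc)
  finally show ?thesis by (simp add: phase_density_def M_def P_def q_def W_def)
qed

lemma continuous_on_densities:
  assumes r: "r > 0" and SP: "\<And>x. tangent_sq c e r x + (axis_speed c e r x)\<^sup>2 > 0"
  shows "continuous_on A (angle_density c e r)" "continuous_on A (height_density c e r)"
proof -
  have Q: "speed_sq c e r x > 0" for x using r by (rule speed_sq_pos)
  have c: "continuous_on A (axis_height c e r)" "continuous_on A (axis_speed c e r)"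
    "continuous_on A (tangent_sq c e r)"
    unfolding axis_height_def[abs_def] axis_speed_def[abs_def] tangent_sq_def[abs_def]
    by (intro continuous_intros continuous_on_speed_sq; simp)+
  have ne: "tangent_sq c e r x + (axis_speed c e r x)\<^sup>2 \<noteq> 0" "sqrt (speed_sq c e r x) \<noteq> 0" for x
    using SP[of x] Q[of x] by auto
  show "continuous_on A (angle_density c e r)" "continuous_on A (height_density c e r)"
    unfolding angle_density_def[abs_def] height_density_def[abs_def]
    by (intro continuous_intros continuous_on_speed_sq c; simp add: ne[simplified])+
qed

lemma integral_phase_density:
  assumes r: "r > 0" and SP: "\<And>x. tangent_sq c e r x + (axis_speed c e r x)\<^sup>2 > 0"
  shows "integral {0..2 * pi} (phase_density c e r) =
     integral {0..2 * pi} (angle_density c e r) + integral {0..2 * pi} (height_density c e r)"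
proof -
  have "phase_density c e r = (\<lambda>x. angle_density c e r x + height_density c e r x)"
    using phase_density_split SP by blast
  moreover have "integral {0..2 * pi} (\<lambda>x. angle_density c e r x + height_density c e r x) =
     integral {0..2 * pi} (angle_density c e r) + integral {0..2 * pi} (height_density c e r)"
    by (intro integral_add integrable_continuous_real continuous_on_densities r SP)
  ultimately show ?thesis by simp
qed

text \<open>Transfers the results of the locale to an arbitrary member of the family with
  \<open>e \<noteq> 0\<close>: its curvature and minimal period are the explicit ones. The lattice
  is obtained for a rotated copy \<open>g\<close>, which is a curve for the same parameters.\<close>

lemma lobed_curve_facts:
  assumes n2: "n \<ge> 2" and r0: "r > 0" and e0: "e \<noteq> 0" and ec: "\<bar>e\<bar> < c"
    and par: "elastic_parameters c e r \<mu> lam \<kappa>\<^sub>0"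
    and lob: "n_lobed_constrained_elastic n \<mu> lam \<kappa>\<^sub>0 \<gamma> P"
  shows "tangent_sq c e r x + (axis_speed c e r x)\<^sup>2 > 0"
    and "real n * \<bar>integral {0..2 * pi} (angle_density c e r)\<bar> = 2 * pi"
    and "\<bar>sin (sqrt (1 + c\<^sup>2) * (real n * curvature_period c e r))\<bar> \<le> 2 * \<bar>e\<bar> * (real n * curvature_period c e r)"
    and "cmod (cis (2 * pi / real n) - 1) ^ 2 *
       ((tangent_sq c e r (pi/2) + (axis_speed c e r (pi/2))\<^sup>2) / (axis_norm c e r)\<^sup>2) \<le>
       (3 * \<bar>e\<bar> * curvature_period c e r + \<bar>1 - cos (sqrt (1 + c\<^sup>2) * curvature_period c e r)\<bar>
         + \<bar>sin (sqrt (1 + c\<^sup>2) * curvature_period c e r)\<bar>)\<^sup>2"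
    and "\<exists>g T. n_lobed_constrained_elastic n \<mu> lam \<kappa>\<^sub>0 g T \<and> hopf_torus_conformal_to g (real n * T)
       (torus_lattice (Complex (real n * integral {0..2 * pi} (phase_density c e r) / (4 * pi))
          (real n * curvature_period c e r / (4 * pi))))"
proof -
  obtain \<kappa> where k: "constrained_elastic_curvature \<mu> lam \<kappa>\<^sub>0 \<kappa>" "spherical_curve_with_curvature \<gamma> \<kappa>" "n_lobed n \<gamma> \<kappa> P"
    using lob unfolding n_lobed_constrained_elastic_def by blast
  obtain \<phi> where phi: "\<phi> 0 = 0" "\<And>s. (\<phi> has_real_derivative sqrt (speed_sq c e r (\<phi> s))) (at s)"
    "strict_mono \<phi>" "surj \<phi>" "\<And>s. \<phi> (s + curvature_period c e r) = \<phi> s + 2 * pi"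
    "curvature_period c e r > 0"
    by (rule phase_function[OF r0, of c e], rule that)
  have kk: "\<kappa> = (\<lambda>s. c + e * cos (\<phi> s))"
    using constrained_elastic_curvature_unique[OF k(1) phase_curvature(1)[OF r0 par phi(1,2)]] .
  have T: "P = curvature_period c e r"
  proof (rule minimal_curvature_period[OF e0 phi(1,3,4,5,6), of \<kappa> c])
    show "\<kappa> s = c + e * cos (\<phi> s)" for s by (simp add: kk)
    show "P > 0" "\<kappa> (s + P) = \<kappa> s" for s using k(3) unfolding n_lobed_def by simp_all
    show "\<forall>T'. 0 < T' \<and> T' < P \<longrightarrow> (\<exists>s. \<kappa> (s + T') \<noteq> \<kappa> s)" if "\<not> \<kappa> constant_on UNIV"
      using k(3) that unfolding n_lobed_def by simp
  qed
  obtain t where t: "\<And>s. norm (\<gamma> s) = 1" "\<And>s. norm (t s) = 1" "\<And>s. \<gamma> s \<bullet> t s = 0"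
    "\<And>s. (\<gamma> has_vector_derivative t s) (at s)"
    "\<And>s. (t has_vector_derivative - \<gamma> s + \<kappa> s *\<^sub>R cross3 (\<gamma> s) (t s)) (at s)"
    "\<And>s. ((\<lambda>s. cross3 (\<gamma> s) (t s)) has_vector_derivative - \<kappa> s *\<^sub>R t s) (at s)"
    by (rule spherical_curve_frame[OF k(2)], rule that)
  interpret L: lobed_elastic_curve n \<gamma> t \<phi> c e r
    by (rule lobed_elastic_curve.intro[OF n2 r0 e0 ec phi(1,2,4,5) t(1-4) t(5,6)[unfolded kk] k(3)[unfolded kk T]])
  show "tangent_sq c e r x + (axis_speed c e r x)\<^sup>2 > 0" by (rule L.lobe_rotation_facts(1))
  show "real n * \<bar>integral {0..2 * pi} (angle_density c e r)\<bar> = 2 * pi" by (rule L.lobe_rotation_facts(2))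
  show "\<bar>sin (sqrt (1 + c\<^sup>2) * (real n * curvature_period c e r))\<bar> \<le> 2 * \<bar>e\<bar> * (real n * curvature_period c e r)"
    using L.total_turning_estimate by (simp only: L.\<Omega>_def)
  \<comment> \<open>The chord is measured where \<phi> = pi / 2, the point at which
    \<open>off_axis_bound\<close> controls the distance from the axis.\<close>
  obtain s where s: "\<phi> s = pi / 2" using phi(4) by (metis surjD)
  have "(norm (\<gamma> (s + curvature_period c e r) - \<gamma> s))\<^sup>2 \<le> (3 * \<bar>e\<bar> * curvature_period c e r + \<bar>1 - cos (sqrt (1 + c\<^sup>2) * curvature_period c e r)\<bar>
         + \<bar>sin (sqrt (1 + c\<^sup>2) * curvature_period c e r)\<bar>)\<^sup>2"
    using L.lobe_displacement_estimate[of s] by (intro power_mono) (simp_all add: L.\<Omega>_def)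
  then show "cmod (cis (2 * pi / real n) - 1) ^ 2 *
       ((tangent_sq c e r (pi/2) + (axis_speed c e r (pi/2))\<^sup>2) / (axis_norm c e r)\<^sup>2) \<le>
       (3 * \<bar>e\<bar> * curvature_period c e r + \<bar>1 - cos (sqrt (1 + c\<^sup>2) * curvature_period c e r)\<bar>
         + \<bar>sin (sqrt (1 + c\<^sup>2) * curvature_period c e r)\<bar>)\<^sup>2"
    using L.lobe_rotation_facts(3)[of s] unfolding s by (rule order_trans[rotated])
  obtain g where g: "spherical_curve_with_curvature g \<kappa>" "n_lobed n g \<kappa> (curvature_period c e r)"
    "hopf_torus_conformal_to g (real n * curvature_period c e r) (torus_lattice
       (Complex (real n * integral {0..2 * pi} (phase_density c e r) / (4 * pi)) (real n * curvature_period c e r / (4 * pi))))"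
    unfolding kk by (rule L.standard_position)
  then show "\<exists>g T. n_lobed_constrained_elastic n \<mu> lam \<kappa>\<^sub>0 g T \<and> hopf_torus_conformal_to g (real n * T)
       (torus_lattice (Complex (real n * integral {0..2 * pi} (phase_density c e r) / (4 * pi))
          (real n * curvature_period c e r / (4 * pi))))"
    unfolding n_lobed_constrained_elastic_def using k(1) by (intro exI[of _ g]) (intro exI[of _ "curvature_period c e r"], auto)
qed

section \<open>The homogeneous tori\<close>

lemma has_vector_derivative_real3:
  fixes f :: "real \<Rightarrow> real^3" and f' :: "real^3"
  assumes d: "((\<lambda>s. f s $ 1) has_real_derivative f' $ 1) (at s)" "((\<lambda>s. f s $ 2) has_real_derivative f' $ 2) (at s)"
      "((\<lambda>s. f s $ 3) has_real_derivative f' $ 3) (at s)"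
  shows "(f has_vector_derivative f') (at s)"
proof -
  have "((\<lambda>s. f s $ i) has_derivative (\<lambda>x. x * f' $ i)) (at s)" for i
    using d exhaust_3[of i] by (auto simp: has_field_derivative_def mult_commute_abs)
  then show ?thesis unfolding has_vector_derivative_def
    by (subst has_derivative_componentwise_within) (auto simp: Basis_vec_def inner_axis)
qed

text \<open>An explicit circle of radius 1 / \<open>\<Omega>\<close> at height c /
  \<open>\<Omega>\<close>, along which the fibre phase changes at a constant rate; (\<Omega> - c)
  (\<Omega> + c) = 1 removes the quotient in that rate.\<close>

lemma circle_hopf_torus:
  fixes c \<mu> lam :: real
  assumes n2: "n \<ge> 2" and ode: "c ^ 3 / 2 + (\<mu> + 1/2) * c + lam = 0"
  shows "\<exists>g T. n_lobed_constrained_elastic n \<mu> lam c g T \<and> hopf_torus_conformal_to g (real n * T)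
     (torus_lattice (Complex (1/2 + 2 * pi * c / sqrt (1 + c\<^sup>2) / (4 * pi)) (2 * pi / sqrt (1 + c\<^sup>2) / (4 * pi))))"
proof -
  define \<Omega> where "\<Omega> = sqrt (1 + c\<^sup>2)"
  have \<Omega>: "\<Omega> > 0" "\<Omega>\<^sup>2 = 1 + c\<^sup>2" by (simp_all add: \<Omega>_def add_pos_nonneg)
  have c\<Omega>: "c < \<Omega>"
  proof (rule power2_less_imp_less)
    show "c\<^sup>2 < \<Omega>\<^sup>2" using \<Omega> by simp
  qed (use \<Omega> in simp)
  \<comment> \<open>A constant curvature admits every positive period, so one \<open>n\<close>-th of
    the length is taken as a lobe.\<close>
  define T where "T = 2 * pi / (real n * \<Omega>)"
  have nT: "real n * T = 2 * pi / \<Omega>" using n2 by (simp add: T_def)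
  have T: "T > 0" using n2 \<Omega> by (simp add: T_def)
  define g where "g s = (vector [cos (\<Omega> * s) / \<Omega>, sin (\<Omega> * s) / \<Omega>, c / \<Omega>] :: real^3)" for s
  define g' where "g' s = (vector [- sin (\<Omega> * s), cos (\<Omega> * s), 0] :: real^3)" for s
  define g'' where "g'' s = (vector [- \<Omega> * cos (\<Omega> * s), - \<Omega> * sin (\<Omega> * s), 0] :: real^3)" for s
  have dg: "(g has_vector_derivative g' s) (at s)" for s
    by (rule has_vector_derivative_real3) (use \<Omega>(1) in \<open>auto simp: g_def g'_def intro!: derivative_eq_intros\<close>)
  have dg': "(g' has_vector_derivative g'' s) (at s)" for s
    by (rule has_vector_derivative_real3) (use \<Omega>(1) in \<open>auto simp: g'_def g''_def intro!: derivative_eq_intros\<close>)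
  have scm: "cos x * cos x + sin x * sin x = 1" for x :: real
    using sin_cos_squared_add2[of x] by (simp add: power2_eq_square)
  have sc: "(sin x)\<^sup>2 + (cos x)\<^sup>2 = 1" for x :: real by simp
  have ng: "norm (g s) = 1" for s
  proof -
    have "g s \<bullet> g s = ((sin (\<Omega> * s))\<^sup>2 + (cos (\<Omega> * s))\<^sup>2 + c\<^sup>2) / \<Omega>\<^sup>2"
      by (simp add: g_def inner_vec_def sum_3 power2_eq_square add_divide_distrib)
    also have "\<dots> = 1" unfolding sc using \<Omega> by (metis divide_self less_irrefl zero_less_power)
    finally show ?thesis by (simp add: norm_eq_1)
  qed
  have ng': "norm (g' s) = 1" for s
    using sc[of "\<Omega> * s"] by (simp add: g'_def norm_eq_1 inner_vec_def sum_3 power2_eq_square)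
  have curv: "c = g'' s \<bullet> cross3 (g s) (g' s)" for s
  proof -
    have "g'' s \<bullet> cross3 (g s) (g' s) = c * ((sin (\<Omega> * s))\<^sup>2 + (cos (\<Omega> * s))\<^sup>2)"
      using \<Omega>(1) by (simp add: g_def g'_def g''_def cross3_def inner_vec_def sum_3 power2_eq_square algebra_simps)
        (metis distrib_left mult_1_right scm)
    then show ?thesis unfolding sc by simp
  qed
  have 1: "spherical_curve_with_curvature g (\<lambda>_. c)"
    unfolding spherical_curve_with_curvature_def using ng ng' dg dg' curv by blast
  have 2: "constrained_elastic_curvature \<mu> lam c (\<lambda>_. c)"
    unfolding constrained_elastic_curvature_def using ode
    by (intro conjI exI[of _ "\<lambda>_. 0"]) (auto simp: algebra_simps)
  have closed: "g (s + real n * T) = g s" for s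
  proof -
    have "\<Omega> * (s + real n * T) = \<Omega> * s + 2 * pi" unfolding nT using \<Omega> by (simp add: field_simps)
    then show ?thesis by (simp add: g_def)
  qed
  have 3: "n_lobed n g (\<lambda>_. c) T"
    unfolding n_lobed_def
  proof (intro conjI ballI)
    fix j assume j: "j \<in> {1..<n}"
    show "\<exists>s. g (s + real j * T) \<noteq> g s"
    proof (rule ccontr)
      assume "\<nexists>s. g (s + real j * T) \<noteq> g s"
      then have "g (0 + real j * T) $ 1 = g 0 $ 1" by metis
      then have "cos (\<Omega> * (real j * T)) = 1" using \<Omega> by (simp add: g_def)
      then obtain k :: int where "\<Omega> * (real j * T) = of_int k * 2 * pi" using cos_one_2pi_int by auto
      moreover have "\<Omega> * (real j * T) = real j / real n * (2 * pi)" using \<Omega> n2 by (simp add: T_def)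
      ultimately have "real j / real n * (2 * pi) = of_int k * (2 * pi)" by (metis mult.assoc)
      then have k: "real j / real n = of_int k" by (simp only: mult_cancel_right) simp
      have "0 < real j / real n" "real j / real n < 1" using j n2 by (auto simp: field_simps)
      then show False unfolding k by simp
    qed
  next
    have path: "(\<lambda>x. Complex (g (real n * T * x) \<bullet> axis 1 1) (g (real n * T * x) \<bullet> axis 2 1)) = circlepath 0 (1 / \<Omega>)"
    proof
      fix x
      have e: "\<Omega> * (real n * T * x) = 2 * pi * x" unfolding nT using \<Omega> by simp
      show "Complex (g (real n * T * x) \<bullet> axis 1 1) (g (real n * T * x) \<bullet> axis 2 1) = circlepath 0 (1 / \<Omega>) x"
        unfolding g_def e by (simp add: circlepath inner_axis complex_eq_iff Re_exp Im_exp)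
    qed
    have wn: "winding_number (circlepath 0 (1 / \<Omega>)) 0 = 1"
      using \<Omega> by (intro winding_number_circlepath) simp
    have ne: "Complex (g s \<bullet> axis 1 1) (g s \<bullet> axis 2 1) \<noteq> 0" for s
    proof -
      have "cos (\<Omega> * s) \<noteq> 0 \<or> sin (\<Omega> * s) \<noteq> 0"
        by (metis scm add_0 mult_zero_left zero_neq_one)
      then show ?thesis using \<Omega>(1) by (auto simp: g_def inner_axis complex_eq_iff)
    qed
    have ax: "(axis 1 1 :: real^3) \<bullet> axis 2 1 = 0" "(axis 1 1 :: real^3) \<bullet> axis 3 1 = 0" "(axis 2 1 :: real^3) \<bullet> axis 3 1 = 0"
      by (simp_all add: inner_axis_axis)
    have h3: "g (s + T) \<bullet> axis 3 1 = g s \<bullet> axis 3 1" for s by (simp add: g_def inner_axis)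
    show "\<exists>e\<^sub>1 e\<^sub>2 e\<^sub>3. norm e\<^sub>1 = 1 \<and> norm e\<^sub>2 = 1 \<and> norm e\<^sub>3 = 1 \<and>
        e\<^sub>1 \<bullet> e\<^sub>2 = 0 \<and> e\<^sub>1 \<bullet> e\<^sub>3 = 0 \<and> e\<^sub>2 \<bullet> e\<^sub>3 = 0 \<and>
        (\<forall>s. g (s + T) \<bullet> e\<^sub>3 = g s \<bullet> e\<^sub>3) \<and>
        (\<forall>s. Complex (g s \<bullet> e\<^sub>1) (g s \<bullet> e\<^sub>2) \<noteq> 0) \<and>
        winding_number (\<lambda>t. Complex (g (real n * T * t) \<bullet> e\<^sub>1) (g (real n * T * t) \<bullet> e\<^sub>2)) 0 = 1"
      by (rule exI[of _ "axis 1 1"], rule exI[of _ "axis 2 1"], rule exI[of _ "axis 3 1"])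
        (use ne wn path ax h3 in \<open>simp add: norm_axis_1\<close>)
  qed (use T closed in \<open>auto simp: constant_on_def\<close>)
  have "hopf_torus_conformal_to g (real n * T) (torus_lattice (Complex ((pi * (1 + c / \<Omega>)) / (2 * pi)) (real n * T / (4 * pi))))"
  proof (rule hopf_torus_lattice[of g g' _ "\<lambda>s. - (1 + c / \<Omega>) * \<Omega> * s / 2"])
    show "continuous_on UNIV g'" using dg' by (meson continuous_at_imp_continuous_on has_vector_derivative_continuous)
    show "g s $ 3 < 1" for s using c\<Omega> \<Omega> by (simp add: g_def)
    show "- (1 + c / \<Omega>) * \<Omega> * (s + real n * T) / 2 = - (1 + c / \<Omega>) * \<Omega> * s / 2 - pi * (1 + c / \<Omega>)" for s
      unfolding nT using \<Omega> by (simp add: field_simps)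
    show "((\<lambda>s. - (1 + c / \<Omega>) * \<Omega> * s / 2) has_real_derivative
       - (g s $ 1 * g' s $ 2 - g s $ 2 * g' s $ 1) / (2 * (1 - g s $ 3))) (at s)" for s
    proof -
      have "g s $ 1 * g' s $ 2 - g s $ 2 * g' s $ 1 = ((sin (\<Omega> * s))\<^sup>2 + (cos (\<Omega> * s))\<^sup>2) / \<Omega>"
        by (simp add: g_def g'_def power2_eq_square add_divide_distrib)
      then have e: "g s $ 1 * g' s $ 2 - g s $ 2 * g' s $ 1 = 1 / \<Omega>" unfolding sc .
      have "(1 + c / \<Omega>) * \<Omega> * (1 - c / \<Omega>) = (\<Omega>\<^sup>2 - c\<^sup>2) / \<Omega>"
        using \<Omega>(1) by (simp add: field_simps power2_eq_square)
      then have f: "(1 + c / \<Omega>) * \<Omega> * (1 - c / \<Omega>) = 1 / \<Omega>" unfolding \<Omega>(2) by simp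
      have g3: "g s $ 3 = c / \<Omega>" by (simp add: g_def)
      have pos: "1 - c / \<Omega> > 0" using c\<Omega> \<Omega> by simp
      have "((\<lambda>s. - (1 + c / \<Omega>) * \<Omega> * s / 2) has_real_derivative - (1 + c / \<Omega>) * \<Omega> / 2) (at s)"
        by (auto intro!: derivative_eq_intros)
      moreover have "- (1 + c / \<Omega>) * \<Omega> / 2 = - (1 / \<Omega>) / (2 * (1 - c / \<Omega>))"
      proof -
        have "- a * b / 2 = - (a * b * q) / (2 * q)" if "q > 0" for a b q :: real using that by simp
        from this[OF pos, of "1 + c / \<Omega>" \<Omega>] show ?thesis unfolding f .
      qed
      ultimately show ?thesis unfolding e g3 by simp
    qed
  qed (use dg ng ng' closed n2 T in auto)
  moreover have "(pi * (1 + c / \<Omega>)) / (2 * pi) = 1/2 + 2 * pi * c / \<Omega> / (4 * pi)"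
    using \<Omega> by (simp add: field_simps)
  moreover have "n_lobed_constrained_elastic n \<mu> lam c g T"
    unfolding n_lobed_constrained_elastic_def by (intro exI[of _ "\<lambda>_. c"] conjI 1 2 3)
  ultimately show ?thesis
    unfolding \<Omega>_def[symmetric] by (intro exI[of _ g], intro exI[of _ T]) (simp add: nT)
qed

section \<open>Dependence on the parameters\<close>

lemma continuous_on_integral_param:
  fixes f :: "'a::topological_space \<Rightarrow> real \<Rightarrow> real"
  assumes "continuous_on (U \<times> UNIV) (\<lambda>q. f (fst q) (snd q))"
  shows "continuous_on U (\<lambda>p. integral {a..b} (f p))"
proof -
  have "continuous_on (U \<times> cbox a b) (\<lambda>(p, x). f p x)"
    unfolding case_prod_beta by (rule continuous_on_subset[OF assms]) auto
  from integral_continuous_on_param[OF this] show ?thesis by (simp add: cbox_interval)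
qed

lemma continuous_on_curvature_period:
  "continuous_on {p. 0 < snd (snd p)} (\<lambda>p. curvature_period (fst p) (fst (snd p)) (snd (snd p)))"
proof -
  have "continuous_on ({p :: real \<times> real \<times> real. 0 < snd (snd p)} \<times> UNIV)
    (\<lambda>q. 1 / sqrt (speed_sq (fst (fst q)) (fst (snd (fst q))) (snd (snd (fst q))) (snd q)))"
  proof -
    have "sqrt (speed_sq (fst (fst q)) (fst (snd (fst q))) (snd (snd (fst q))) (snd q)) \<noteq> 0"
      if "q \<in> {p :: real \<times> real \<times> real. 0 < snd (snd p)} \<times> UNIV" for q
    proof -
      have "0 < snd (snd (fst q))" using that by auto
      from speed_sq_pos[OF this, of "fst (fst q)" "fst (snd (fst q))" "snd q"] show ?thesis by simp
    qed
    then show ?thesis unfolding speed_sq_def by (intro continuous_intros) auto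
  qed
  then show ?thesis unfolding curvature_period_def by (rule continuous_on_integral_param)
qed

text \<open>The value \<open>r = 4\<close> is the resonance: there the axis vector of a circle
  vanishes and the phase period equals one full turn. The last condition bounds the oscillation of
  \<open>axis_speed\<close> around \<open>r / 4 - 1\<close>, so that \<open>axis_speed\<close> has
  no zero.\<close>

definition nonresonant :: "(real \<times> real \<times> real) set" where
  "nonresonant = {p. 0 < fst p} \<inter> {p. \<bar>fst (snd p)\<bar> < fst p} \<inter> {p. 0 < snd (snd p)} \<inter>
     {p. (fst (snd p))\<^sup>2 / 4 + fst p * \<bar>fst (snd p)\<bar> < \<bar>snd (snd p) / 4 - 1\<bar>}"

lemma open_nonresonant: "open nonresonant"
  unfolding nonresonant_def by (intro open_Int open_Collect_less continuous_intros) auto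

lemma nonresonantD:
  assumes "(c, e, r) \<in> nonresonant"
  shows "0 < c" "\<bar>e\<bar> < c" "0 < r" "axis_speed c e r x \<noteq> 0" "r > 4 \<Longrightarrow> axis_speed c e r x > 0"
    "tangent_sq c e r x + (axis_speed c e r x)\<^sup>2 > 0"
proof -
  show a: "0 < c" "\<bar>e\<bar> < c" "0 < r" using assms by (auto simp: nonresonant_def)
  have b: "e\<^sup>2 / 4 + c * \<bar>e\<bar> < \<bar>r / 4 - 1\<bar>" using assms by (auto simp: nonresonant_def)
  have eq: "axis_speed c e r x = (r / 4 - 1) + (c * e * cos x + e\<^sup>2 * ((cos x)\<^sup>2 / 2 - 1/4))"
    by (simp add: axis_speed_def power2_eq_square field_simps)
  have "\<bar>c * e * cos x\<bar> \<le> c * \<bar>e\<bar>"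
    using a abs_cos_le_one[of x] by (simp add: abs_mult mult_left_le)
  moreover have "\<bar>e\<^sup>2 * ((cos x)\<^sup>2 / 2 - 1/4)\<bar> \<le> e\<^sup>2 * (1/4)"
  proof -
    have "(cos x)\<^sup>2 \<le> 1" by (simp add: abs_square_le_1)
    then have "\<bar>(cos x)\<^sup>2 / 2 - 1/4\<bar> \<le> 1/4" using zero_le_power2[of "cos x"] by linarith
    from mult_left_mono[OF this zero_le_power2[of e]] show ?thesis by (simp only: abs_mult abs_power2)
  qed
  ultimately have d: "\<bar>c * e * cos x + e\<^sup>2 * ((cos x)\<^sup>2 / 2 - 1/4)\<bar> < \<bar>r / 4 - 1\<bar>" using b by linarith
  then show 1: "axis_speed c e r x \<noteq> 0" unfolding eq by linarith
  show "axis_speed c e r x > 0" if "r > 4" unfolding eq using d that by linarith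
  show "tangent_sq c e r x + (axis_speed c e r x)\<^sup>2 > 0"
    using 1 speed_sq_pos[OF a(3), of c e x] by (intro add_nonneg_pos) (auto simp: tangent_sq_def intro!: mult_nonneg_nonneg)
qed

lemma continuous_on_param_axis:
  fixes U :: "((real \<times> real \<times> real) \<times> real) set"
  shows "continuous_on U (\<lambda>q. axis_height (fst (fst q)) (fst (snd (fst q))) (snd (snd (fst q))) (snd q))"
    "continuous_on U (\<lambda>q. axis_speed (fst (fst q)) (fst (snd (fst q))) (snd (snd (fst q))) (snd q))"
    "continuous_on U (\<lambda>q. tangent_sq (fst (fst q)) (fst (snd (fst q))) (snd (snd (fst q))) (snd q))"
    "continuous_on U (\<lambda>q. speed_sq (fst (fst q)) (fst (snd (fst q))) (snd (snd (fst q))) (snd q))"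
    "continuous_on U (\<lambda>q. axis_norm (fst (fst q)) (fst (snd (fst q))) (snd (snd (fst q))))"
  unfolding axis_height_def axis_speed_def tangent_sq_def speed_sq_def axis_norm_def
  by (intro continuous_intros; simp)+

lemma continuous_on_angle_height:
  "continuous_on nonresonant (\<lambda>p. integral {0..2 * pi} (angle_density (fst p) (fst (snd p)) (snd (snd p))))"
  "continuous_on nonresonant (\<lambda>p. integral {0..2 * pi} (height_density (fst p) (fst (snd p)) (snd (snd p))))"
proof -
  have ne: "tangent_sq (fst (fst q)) (fst (snd (fst q))) (snd (snd (fst q))) (snd q) + (axis_speed (fst (fst q)) (fst (snd (fst q))) (snd (snd (fst q))) (snd q))\<^sup>2 \<noteq> 0"
     "speed_sq (fst (fst q)) (fst (snd (fst q))) (snd (snd (fst q))) (snd q) \<noteq> 0"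
    if "q \<in> nonresonant \<times> UNIV" for q
  proof -
    have "(fst (fst q), fst (snd (fst q)), snd (snd (fst q))) \<in> nonresonant" using that by auto
    note d = nonresonantD[OF this]
    show "tangent_sq (fst (fst q)) (fst (snd (fst q))) (snd (snd (fst q))) (snd q) + (axis_speed (fst (fst q)) (fst (snd (fst q))) (snd (snd (fst q))) (snd q))\<^sup>2 \<noteq> 0"
      using d(6)[of "snd q"] by linarith
    show "speed_sq (fst (fst q)) (fst (snd (fst q))) (snd (snd (fst q))) (snd q) \<noteq> 0"
      using speed_sq_pos[OF d(3)] by (metis less_irrefl)
  qed
  show "continuous_on nonresonant (\<lambda>p. integral {0..2 * pi} (angle_density (fst p) (fst (snd p)) (snd (snd p))))"
  proof (rule continuous_on_integral_param)
    show "continuous_on (nonresonant \<times> UNIV) (\<lambda>q. angle_density (fst (fst q)) (fst (snd (fst q))) (snd (snd (fst q))) (snd q))"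
      unfolding angle_density_def by (intro continuous_intros continuous_on_param_axis) (use ne in auto)
  qed
  show "continuous_on nonresonant (\<lambda>p. integral {0..2 * pi} (height_density (fst p) (fst (snd p)) (snd (snd p))))"
  proof (rule continuous_on_integral_param)
    show "continuous_on (nonresonant \<times> UNIV) (\<lambda>q. height_density (fst (fst q)) (fst (snd (fst q))) (snd (snd (fst q))) (snd q))"
      unfolding height_density_def by (intro continuous_intros continuous_on_param_axis) (use ne in auto)
  qed
qed

text \<open>At \<open>e = 0\<close> all the data are constant in \<open>x\<close>. The absolute
  value accounts for the sign of \<open>r / 4 - 1\<close>.\<close>

lemma circle_values:
  assumes c: "c > 0" and r: "r > 0"
  shows "curvature_period c 0 r = 2 * pi / sqrt (c\<^sup>2 + r / 4)"
    and "r \<noteq> 4 \<Longrightarrow> \<bar>integral {0..2 * pi} (angle_density c 0 r)\<bar> = 2 * pi * sqrt (1 + c\<^sup>2) / sqrt (c\<^sup>2 + r / 4)"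
    and "r \<noteq> 4 \<Longrightarrow> integral {0..2 * pi} (height_density c 0 r) = 2 * pi * c / sqrt (c\<^sup>2 + r / 4)"
    and "axis_norm c 0 r = \<bar>r / 4 - 1\<bar> * sqrt (1 + c\<^sup>2)"
    and "axis_height c 0 r x = - c * (r / 4 - 1)" and "axis_speed c 0 r x = r / 4 - 1"
    and "tangent_sq c 0 r x = 0" and "speed_sq c 0 r x = c\<^sup>2 + r / 4"
proof -
  show Q: "speed_sq c 0 r x = c\<^sup>2 + r / 4" for x by (simp add: speed_sq_def power2_eq_square)
  show S: "tangent_sq c 0 r x = 0" for x by (simp add: tangent_sq_def)
  show P: "axis_speed c 0 r x = r / 4 - 1" for x by (simp add: axis_speed_def power2_eq_square field_simps)
  show M: "axis_height c 0 r x = - c * (r / 4 - 1)" for x by (simp add: axis_height_def field_simps)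
  show W: "axis_norm c 0 r = \<bar>r / 4 - 1\<bar> * sqrt (1 + c\<^sup>2)"
  proof -
    have "(axis_height c 0 r 0)\<^sup>2 + (axis_speed c 0 r 0)\<^sup>2 = (r / 4 - 1)\<^sup>2 * (1 + c\<^sup>2)"
      unfolding M P by (simp add: power_mult_distrib distrib_left)
    then show ?thesis by (simp add: axis_norm_def real_sqrt_mult)
  qed
  show "curvature_period c 0 r = 2 * pi / sqrt (c\<^sup>2 + r / 4)"
    unfolding curvature_period_def Q by simp
  assume r4: "r \<noteq> 4"
  define s where "s = r / 4 - 1"
  have s: "s \<noteq> 0" using r4 by (simp add: s_def)
  define w where "w = sqrt (c\<^sup>2 + r / 4)"
  have w: "w > 0" using c r by (simp add: w_def add_pos_pos)
  have "angle_density c 0 r = (\<lambda>x. \<bar>s\<bar> * sqrt (1 + c\<^sup>2) * s / (s\<^sup>2 * w))"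
    unfolding angle_density_def Q S P W s_def[symmetric] w_def[symmetric] by simp
  then have "\<bar>integral {0..2 * pi} (angle_density c 0 r)\<bar> = 2 * pi * \<bar>\<bar>s\<bar> * sqrt (1 + c\<^sup>2) * s / (s\<^sup>2 * w)\<bar>"
    by (simp add: abs_mult)
  also have "\<bar>\<bar>s\<bar> * sqrt (1 + c\<^sup>2) * s / (s\<^sup>2 * w)\<bar> = \<bar>s\<bar> * \<bar>s\<bar> * sqrt (1 + c\<^sup>2) / (s\<^sup>2 * w)"
    using w by (simp add: abs_mult)
  also have "\<dots> = sqrt (1 + c\<^sup>2) / w" using s by (simp add: power2_eq_square)
  finally show "\<bar>integral {0..2 * pi} (angle_density c 0 r)\<bar> = 2 * pi * sqrt (1 + c\<^sup>2) / sqrt (c\<^sup>2 + r / 4)"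
    by (simp add: w_def)
  have "height_density c 0 r = (\<lambda>x. c * s * s / (s\<^sup>2 * w))"
    unfolding height_density_def Q S P M s_def[symmetric] w_def[symmetric] by simp
  also have "\<dots> = (\<lambda>x. c / w)" using s by (simp add: power2_eq_square fun_eq_iff)
  finally show "integral {0..2 * pi} (height_density c 0 r) = 2 * pi * c / sqrt (c\<^sup>2 + r / 4)"
    by (simp add: w_def)
qed

text \<open>A bound independent of \<open>r\<close> and of \<open>e\<close> is the point: as
  \<open>e\<close> tends to 0 and \<open>r\<close> to 4 numerator and denominator both tend to zero.
  At \<open>pi/2\<close> the height is - c P - c e^2 / 2, whose square is at most 2 c^2 P^2 + S when
  \<open>e\<^sup>2 \<le> 2\<close>.\<close>

lemma off_axis_bound:
  assumes c: "c > 0" and r: "r > 0" and e: "e \<noteq> 0" "e\<^sup>2 \<le> 2"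
  shows "1 / (2 * c\<^sup>2 + 2) \<le> (tangent_sq c e r (pi/2) + (axis_speed c e r (pi/2))\<^sup>2) / (axis_norm c e r)\<^sup>2"
proof -
  define S P M where "S = tangent_sq c e r (pi/2)" and "P = axis_speed c e r (pi/2)" and "M = axis_height c e r (pi/2)"
  have W: "(axis_norm c e r)\<^sup>2 = M\<^sup>2 + S + P\<^sup>2" using axis_norm_eq[of c e r "pi/2"] by (simp add: S_def P_def M_def)
  have S: "S = e\<^sup>2 * (c\<^sup>2 + r / 4)" by (simp add: S_def tangent_sq_def speed_sq_def power2_eq_square field_simps)
  have S0: "S > 0" unfolding S using c r e by (simp add: add_pos_pos)
  have P: "P = r / 4 - 1 - e\<^sup>2 / 4" by (simp add: P_def axis_speed_def field_simps)
  have M: "M = - (c * P) - c * e\<^sup>2 / 2" unfolding P by (simp add: M_def axis_height_def field_simps)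
  have "M\<^sup>2 = 2 * (c * P)\<^sup>2 + 2 * (c * e\<^sup>2 / 2)\<^sup>2 - (c * P - c * e\<^sup>2 / 2)\<^sup>2"
    unfolding M by (simp add: power2_eq_square field_simps)
  also have "\<dots> \<le> 2 * (c * P)\<^sup>2 + 2 * (c * e\<^sup>2 / 2)\<^sup>2" by simp
  also have "2 * (c * e\<^sup>2 / 2)\<^sup>2 = (e\<^sup>2 / 2) * (e\<^sup>2 * c\<^sup>2)" by (simp add: power2_eq_square)
  also have "\<dots> \<le> 1 * (e\<^sup>2 * (c\<^sup>2 + r / 4))" using e r by (intro mult_mono) auto
  also have "\<dots> = S" by (simp add: S)
  also have "2 * (c * P)\<^sup>2 + S \<le> (2 * c\<^sup>2 + 1) * (S + P\<^sup>2)"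
    using S0 by (simp add: power_mult_distrib algebra_simps)
  finally have "M\<^sup>2 + S + P\<^sup>2 \<le> (2 * c\<^sup>2 + 2) * (S + P\<^sup>2)" by (simp add: algebra_simps)
  moreover have "M\<^sup>2 + S + P\<^sup>2 > 0" using S0 by (simp add: add_pos_nonneg add_nonneg_pos)
  moreover have "2 * c\<^sup>2 + 2 > 0" by (simp add: add_nonneg_pos)
  ultimately have "1 / (2 * c\<^sup>2 + 2) \<le> (S + P\<^sup>2) / (M\<^sup>2 + S + P\<^sup>2)"
    by (simp add: pos_divide_le_eq pos_le_divide_eq mult.commute)
  then show ?thesis unfolding W by (simp add: S_def P_def)
qed

text \<open>As 1 < pi / 3, the cosine is at least 1/2 on the interval, so 2 sin v - v
  increases.\<close>

lemma abs_le_twice_abs_sin: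
  fixes u :: real
  assumes "\<bar>u\<bar> \<le> 1"
  shows "\<bar>u\<bar> \<le> 2 * \<bar>sin u\<bar>"
proof -
  have main: "v \<le> 2 * sin v" if v: "0 \<le> v" "v \<le> 1" for v :: real
  proof -
    have "2 * sin 0 - 0 \<le> 2 * sin v - v"
    proof (rule DERIV_nonneg_imp_nondecreasing[OF v(1)])
      fix x assume x: "0 \<le> x" "x \<le> v"
      have "pi > 3" by (rule pi_gt3)
      then have "cos (pi / 3) \<le> cos x" using x v by (intro cos_monotone_0_pi_le) auto
      then have "0 \<le> 2 * cos x - 1" by (simp add: cos_60)
      moreover have "((\<lambda>x. 2 * sin x - x) has_real_derivative 2 * cos x - 1) (at x)"
        by (auto intro!: derivative_eq_intros)
      ultimately show "\<exists>y. ((\<lambda>x. 2 * sin x - x) has_real_derivative y) (at x) \<and> 0 \<le> y" by blast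
    qed
    then show ?thesis by simp
  qed
  have nn: "0 \<le> sin \<bar>u\<bar>" using main[of "\<bar>u\<bar>"] assms by simp
  have "\<bar>sin u\<bar> = sin \<bar>u\<bar>" using nn by (cases "u \<ge> 0") auto
  then show ?thesis using main[of "\<bar>u\<bar>"] assms by simp
qed

text \<open>For \<open>r \<ge> 4\<close> both speeds are at least 1, so taking roots and reciprocals
  does not enlarge differences; the squared speeds differ by (e cos x) (c + e cos x / 4).\<close>

lemma curvature_period_estimate:
  assumes c: "c > 0" and r: "r \<ge> 4" and e: "\<bar>e\<bar> \<le> c"
  shows "\<bar>curvature_period c e r - 2 * pi / sqrt (c\<^sup>2 + r / 4)\<bar> \<le> 2 * pi * (2 * c * \<bar>e\<bar>)"
    and "curvature_period c e r \<le> 2 * pi"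
proof -
  define w where "w = sqrt (c\<^sup>2 + r / 4)"
  have "1 \<le> c\<^sup>2 + r / 4" using r zero_le_power2[of c] by linarith
  then have w1: "w \<ge> 1" by (simp add: w_def)
  have r0: "r > 0" using r by simp
  have q1: "sqrt (speed_sq c e r x) \<ge> 1" for x
    using r by (simp add: speed_sq_def add_increasing)
  have est: "\<bar>1 / sqrt (speed_sq c e r x) - 1 / w\<bar> \<le> 2 * c * \<bar>e\<bar>" for x
  proof -
    define q where "q = sqrt (speed_sq c e r x)"
    have q1': "q \<ge> 1" using q1 by (simp add: q_def)
    have q2: "q\<^sup>2 = speed_sq c e r x" unfolding q_def using speed_sq_pos[OF r0, of c e x] by simp
    have w2: "w\<^sup>2 = c\<^sup>2 + r / 4" unfolding w_def using r by (simp add: add_nonneg_nonneg)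
    have "w\<^sup>2 - q\<^sup>2 = - (e * cos x) * (c + (e * cos x) / 4)"
      unfolding w2 q2 speed_sq_def by (simp add: power2_eq_square field_simps)
    then have "\<bar>w\<^sup>2 - q\<^sup>2\<bar> = \<bar>e * cos x\<bar> * \<bar>c + (e * cos x) / 4\<bar>" by (simp add: abs_mult)
    also have "\<dots> \<le> \<bar>e\<bar> * (2 * c)"
    proof (rule mult_mono)
      show 1: "\<bar>e * cos x\<bar> \<le> \<bar>e\<bar>" using abs_cos_le_one[of x] by (simp add: abs_mult mult_left_le)
      show "\<bar>c + (e * cos x) / 4\<bar> \<le> 2 * c" using 1 e c by linarith
    qed auto
    finally have 1: "\<bar>w\<^sup>2 - q\<^sup>2\<bar> \<le> 2 * c * \<bar>e\<bar>" by (simp add: mult.commute mult.left_commute)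
    have "\<bar>w - q\<bar> * 1 \<le> \<bar>w - q\<bar> * (w + q)" using w1 q1' by (intro mult_left_mono) auto
    also have "\<dots> = \<bar>w\<^sup>2 - q\<^sup>2\<bar>"
      using w1 q1' by (simp add: power2_eq_square square_diff_square_factored abs_mult mult.commute)
    finally have 2: "\<bar>w - q\<bar> \<le> 2 * c * \<bar>e\<bar>" using 1 by simp
    have "\<bar>1 / q - 1 / w\<bar> = \<bar>w - q\<bar> / (q * w)" using q1' w1 by (simp add: diff_frac_eq abs_divide)
    also have "\<dots> \<le> \<bar>w - q\<bar> / 1"
      using mult_mono[of 1 q 1 w] q1' w1 by (intro divide_left_mono) auto
    finally show ?thesis using 2 by (simp add: q_def)
  qed
  have int: "(\<lambda>x. 1 / sqrt (speed_sq c e r x)) integrable_on {0..2 * pi}"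
  proof (rule integrable_continuous_real)
    have "sqrt (speed_sq c e r x) \<noteq> 0" for x using q1[of x] by linarith
    then show "continuous_on {0..2 * pi} (\<lambda>x. 1 / sqrt (speed_sq c e r x))"
      by (intro continuous_on_divide continuous_on_const continuous_on_real_sqrt continuous_on_speed_sq) auto
  qed
  have "curvature_period c e r - 2 * pi / w = integral {0..2 * pi} (\<lambda>x. 1 / sqrt (speed_sq c e r x)) - integral {0..2 * pi} (\<lambda>x. 1 / w)"
    by (simp add: curvature_period_def)
  also have "\<dots> = integral {0..2 * pi} (\<lambda>x. 1 / sqrt (speed_sq c e r x) - 1 / w)"
    by (rule integral_diff[symmetric]) (use int in auto)
  finally have "\<bar>curvature_period c e r - 2 * pi / w\<bar> = norm (integral {0..2 * pi} (\<lambda>x. 1 / sqrt (speed_sq c e r x) - 1 / w))"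
    by simp
  also have "\<dots> \<le> integral {0..2 * pi} (\<lambda>x. 2 * c * \<bar>e\<bar>)"
    by (rule integral_norm_bound_integral) (use int est in \<open>auto intro!: integrable_diff\<close>)
  also have "\<dots> = 2 * pi * (2 * c * \<bar>e\<bar>)" by simp
  finally show "\<bar>curvature_period c e r - 2 * pi / sqrt (c\<^sup>2 + r / 4)\<bar> \<le> 2 * pi * (2 * c * \<bar>e\<bar>)" by (simp add: w_def)
  have "curvature_period c e r \<le> integral {0..2 * pi} (\<lambda>x. 1)"
    unfolding curvature_period_def
    by (rule integral_le) (use int q1 in \<open>auto simp: divide_le_eq_1\<close>)
  then show "curvature_period c e r \<le> 2 * pi" by simp
qed

text \<open>The isoperimetric inequality \<open>L\<^sup>2 + H\<^sup>2 > 4 \<pi>\<^sup>2\<close> for noncircular curves near a circle. Linearized at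
  the circle of height \<open>axis_height c e r (\<pi>/2) / axis_norm c e r\<close> it asks for a positive integral, whose
  integrand is \<open>e\<^sup>2\<close> times a continuous function.\<close>

definition iso_radius :: "real \<Rightarrow> real \<Rightarrow> real \<Rightarrow> real" where
  "iso_radius c e r = sqrt ((tangent_sq c e r (pi/2) + (axis_speed c e r (pi/2))\<^sup>2) / (axis_norm c e r)\<^sup>2)"

text \<open>The angular velocity in arclength times 1 - h y, where y is the height of the curve and
  h that of the reference circle. On a circle it equals \<open>iso_radius\<close>.\<close>

definition iso_cross :: "real \<Rightarrow> real \<Rightarrow> real \<Rightarrow> real \<Rightarrow> real" where
  "iso_cross c e r x = ((axis_norm c e r)\<^sup>2 - axis_height c e r (pi/2) * axis_height c e r x) * axis_speed c e r x /
     (axis_norm c e r * (tangent_sq c e r x + (axis_speed c e r x)\<^sup>2))"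

text \<open>The difference \<open>iso_radius - iso_cross\<close>, written as a difference of squares
  over a sum, divided by the speed and by e^2. The factor e^2 is cancelled algebraically, which
  keeps the quotient continuous at \<open>e = 0\<close>.\<close>

definition iso_density :: "real \<Rightarrow> real \<Rightarrow> real \<Rightarrow> real \<Rightarrow> real" where
  "iso_density c e r x =
     ((iso_radius c e r)\<^sup>2 * (speed_sq c e r x * (sin x)\<^sup>2) * (tangent_sq c e r x + (axis_speed c e r x)\<^sup>2)
        - (cos x)\<^sup>2 * (axis_speed c e r x)\<^sup>2) /
     ((tangent_sq c e r x + (axis_speed c e r x)\<^sup>2)\<^sup>2 * (iso_radius c e r + iso_cross c e r x) * sqrt (speed_sq c e r x))"

lemma nonresonant_iso_pos:
  assumes p: "(c, e, r) \<in> nonresonant" and r: "r > 4"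
  shows "axis_norm c e r > 0" "iso_radius c e r > 0" "iso_cross c e r x > 0"
proof -
  note d = nonresonantD[OF p]
  have lt: "\<bar>axis_height c e r x\<bar> < axis_norm c e r" for x by (rule axis_height_less[OF d(6)])
  show W: "axis_norm c e r > 0" using lt[of 0] by linarith
  show "iso_radius c e r > 0" unfolding iso_radius_def using d(6)[of "pi/2"] W by simp
  have "axis_height c e r (pi/2) * axis_height c e r x \<le> \<bar>axis_height c e r (pi/2)\<bar> * \<bar>axis_height c e r x\<bar>"
    by (metis abs_ge_self abs_mult)
  also have "\<dots> < axis_norm c e r * axis_norm c e r"
    using lt[of x] lt[of "pi/2"] by (intro mult_strict_mono') auto
  finally have "(axis_norm c e r)\<^sup>2 - axis_height c e r (pi/2) * axis_height c e r x > 0" by (simp add: power2_eq_square)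
  then show "iso_cross c e r x > 0" unfolding iso_cross_def using d(5)[OF r, of x] d(6)[of x] W by simp
qed

text \<open>Rests on (W^2 - m M)^2 = (W^2 - m^2) (W^2 - M^2) + W^2 (M - m)^2. Both deviations from
  the circle are of second order, since M - m = e cos x and the tangential part \<open>S\<close>
  contains e^2.\<close>

lemma iso_density_eq:
  assumes p: "(c, e, r) \<in> nonresonant" and r: "r > 4"
  shows "iso_radius c e r * (1 / sqrt (speed_sq c e r x))
     + (- axis_height c e r (pi/2) / axis_norm c e r) * height_density c e r x - angle_density c e r x
     = e\<^sup>2 * iso_density c e r x"
proof -
  note d = nonresonantD[OF p]
  note ip = nonresonant_iso_pos[OF p r]
  define S P M m W D q s B where "S = tangent_sq c e r x" and "P = axis_speed c e r x" and "M = axis_height c e r x"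
    and "m = axis_height c e r (pi/2)" and "W = axis_norm c e r" and "D = S + P\<^sup>2" and "q = sqrt (speed_sq c e r x)"
    and "s = iso_radius c e r" and "B = iso_cross c e r x"
  have D: "D > 0" using d(6)[of x] by (simp add: D_def S_def P_def)
  have W: "W > 0" and s: "s > 0" and B0: "B > 0" using ip(1,2) ip(3)[of x] by (simp_all add: W_def s_def B_def)
  have q: "q > 0" using speed_sq_pos[OF d(3), of c e x] by (simp add: q_def)
  have WM: "W\<^sup>2 - M\<^sup>2 = D" using axis_norm_eq[of c e r x] by (simp add: W_def M_def D_def S_def P_def)
  have s2: "W\<^sup>2 * s\<^sup>2 = W\<^sup>2 - m\<^sup>2"
  proof -
    have "s\<^sup>2 = (tangent_sq c e r (pi/2) + (axis_speed c e r (pi/2))\<^sup>2) / W\<^sup>2"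
      unfolding s_def iso_radius_def W_def using d(6)[of "pi/2"] by simp
    then show ?thesis using axis_norm_eq[of c e r "pi/2"] W by (simp add: W_def m_def)
  qed
  have Mm: "M - m = e * cos x" by (simp add: M_def m_def axis_height_def)
  have SS: "S = e\<^sup>2 * (speed_sq c e r x * (sin x)\<^sup>2)" by (simp add: S_def tangent_sq_def)
  have Bd: "B = (W\<^sup>2 - m * M) * P / (W * D)" by (simp add: B_def iso_cross_def W_def m_def M_def P_def D_def S_def)
  have "(W\<^sup>2 - m * M)\<^sup>2 = (W\<^sup>2 - m\<^sup>2) * (W\<^sup>2 - M\<^sup>2) + W\<^sup>2 * (M - m)\<^sup>2"
    by (simp add: power2_eq_square algebra_simps)
  also have "\<dots> = W\<^sup>2 * (s\<^sup>2 * D + e\<^sup>2 * (cos x)\<^sup>2)"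
    unfolding s2[symmetric] WM Mm by (simp add: power_mult_distrib algebra_simps)
  finally have "B\<^sup>2 * D\<^sup>2 = (s\<^sup>2 * D + e\<^sup>2 * (cos x)\<^sup>2) * P\<^sup>2"
    unfolding Bd using W D by (simp add: power_divide power_mult_distrib)
  then have "(s\<^sup>2 - B\<^sup>2) * D\<^sup>2 = s\<^sup>2 * D * (D - P\<^sup>2) - e\<^sup>2 * (cos x)\<^sup>2 * P\<^sup>2"
    by (simp add: power2_eq_square algebra_simps)
  also have "D - P\<^sup>2 = S" by (simp add: D_def)
  finally have num: "(s\<^sup>2 - B\<^sup>2) * D\<^sup>2 = e\<^sup>2 * (s\<^sup>2 * (speed_sq c e r x * (sin x)\<^sup>2) * D - (cos x)\<^sup>2 * P\<^sup>2)"
    unfolding SS by (simp add: algebra_simps)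
  have "s * (1 / q) + (- m / W) * (- M * P / (D * q)) - W * P / (D * q) = (s - B) / q"
    unfolding Bd using W D q by (simp add: field_simps power2_eq_square)
  also have "\<dots> = (s\<^sup>2 - B\<^sup>2) * D\<^sup>2 / (D\<^sup>2 * (s + B) * q)"
    using D s B0 q by (simp add: power2_eq_square square_diff_square_factored)
  finally have "s * (1 / q) + (- m / W) * (- M * P / (D * q)) - W * P / (D * q) =
     e\<^sup>2 * (s\<^sup>2 * (speed_sq c e r x * (sin x)\<^sup>2) * D - (cos x)\<^sup>2 * P\<^sup>2) / (D\<^sup>2 * (s + B) * q)"
    unfolding num .
  then show ?thesis
    unfolding iso_density_def height_density_def angle_density_def S_def[symmetric] P_def[symmetric] M_def[symmetric]
      m_def[symmetric] W_def[symmetric] D_def[symmetric] q_def[symmetric] s_def[symmetric] B_def[symmetric]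
    by simp
qed

lemma continuous_on_iso_integral:
  "continuous_on (nonresonant \<inter> {p. 4 < snd (snd p)}) (\<lambda>p. integral {0..2 * pi} (iso_density (fst p) (fst (snd p)) (snd (snd p))))"
proof (rule continuous_on_integral_param)
  let ?U = "(nonresonant \<inter> {p. 4 < snd (snd p)}) \<times> (UNIV :: real set)"
  have ne: "tangent_sq (fst (fst q)) (fst (snd (fst q))) (snd (snd (fst q))) x + (axis_speed (fst (fst q)) (fst (snd (fst q))) (snd (snd (fst q))) x)\<^sup>2 \<noteq> 0"
     "axis_norm (fst (fst q)) (fst (snd (fst q))) (snd (snd (fst q))) \<noteq> 0"
     "iso_radius (fst (fst q)) (fst (snd (fst q))) (snd (snd (fst q))) + iso_cross (fst (fst q)) (fst (snd (fst q))) (snd (snd (fst q))) x \<noteq> 0"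
     "speed_sq (fst (fst q)) (fst (snd (fst q))) (snd (snd (fst q))) x \<noteq> 0"
    if "q \<in> ?U" for q x
  proof -
    have p: "(fst (fst q), fst (snd (fst q)), snd (snd (fst q))) \<in> nonresonant" and r: "snd (snd (fst q)) > 4"
      using that by auto
    note d = nonresonantD[OF p] and ip = nonresonant_iso_pos[OF p r]
    show "tangent_sq (fst (fst q)) (fst (snd (fst q))) (snd (snd (fst q))) x + (axis_speed (fst (fst q)) (fst (snd (fst q))) (snd (snd (fst q))) x)\<^sup>2 \<noteq> 0"
      using d(6)[of x] by linarith
    show "axis_norm (fst (fst q)) (fst (snd (fst q))) (snd (snd (fst q))) \<noteq> 0" using ip(1) by linarith
    show "iso_radius (fst (fst q)) (fst (snd (fst q))) (snd (snd (fst q))) + iso_cross (fst (fst q)) (fst (snd (fst q))) (snd (snd (fst q))) x \<noteq> 0"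
      using ip(2) ip(3)[of x] by linarith
    show "speed_sq (fst (fst q)) (fst (snd (fst q))) (snd (snd (fst q))) x \<noteq> 0"
      using speed_sq_pos[OF d(3)] by (metis less_irrefl)
  qed
  have half: "continuous_on ?U (\<lambda>q. axis_height (fst (fst q)) (fst (snd (fst q))) (snd (snd (fst q))) (pi/2))"
    "continuous_on ?U (\<lambda>q. axis_speed (fst (fst q)) (fst (snd (fst q))) (snd (snd (fst q))) (pi/2))"
    "continuous_on ?U (\<lambda>q. tangent_sq (fst (fst q)) (fst (snd (fst q))) (snd (snd (fst q))) (pi/2))"
    unfolding axis_height_def axis_speed_def tangent_sq_def speed_sq_def by (intro continuous_intros; simp)+
  have rad: "continuous_on ?U (\<lambda>q. iso_radius (fst (fst q)) (fst (snd (fst q))) (snd (snd (fst q))))"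
    unfolding iso_radius_def by (intro continuous_intros half continuous_on_param_axis) (use ne in auto)
  have cro: "continuous_on ?U (\<lambda>q. iso_cross (fst (fst q)) (fst (snd (fst q))) (snd (snd (fst q))) (snd q))"
    unfolding iso_cross_def by (intro continuous_intros half continuous_on_param_axis) (use ne in \<open>auto intro!: continuous_on_param_axis\<close>)
  show "continuous_on ?U (\<lambda>q. iso_density (fst (fst q)) (fst (snd (fst q))) (snd (snd (fst q))) (snd q))"
    unfolding iso_density_def by (intro continuous_intros rad cro continuous_on_param_axis) (use ne in auto)
qed

lemma integral_sin_cos_sq:
  "integral {0..2 * pi} (\<lambda>x. k * (a * (sin x)\<^sup>2 - (cos x)\<^sup>2)) = k * ((a - 1) * pi)"
proof -
  define F where "F x = k * (a * ((x - sin x * cos x) / 2) - (x + sin x * cos x) / 2)" for x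
  have "(F has_real_derivative k * (a * (sin x)\<^sup>2 - (cos x)\<^sup>2)) (at x)" for x
  proof -
    have "(F has_real_derivative k * (a * ((1 - ((cos x)\<^sup>2 - (sin x)\<^sup>2)) / 2) - (1 + ((cos x)\<^sup>2 - (sin x)\<^sup>2)) / 2)) (at x)"
      unfolding F_def by (auto intro!: derivative_eq_intros simp: power2_eq_square field_simps)
    moreover have "1 - ((cos x)\<^sup>2 - (sin x)\<^sup>2) = 2 * (sin x)\<^sup>2" "1 + ((cos x)\<^sup>2 - (sin x)\<^sup>2) = 2 * (cos x)\<^sup>2"
      using sin_cos_squared_add[of x] by linarith+
    ultimately show ?thesis by simp
  qed
  then have "((\<lambda>x. k * (a * (sin x)\<^sup>2 - (cos x)\<^sup>2)) has_integral (F (2 * pi) - F 0)) {0..2 * pi}"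
    by (intro fundamental_theorem_of_calculus)
      (auto simp: has_real_derivative_iff_has_vector_derivative intro: has_vector_derivative_at_within)
  then have "integral {0..2 * pi} (\<lambda>x. k * (a * (sin x)\<^sup>2 - (cos x)\<^sup>2)) = F (2 * pi) - F 0" by (rule integral_unique)
  also have "\<dots> = k * ((a - 1) * pi)" by (simp add: F_def algebra_simps)
  finally show ?thesis .
qed

text \<open>The limit of \<open>r\<close> as \<open>e\<close> tends to 0 along curves with mean curvature \<open>c\<close> whose lobes turn by \<open>2 \<pi> / n\<close>.\<close>

definition circle_gap :: "nat \<Rightarrow> real \<Rightarrow> real" where
  "circle_gap n c = 4 * ((real n)\<^sup>2 + ((real n)\<^sup>2 - 1) * c\<^sup>2)"

lemma circle_gap:
  assumes "n \<ge> 2"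
  shows "circle_gap n c > 4" "sqrt (c\<^sup>2 + circle_gap n c / 4) = real n * sqrt (1 + c\<^sup>2)"
    and "c > 0 \<Longrightarrow> (c, 0, circle_gap n c) \<in> nonresonant"
proof -
  have n: "(real n)\<^sup>2 \<ge> 4" using power_mono[of 2 "real n" 2] assms by simp
  have g: "((real n)\<^sup>2 - 1) * c\<^sup>2 \<ge> 0" using n by simp
  show 1: "circle_gap n c > 4" proof -
    have "4 < 4 * (a + b)" if "4 \<le> a" "0 \<le> b" for a b :: real
      using add_increasing2[OF that(2,1)] by simp
    from this[OF n g] show ?thesis unfolding circle_gap_def .
  qed
  have "c\<^sup>2 + circle_gap n c / 4 = (real n)\<^sup>2 * (1 + c\<^sup>2)" by (simp add: circle_gap_def field_simps)
  then show "sqrt (c\<^sup>2 + circle_gap n c / 4) = real n * sqrt (1 + c\<^sup>2)" by (simp add: real_sqrt_mult)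
  show "c > 0 \<Longrightarrow> (c, 0, circle_gap n c) \<in> nonresonant" using 1 by (simp add: nonresonant_def)
qed

text \<open>In the limit the density is a positive multiple of n^2 sin^2 - cos^2, with integral
  proportional to n^2 - 1. With a single lobe it would vanish, as it must for rotations of the
  sphere.\<close>

lemma iso_integral_circle:
  assumes n: "n \<ge> 2" and c: "c > 0"
  shows "integral {0..2 * pi} (iso_density c 0 (circle_gap n c)) > 0"
proof -
  define r where "r = circle_gap n c"
  have r4: "r > 4" using circle_gap(1)[OF n] by (simp add: r_def)
  then have r0: "r > 0" "r \<noteq> 4" by auto
  note v = circle_values[OF c r0(1)]
  define \<sigma> where "\<sigma> = r / 4 - 1"
  have \<sigma>: "\<sigma> > 0" using r4 by (simp add: \<sigma>_def)
  define w where "w = sqrt (1 + c\<^sup>2)"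
  have w: "w > 0" "w\<^sup>2 = 1 + c\<^sup>2" by (simp_all add: w_def add_pos_nonneg)
  have W: "axis_norm c 0 r = \<sigma> * w" using v(4) \<sigma> by (simp add: \<sigma>_def[symmetric] w_def)
  have rad: "iso_radius c 0 r = 1 / w"
    unfolding iso_radius_def v(7) v(6) \<sigma>_def[symmetric] W using \<sigma> w(1) by (simp add: power_mult_distrib real_sqrt_divide)
  have cro: "iso_cross c 0 r x = 1 / w" for x
  proof -
    have "(\<sigma> * w)\<^sup>2 - (- c * \<sigma>) * (- c * \<sigma>) = \<sigma>\<^sup>2"
      unfolding power_mult_distrib w(2) by (simp add: power2_eq_square algebra_simps)
    then show ?thesis
      unfolding iso_cross_def v(5) v(6) v(7) \<sigma>_def[symmetric] W using \<sigma> by simp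
  qed
  have q: "speed_sq c 0 r x = (real n * w)\<^sup>2" for x
    unfolding v(8) by (simp add: r_def circle_gap_def power_mult_distrib w(2) field_simps)
  define k where "k = \<sigma>\<^sup>2 / ((\<sigma>\<^sup>2)\<^sup>2 * (1 / w + 1 / w) * (real n * w))"
  have k: "k > 0" unfolding k_def using \<sigma> w n by (intro divide_pos_pos mult_pos_pos) auto
  have "iso_density c 0 r = (\<lambda>x. k * ((real n)\<^sup>2 * (sin x)\<^sup>2 - (cos x)\<^sup>2))"
  proof
    fix x
    have "(1 / w)\<^sup>2 * ((real n * w)\<^sup>2 * (sin x)\<^sup>2) * (0 + \<sigma>\<^sup>2) - (cos x)\<^sup>2 * \<sigma>\<^sup>2 = \<sigma>\<^sup>2 * ((real n)\<^sup>2 * (sin x)\<^sup>2 - (cos x)\<^sup>2)"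
      using w(1) by (simp add: power_mult_distrib power_divide algebra_simps)
    moreover have "sqrt ((real n * w)\<^sup>2) = real n * w" using w by simp
    ultimately show "iso_density c 0 r x = k * ((real n)\<^sup>2 * (sin x)\<^sup>2 - (cos x)\<^sup>2)"
      unfolding iso_density_def rad cro q v(6) v(7) \<sigma>_def[symmetric] k_def by simp
  qed
  then have "integral {0..2 * pi} (iso_density c 0 r) = k * (((real n)\<^sup>2 - 1) * pi)"
    by (simp only: integral_sin_cos_sq)
  moreover have "(real n)\<^sup>2 > 1" using n by simp
  ultimately show ?thesis using k by (simp add: r_def)
qed

text \<open>Integrating the pointwise identity gives s L + h H > 2 pi for a unit vector (s, h), and
  Cauchy-Schwarz turns this into the bound on H^2 + L^2.\<close>

lemma isoperimetric:
  assumes n: "n \<ge> 1" and p: "(c, e, r) \<in> nonresonant" and r: "r > 4" and e: "e \<noteq> 0"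
    and iso: "integral {0..2 * pi} (iso_density c e r) > 0"
    and ang: "real n * integral {0..2 * pi} (angle_density c e r) = 2 * pi"
  shows "4 * pi\<^sup>2 < (real n * integral {0..2 * pi} (height_density c e r))\<^sup>2 + (real n * curvature_period c e r)\<^sup>2"
proof -
  note d = nonresonantD[OF p] and ip = nonresonant_iso_pos[OF p r]
  define s h where "s = iso_radius c e r" and "h = - axis_height c e r (pi/2) / axis_norm c e r"
  define H L where "H = real n * integral {0..2 * pi} (height_density c e r)" and "L = real n * curvature_period c e r"
  have sq: "s\<^sup>2 + h\<^sup>2 = 1"
  proof -
    have "s\<^sup>2 = (tangent_sq c e r (pi/2) + (axis_speed c e r (pi/2))\<^sup>2) / (axis_norm c e r)\<^sup>2"
      unfolding s_def iso_radius_def using d(6)[of "pi/2"] by simp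
    then have "s\<^sup>2 + h\<^sup>2 = ((axis_height c e r (pi/2))\<^sup>2 + tangent_sq c e r (pi/2) + (axis_speed c e r (pi/2))\<^sup>2) / (axis_norm c e r)\<^sup>2"
      by (simp add: h_def power_divide add_divide_distrib)
    then show ?thesis unfolding axis_norm_eq using ip(1) by simp
  qed
  define g where "g x = 1 / sqrt (speed_sq c e r x)" for x
  have T: "curvature_period c e r = integral {0..2 * pi} g" by (simp add: curvature_period_def g_def[abs_def])
  have "g integrable_on {0..2 * pi}"
  proof (rule integrable_continuous_real)
    have "sqrt (speed_sq c e r x) \<noteq> 0" for x using speed_sq_pos[OF d(3), of c e x] by simp
    then show "continuous_on {0..2 * pi} g"
      unfolding g_def by (intro continuous_on_divide continuous_on_const continuous_on_real_sqrt continuous_on_speed_sq) auto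
  qed
  note i1 = integrable_on_mult_right[OF this, of s]
  note co = continuous_on_densities[OF d(3,6), THEN integrable_continuous_real]
  note i2 = integrable_on_mult_right[OF co(2), of h]
  have "e\<^sup>2 * integral {0..2 * pi} (iso_density c e r) = integral {0..2 * pi} (\<lambda>x. e\<^sup>2 * iso_density c e r x)" by simp
  also have "\<dots> = integral {0..2 * pi} (\<lambda>x. (s * g x + h * height_density c e r x) - angle_density c e r x)"
    unfolding iso_density_eq[OF p r, symmetric] s_def h_def g_def ..
  also have "\<dots> = s * curvature_period c e r + h * integral {0..2 * pi} (height_density c e r) - integral {0..2 * pi} (angle_density c e r)"
    unfolding integral_diff[OF integrable_add[OF i1 i2] co(1)] integral_add[OF i1 i2] T by simp
  finally have eq: "e\<^sup>2 * integral {0..2 * pi} (iso_density c e r) =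
    s * curvature_period c e r + h * integral {0..2 * pi} (height_density c e r) - integral {0..2 * pi} (angle_density c e r)" .
  have "real n * (e\<^sup>2 * integral {0..2 * pi} (iso_density c e r)) = s * L + h * H - 2 * pi"
    unfolding eq using ang by (simp add: L_def H_def right_diff_distrib distrib_left mult.left_commute)
  moreover have "real n * (e\<^sup>2 * integral {0..2 * pi} (iso_density c e r)) > 0" using n e iso by simp
  ultimately have lt: "2 * pi < s * L + h * H" by linarith
  have "(2 * pi)\<^sup>2 < (s * L + h * H)\<^sup>2" using lt by (intro power_strict_mono) auto
  also have "\<dots> \<le> (s * L + h * H)\<^sup>2 + (s * H - h * L)\<^sup>2" by simp
  also have "\<dots> = (s\<^sup>2 + h\<^sup>2) * (H\<^sup>2 + L\<^sup>2)" by (simp add: power2_eq_square algebra_simps)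
  finally show ?thesis unfolding sq by (simp add: H_def L_def)
qed

text \<open>The difference \<open>e\<close> of \<open>\<kappa>\<^sub>0\<close> and the mean of the two real roots of the quartic is a continuous
  function of the parameters, including the parameters with a double root.\<close>

lemma half_amplitude_function:
  fixes m0 l0 k0 :: real
  assumes base: "l0 + k0 * (m0 + k0\<^sup>2 / 2) = 0" and \<omega>: "m0 + 3/2 * k0\<^sup>2 > 0"
  obtains E and Y :: "(real \<times> real \<times> real) set" where "open Y" "(m0, l0, k0) \<in> Y" "continuous_on Y E" "E (m0, l0, k0) = 0"
    "\<And>m l k. (m, l, k) \<in> Y \<Longrightarrow> elastic_parameters (k - E (m, l, k)) (E (m, l, k))
        (4 * m + (E (m, l, k))\<^sup>2 + 2 * (k - E (m, l, k))\<^sup>2) (m - 1/2) l k"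
proof -
  \<comment> \<open>A zero \<open>a\<close> is a half amplitude: the formula for \<open>lam\<close>
    in \<open>elastic_parameters\<close> with \<open>c = k - a\<close> and \<open>r\<close>
    eliminated through \<open>m = \<mu> + 1/2\<close>.\<close>
  define f where "f a y = fst (snd y) + (snd (snd y) - a) * (fst y + (a\<^sup>2 + (snd (snd y) - a)\<^sup>2) / 2)"
    for a :: real and y :: "real \<times> real \<times> real"
  define w where "w = m0 + 3/2 * k0\<^sup>2"
  have w: "w > 0" using \<omega> by (simp add: w_def)
  \<comment> \<open>Chosen so that the mixed term 2 k (a + b) of the difference quotient is at most
    w / 4; with 3 w / 4 from \<open>Y\<close> the slope of \<open>f\<close> in \<open>a\<close> then
    stays below - w / 2 = - \<open>\<alpha>\<close>.\<close>
  define \<delta> where "\<delta> = w / (16 * (\<bar>k0\<bar> + 1))"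
  have \<delta>: "\<delta> > 0" using w by (simp add: \<delta>_def add_nonneg_pos)
  define \<alpha> where "\<alpha> = w / 2"
  have \<alpha>: "\<alpha> > 0" using w by (simp add: \<alpha>_def)
  define Y where "Y = {y :: real \<times> real \<times> real. \<bar>snd (snd y)\<bar> < \<bar>k0\<bar> + 1} \<inter> {y. 3 * w / 4 < fst y + 3/2 * (snd (snd y))\<^sup>2} \<inter>
     {y. \<bar>f 0 y\<bar> < \<alpha> * \<delta>}"
  have cf: "continuous_on A (f a)" for A a unfolding f_def by (intro continuous_intros) auto
  have oY: "open Y" unfolding Y_def by (intro open_Int open_Collect_less continuous_intros cf)
  have y0: "(m0, l0, k0) \<in> Y"
    using base w \<alpha> \<delta> by (simp add: Y_def f_def w_def)
  have slope: "\<alpha> * \<bar>a - b\<bar> \<le> \<bar>f a y - f b y\<bar>" and dec: "a \<le> b \<Longrightarrow> f b y \<le> f a y - \<alpha> * (b - a)"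
    if y: "y \<in> Y" and ab: "\<bar>a\<bar> \<le> \<delta>" "\<bar>b\<bar> \<le> \<delta>" for a b y
  proof -
    obtain m l k where yk: "y = (m, l, k)" by (cases y)
    define G where "G = m + 3/2 * k\<^sup>2 - 2 * k * (a + b) + (a\<^sup>2 + a * b + b\<^sup>2)"
    have eq: "f a y - f b y = (b - a) * G"
      by (simp add: yk f_def G_def power2_eq_square field_simps)
    have k: "\<bar>k\<bar> \<le> \<bar>k0\<bar> + 1" and m: "3 * w / 4 < m + 3/2 * k\<^sup>2" using y by (auto simp: Y_def yk)
    have "\<bar>2 * k * (a + b)\<bar> = 2 * \<bar>k\<bar> * \<bar>a + b\<bar>" by (simp add: abs_mult)
    also have "\<dots> \<le> 2 * (\<bar>k0\<bar> + 1) * (2 * \<delta>)" using ab k \<delta> by (intro mult_mono) auto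
    also have "\<dots> = w / 4" unfolding \<delta>_def by (simp add: field_simps add_nonneg_pos)
    finally have "\<bar>2 * k * (a + b)\<bar> \<le> w / 4" .
    moreover have "a\<^sup>2 + a * b + b\<^sup>2 \<ge> 0"
    proof -
      have "a\<^sup>2 + a * b + b\<^sup>2 = (a + b / 2)\<^sup>2 + 3/4 * b\<^sup>2" by (simp add: power2_eq_square field_simps)
      then show ?thesis by simp
    qed
    ultimately have G: "G \<ge> \<alpha>" using m unfolding G_def \<alpha>_def by linarith
    show "\<alpha> * \<bar>a - b\<bar> \<le> \<bar>f a y - f b y\<bar>"
      unfolding eq using G \<alpha> by (simp add: abs_mult abs_minus_commute mult.commute mult_right_mono)
    show "f b y \<le> f a y - \<alpha> * (b - a)" if "a \<le> b"
      using mult_left_mono[OF G, of "b - a"] eq that by (simp add: mult.commute)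
  qed
  have ex: "\<exists>a. \<bar>a\<bar> \<le> \<delta> \<and> f a y = 0" if y: "y \<in> Y" for y
  proof -
    have 0: "\<bar>f 0 y\<bar> < \<alpha> * \<delta>" using y by (simp add: Y_def)
    have "f \<delta> y \<le> 0" using dec[OF y, of 0 \<delta>] \<delta> 0 by simp
    moreover have "0 \<le> f (- \<delta>) y" using dec[OF y, of "- \<delta>" 0] \<delta> 0 by simp
    moreover have "continuous_on {- \<delta>..\<delta>} (\<lambda>a. f a y)" unfolding f_def by (intro continuous_intros) auto
    ultimately have "\<exists>a\<ge>- \<delta>. a \<le> \<delta> \<and> f a y = 0" using \<delta> by (intro IVT2') auto
    then show ?thesis by (auto simp: abs_le_iff)
  qed
  define E where "E y = (SOME a. \<bar>a\<bar> \<le> \<delta> \<and> f a y = 0)" for y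
  have E: "\<bar>E y\<bar> \<le> \<delta>" "f (E y) y = 0" if "y \<in> Y" for y
    using someI_ex[OF ex[OF that]] by (auto simp: E_def)
  \<comment> \<open>The uniform slope bounds the distance of two zeros by the value of
    \<open>f\<close> at the old zero and the new parameters, which tends to 0.\<close>
  have cE: "continuous_on Y E"
    unfolding continuous_on_def
  proof
    fix y assume y: "y \<in> Y"
    have "((\<lambda>z. \<bar>f (E y) z\<bar> / \<alpha>) \<longlongrightarrow> \<bar>f (E y) y\<bar> / \<alpha>) (at y within Y)"
      using cf[of Y "E y"] y \<alpha> by (intro tendsto_intros) (auto simp: continuous_on_def)
    then have lim: "((\<lambda>z. \<bar>f (E y) z\<bar> / \<alpha>) \<longlongrightarrow> 0) (at y within Y)" by (simp add: E(2)[OF y])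
    have "\<forall>\<^sub>F z in at y within Y. norm (E z - E y) \<le> \<bar>f (E y) z\<bar> / \<alpha>"
    proof (rule eventually_at_topological[THEN iffD2], intro exI[of _ UNIV] conjI ballI impI)
      fix z assume z: "z \<in> Y"
      have "\<alpha> * \<bar>E z - E y\<bar> \<le> \<bar>f (E z) z - f (E y) z\<bar>" by (rule slope[OF z E(1)[OF z] E(1)[OF y]])
      then show "norm (E z - E y) \<le> \<bar>f (E y) z\<bar> / \<alpha>"
        using \<alpha> by (simp add: E(2)[OF z] pos_le_divide_eq mult.commute)
    qed auto
    from Lim_null_comparison[OF this lim] show "(E \<longlongrightarrow> E y) (at y within Y)" by (simp add: LIM_zero_iff)
  qed
  have "\<alpha> * \<bar>E (m0, l0, k0) - 0\<bar> \<le> \<bar>f (E (m0, l0, k0)) (m0, l0, k0) - f 0 (m0, l0, k0)\<bar>"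
    by (rule slope[OF y0 E(1)[OF y0]]) (use \<delta> in simp)
  also have "f 0 (m0, l0, k0) = 0" using base by (simp add: f_def)
  finally have E0: "E (m0, l0, k0) = 0" using \<alpha> by (simp add: E(2)[OF y0] mult_le_0_iff)
  have "elastic_parameters (k - E (m, l, k)) (E (m, l, k))
        (4 * m + (E (m, l, k))\<^sup>2 + 2 * (k - E (m, l, k))\<^sup>2) (m - 1/2) l k" if "(m, l, k) \<in> Y" for m l k
    using E(2)[OF that] unfolding elastic_parameters_def f_def by (simp add: field_simps)
  then show ?thesis using that[OF oY y0 cE E0] by blast
qed

section \<open>Real analytic functions of two variables\<close>

text \<open>Each nonconstant term at (x, y) is at most s / R times its absolute value at (R, R),
  with s the larger of |x| and |y|; absolute summability at (R, R) gives a Lipschitz bound at the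
  centre.\<close>

lemma real_analytic_on2_isCont:
  assumes an: "real_analytic_on2 f U" and p: "(x0, y0) \<in> U"
  shows "isCont f (x0, y0)"
proof -
  obtain r c where r: "r > 0" and hs: "\<And>x y. \<bar>x\<bar> < r \<Longrightarrow> \<bar>y\<bar> < r \<Longrightarrow>
     ((\<lambda>(i, j). c i j * x ^ i * y ^ j) has_sum f (x0 + x, y0 + y)) (UNIV :: (nat \<times> nat) set)"
    using an p unfolding real_analytic_on2_def by fast
  define R where "R = r / 2"
  have R: "R > 0" "R < r" using r by (simp_all add: R_def)
  have "(\<lambda>(i, j). c i j * R ^ i * R ^ j) summable_on (UNIV :: (nat \<times> nat) set)"
    using hs[of R R] R by (auto simp: summable_on_def)
  then have "(\<lambda>z. norm ((\<lambda>(i, j). c i j * R ^ i * R ^ j) z)) summable_on (UNIV :: (nat \<times> nat) set)"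
    by (rule summable_on_iff_abs_summable_on_real[THEN iffD1])
  then obtain B where B: "((\<lambda>z. norm ((\<lambda>(i, j). c i j * R ^ i * R ^ j) z)) has_sum B) (UNIV :: (nat \<times> nat) set)"
    by (auto simp: summable_on_def)
  have bound: "\<bar>f (x0 + x, y0 + y) - f (x0, y0)\<bar> \<le> (max \<bar>x\<bar> \<bar>y\<bar> / R) * B" if xy: "\<bar>x\<bar> \<le> R" "\<bar>y\<bar> \<le> R" for x y
  proof -
    define s where "s = max \<bar>x\<bar> \<bar>y\<bar>"
    have s: "\<bar>x\<bar> \<le> s" "\<bar>y\<bar> \<le> s" "0 \<le> s" "s \<le> R" using xy by (auto simp: s_def)
    define u where "u = (\<lambda>(i, j). c i j * x ^ i * y ^ j - c i j * 0 ^ i * 0 ^ j :: real)"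
    have u: "(u has_sum (f (x0 + x, y0 + y) - f (x0, y0))) UNIV"
    proof -
      have "((\<lambda>z. (\<lambda>(i, j). c i j * x ^ i * y ^ j) z + - (\<lambda>(i, j). c i j * 0 ^ i * 0 ^ j) z) has_sum
         (f (x0 + x, y0 + y) + - f (x0 + 0, y0 + 0))) UNIV"
        by (intro has_sum_add has_sum_uminusI hs) (use xy R in auto)
      then show ?thesis by (simp add: u_def case_prod_unfold)
    qed
    have le: "\<bar>u z\<bar> \<le> (s / R) * norm ((\<lambda>(i, j). c i j * R ^ i * R ^ j) z)" for z
    proof -
      obtain i j where z: "z = (i, j)" by (cases z)
      show ?thesis
      proof (cases "i = 0 \<and> j = 0")
        case True
        then show ?thesis using s R by (simp add: z u_def)
      next
        case False
        then obtain k where k: "i + j = Suc k" by (metis add_is_0 not0_implies_Suc)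
        have "\<bar>u z\<bar> = \<bar>c i j\<bar> * (\<bar>x\<bar> ^ i * \<bar>y\<bar> ^ j)"
          using False by (auto simp: z u_def abs_mult power_abs power_0_left)
        also have "\<dots> \<le> \<bar>c i j\<bar> * (s ^ i * s ^ j)"
          using s by (intro mult_left_mono mult_mono power_mono) auto
        also have "s ^ i * s ^ j = s * s ^ k" by (simp add: power_add[symmetric] k)
        also have "\<bar>c i j\<bar> * (s * s ^ k) \<le> \<bar>c i j\<bar> * (s * R ^ k)"
          using s by (intro mult_left_mono power_mono) auto
        also have "\<dots> = (s / R) * (\<bar>c i j\<bar> * R ^ (i + j))" using R by (simp add: k)
        also have "\<bar>c i j\<bar> * R ^ (i + j) = norm ((\<lambda>(i, j). c i j * R ^ i * R ^ j) z)"
          using R by (simp add: z abs_mult power_add)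
        finally show ?thesis .
      qed
    qed
    have Bs: "((\<lambda>z. (s / R) * norm ((\<lambda>(i, j). c i j * R ^ i * R ^ j) z)) has_sum ((s / R) * B)) UNIV"
      by (rule has_sum_cmult_right[OF B])
    have "f (x0 + x, y0 + y) - f (x0, y0) \<le> (s / R) * B"
      by (rule has_sum_mono[OF u Bs]) (use le abs_le_D1 in blast)
    moreover have "- (f (x0 + x, y0 + y) - f (x0, y0)) \<le> (s / R) * B"
      by (rule has_sum_mono[OF has_sum_uminusI[OF u] Bs]) (use le abs_le_D2 in blast)
    ultimately show ?thesis unfolding s_def[symmetric] by linarith
  qed
  have "((\<lambda>p. f p - f (x0, y0)) \<longlongrightarrow> 0) (at (x0, y0))"
  proof (rule Lim_null_comparison)
    have "\<forall>\<^sub>F p in at (x0, y0). dist p (x0, y0) < R" using R unfolding eventually_at by auto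
    then show "\<forall>\<^sub>F p in at (x0, y0). norm (f p - f (x0, y0)) \<le> (max \<bar>fst p - x0\<bar> \<bar>snd p - y0\<bar> / R) * B"
    proof eventually_elim
      case (elim p)
      have "\<bar>fst p - x0\<bar> \<le> R" "\<bar>snd p - y0\<bar> \<le> R"
        using dist_fst_le[of p "(x0, y0)"] dist_snd_le[of p "(x0, y0)"] elim by (simp_all add: dist_real_def)
      from bound[OF this] show ?case by simp
    qed
    have "((\<lambda>p. (max \<bar>fst p - x0\<bar> \<bar>snd p - y0\<bar> / R) * B) \<longlongrightarrow> (max \<bar>fst (x0, y0) - x0\<bar> \<bar>snd (x0, y0) - y0\<bar> / R) * B) (at (x0, y0))"
      using R by (intro tendsto_intros) auto
    then show "((\<lambda>p. (max \<bar>fst p - x0\<bar> \<bar>snd p - y0\<bar> / R) * B) \<longlongrightarrow> 0) (at (x0, y0))" by simp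
  qed
  then show ?thesis by (simp add: isCont_def LIM_zero_iff)
qed

text \<open>On the line y = 0 only the terms with \<open>j = 0\<close> remain, an ordinary power
  series. This supplies the derivative of \<open>\<mu>\<close> in \<open>lam\<close>; its value is
  never computed.\<close>

lemma real_analytic_on2_differentiable_fst:
  assumes an: "real_analytic_on2 f U" and p: "(x0, y0) \<in> U"
  obtains d where "((\<lambda>x. f (x, y0)) has_real_derivative d) (at x0)"
proof -
  obtain r c where r: "r > 0" and hs: "\<And>x y. \<bar>x\<bar> < r \<Longrightarrow> \<bar>y\<bar> < r \<Longrightarrow>
     ((\<lambda>(i, j). c i j * x ^ i * y ^ j) has_sum f (x0 + x, y0 + y)) (UNIV :: (nat \<times> nat) set)"
    using an p unfolding real_analytic_on2_def by fast
  have sums: "(\<lambda>i. c i 0 * x ^ i) sums f (x0 + x, y0)" if x: "\<bar>x\<bar> < r" for x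
  proof -
    have "((\<lambda>(i, j). c i j * x ^ i * 0 ^ j) has_sum f (x0 + x, y0)) (range (\<lambda>i::nat. (i, 0::nat)))"
      by (rule has_sum_cong_neutral[THEN iffD1, OF _ _ _ hs[of x 0, simplified]])
        (use x r in \<open>auto simp: image_iff power_0_left\<close>)
    then have "((\<lambda>i. c i 0 * x ^ i) has_sum f (x0 + x, y0)) UNIV"
      by (subst (asm) has_sum_reindex) (auto simp: inj_on_def comp_def)
    then show ?thesis by (rule has_sum_imp_sums)
  qed
  have "summable (\<lambda>i. c i 0 * (r / 2) ^ i)" using sums[of "r / 2"] r by (auto simp: sums_iff)
  from termdiffs_strong[OF this, of 0] r obtain d where "((\<lambda>x. \<Sum>i. c i 0 * x ^ i) has_real_derivative d) (at 0)"
    by auto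
  then have "((\<lambda>x. f (x0 + x, y0)) has_real_derivative d) (at 0)"
  proof (rule has_field_derivative_transform_within_open)
    show "open {- r<..<r}" "0 \<in> {- r<..<r}" using r by auto
    show "(\<Sum>i. c i 0 * x ^ i) = f (x0 + x, y0)" if "x \<in> {- r<..<r}" for x
      using sums[of x] that by (auto simp: sums_iff abs_less_iff)
  qed
  then have "((\<lambda>x. f (x, y0)) has_real_derivative d) (at x0)"
    using DERIV_shift[of "\<lambda>x. f (x, y0)" d 0 x0] by (simp add: add.commute)
  then show ?thesis by (rule that)
qed

section \<open>The family near the homogeneous tori\<close>

lemma constant_curvature_iff:
  "constrained_elastic_curvature \<mu> lam c (\<lambda>_. c) \<longleftrightarrow> c ^ 3 / 2 + (\<mu> + 1/2) * c + lam = 0"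
proof
  assume "constrained_elastic_curvature \<mu> lam c (\<lambda>_. c)"
  then obtain k1 k2 where k: "\<And>s. ((\<lambda>_. c) has_real_derivative k1 s) (at s)" "\<And>s. (k1 has_real_derivative k2 s) (at s)"
     "\<And>s. k2 s + 1/2 * c ^ 3 + (\<mu> + 1/2) * c + lam = 0"
    unfolding constrained_elastic_curvature_def by blast
  have "k1 = (\<lambda>_. 0)" using DERIV_unique[OF k(1) DERIV_const] by auto
  then have "((\<lambda>_. 0) has_real_derivative k2 0) (at 0)" using k(2)[of 0] by simp
  then have "k2 0 = 0" using DERIV_unique[OF _ DERIV_const] by blast
  then show "c ^ 3 / 2 + (\<mu> + 1/2) * c + lam = 0" using k(3)[of 0] by simp
next
  assume "c ^ 3 / 2 + (\<mu> + 1/2) * c + lam = 0"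
  then show "constrained_elastic_curvature \<mu> lam c (\<lambda>_. c)"
    unfolding constrained_elastic_curvature_def
    by (intro conjI exI[of _ "\<lambda>_. 0"]) (auto simp: algebra_simps)
qed

text \<open>The left side is minus the second derivative of the curvature at 0. As the square of the
  speed is positive, the sign of \<open>e\<close> can be read from an explicit function of the
  parameters.\<close>

lemma elastic_parameters_root_value:
  assumes "elastic_parameters c e r \<mu> lam k"
  shows "k ^ 3 / 2 + (\<mu> + 1/2) * k + lam = e * speed_sq c e r 0"
proof -
  have k: "k = c + e" and lam: "lam = - c * (r + e\<^sup>2) / 4" and mu: "\<mu> + 1/2 = (r - e\<^sup>2 - 2 * c\<^sup>2) / 4"
    using assms by (auto simp: elastic_parameters_def)
  show ?thesis unfolding mu unfolding lam k speed_sq_def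
    by (simp add: power2_eq_square power3_eq_cube field_simps)
qed

text \<open>The second quadratic factor ((x + c)^2 + r) / 4 has no real zero, and
  \<open>e \<ge> 0\<close> makes c + e the larger root.\<close>

lemma larger_real_rootI:
  assumes par: "elastic_parameters c e r \<mu> lam k" and e: "e \<ge> 0" and r: "r > 0"
  shows "larger_real_root \<mu> lam k"
proof -
  have k: "k = c + e" and lam: "lam = - c * (r + e\<^sup>2) / 4" and mu: "\<mu> + 1/2 = (r - e\<^sup>2 - 2 * c\<^sup>2) / 4"
    using par by (auto simp: elastic_parameters_def)
  define q where "q = [:(c\<^sup>2 + r) / 4, c / 2, 1/4:]"
  have "elastic_quartic \<mu> lam ((c\<^sup>2 - e\<^sup>2) * (c\<^sup>2 + r) / 4) = [:- k, 1:] * [:- (c - e), 1:] * q"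
    unfolding elastic_quartic_def mu lam k q_def by (simp add: power2_eq_square field_simps)
  moreover have "poly q x \<noteq> 0" for x
  proof -
    have "poly q x = ((x + c)\<^sup>2 + r) / 4" by (simp add: q_def power2_eq_square field_simps)
    moreover have "(x + c)\<^sup>2 + r > 0" using r by (simp add: add_nonneg_pos)
    ultimately show ?thesis by simp
  qed
  moreover have "c - e \<le> k" using e k by simp
  ultimately show ?thesis unfolding larger_real_root_def by blast
qed

text \<open>The circle makes \<open>c\<close> a double root. If r <= 0, the remaining quadratic had
  the real zero - c - sqrt (- r) < c; the linear factor of \<open>\<kappa>1\<close> would have to
  account both for this zero and for the second zero at \<open>c\<close>.\<close>

lemma larger_real_root_double:
  assumes root: "larger_real_root \<mu> lam c" and c: "c > 0" and ode: "c ^ 3 / 2 + (\<mu> + 1/2) * c + lam = 0"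
  shows "4 * (\<mu> + 1/2) + 2 * c\<^sup>2 > 0"
proof (rule ccontr)
  define m where "m = \<mu> + 1/2"
  define r where "r = 4 * m + 2 * c\<^sup>2"
  assume "\<not> ?thesis"
  then have r: "r \<le> 0" by (simp add: r_def m_def)
  obtain \<nu> \<kappa>1 q where q: "elastic_quartic \<mu> lam \<nu> = [:- c, 1:] * [:- \<kappa>1, 1:] * q" "\<And>x. poly q x \<noteq> 0"
    using root unfolding larger_real_root_def by blast
  have lam: "lam = - c * (m + c\<^sup>2 / 2)" using ode by (simp add: m_def power2_eq_square power3_eq_cube field_simps)
  have "poly (elastic_quartic \<mu> lam \<nu>) c = 0" by (simp only: q(1) poly_mult) simp
  then have nu: "\<nu> = m * c\<^sup>2 + 3/4 * c ^ 4"
    unfolding elastic_quartic_def m_def[symmetric] lam by (simp add: power2_eq_square eval_nat_numeral field_simps)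
  define h where "h = [:(c\<^sup>2 + r) / 4, c / 2, 1/4:]"
  have "elastic_quartic \<mu> lam \<nu> = [:- c, 1:] * ([:- c, 1:] * h)"
    unfolding elastic_quartic_def m_def[symmetric] lam nu h_def r_def by (simp add: power2_eq_square eval_nat_numeral field_simps)
  moreover have "elastic_quartic \<mu> lam \<nu> = [:- c, 1:] * ([:- \<kappa>1, 1:] * q)" by (simp only: q(1) mult.assoc)
  ultimately have "[:- c, 1:] * ([:- \<kappa>1, 1:] * q) = [:- c, 1:] * ([:- c, 1:] * h)" by (rule trans[OF sym, rotated])
  then have fac: "[:- \<kappa>1, 1:] * q = [:- c, 1:] * h" by (rule mult_left_cancel[THEN iffD1, rotated]) simp
  define x where "x = - c - sqrt (- r)"
  have hx: "poly h x = 0"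
  proof -
    have "poly h x = ((x + c)\<^sup>2 + r) / 4" by (simp add: h_def power2_eq_square field_simps)
    also have "(x + c)\<^sup>2 = - r" using r by (simp add: x_def)
    finally show ?thesis by simp
  qed
  have "poly ([:- \<kappa>1, 1:] * q) x = 0" unfolding fac using hx by simp
  then have "\<kappa>1 = x" using q(2)[of x] by simp
  moreover have "poly ([:- \<kappa>1, 1:] * q) c = 0" unfolding fac by simp
  then have "\<kappa>1 = c" using q(2)[of c] by simp
  ultimately have "- c - sqrt (- r) = c" by (simp add: x_def)
  moreover have "sqrt (- r) \<ge> 0" using r by simp
  ultimately show False using c by linarith
qed

lemma continuous_triple:
  fixes n :: nat and U :: "(real \<times> real) set" and \<mu> :: "real \<times> real \<Rightarrow> real"
  assumes an: "real_analytic_on2 \<mu> U" and U: "open U" "(lam0, c) \<in> U"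
    and ode: "c ^ 3 / 2 + (\<mu> (lam0, c) + 1/2) * c + lam0 = 0" and r0: "4 * (\<mu> (lam0, c) + 1/2) + 2 * c\<^sup>2 > 0"
  obtains X O' where "open O'" "(lam0, c) \<in> O'" "O' \<subseteq> U" "continuous_on O' X"
    "X (lam0, c) = (c, 0, 4 * (\<mu> (lam0, c) + 1/2) + 2 * c\<^sup>2)"
    "\<And>lam k. (lam, k) \<in> O' \<Longrightarrow> elastic_parameters (fst (X (lam, k))) (fst (snd (X (lam, k)))) (snd (snd (X (lam, k)))) (\<mu> (lam, k)) lam k"
proof -
  define m0 where "m0 = \<mu> (lam0, c) + 1/2"
  have b1: "lam0 + c * (m0 + c\<^sup>2 / 2) = 0" using ode by (simp add: m0_def power2_eq_square power3_eq_cube field_simps)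
  have b2: "m0 + 3/2 * c\<^sup>2 > 0"
  proof -
    have "4 * m0 + 2 * c\<^sup>2 > 0" using r0 by (simp add: m0_def)
    then show ?thesis using zero_le_power2[of c] by linarith
  qed
  obtain E and Y :: "(real \<times> real \<times> real) set" where Y: "open Y" "(m0, lam0, c) \<in> Y" "continuous_on Y E" "E (m0, lam0, c) = 0"
    and par: "\<And>m l k. (m, l, k) \<in> Y \<Longrightarrow> elastic_parameters (k - E (m, l, k)) (E (m, l, k))
        (4 * m + (E (m, l, k))\<^sup>2 + 2 * (k - E (m, l, k))\<^sup>2) (m - 1/2) l k"
    by (rule half_amplitude_function[OF b1 b2], rule that)
  define y where "y p = (\<mu> p + 1/2, fst p, snd p)" for p
  have "continuous_on U \<mu>"
    using real_analytic_on2_isCont[OF an] by (auto intro!: continuous_at_imp_continuous_on)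
  then have cy: "continuous_on U y" unfolding y_def by (intro continuous_intros)
  define O' where "O' = U \<inter> y -` Y"
  have "open O'" unfolding O'_def by (rule continuous_open_preimage[OF cy U(1) Y(1)])
  moreover have "(lam0, c) \<in> O'" using U Y by (simp add: O'_def y_def m0_def)
  moreover define X where "X p = (snd p - E (y p), E (y p), 4 * (\<mu> p + 1/2) + (E (y p))\<^sup>2 + 2 * (snd p - E (y p))\<^sup>2)" for p
  have cE: "continuous_on O' (\<lambda>p. E (y p))"
    by (rule continuous_on_compose2[OF Y(3) continuous_on_subset[OF cy]]) (auto simp: O'_def)
  have "continuous_on O' X" unfolding X_def
    by (intro continuous_intros cE continuous_on_subset[OF \<open>continuous_on U \<mu>\<close>]) (auto simp: O'_def)
  moreover have "X (lam0, c) = (c, 0, 4 * (\<mu> (lam0, c) + 1/2) + 2 * c\<^sup>2)"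
    using Y(4) by (simp add: X_def y_def m0_def)
  moreover have "elastic_parameters (fst (X (lam, k))) (fst (snd (X (lam, k)))) (snd (snd (X (lam, k)))) (\<mu> (lam, k)) lam k"
    if "(lam, k) \<in> O'" for lam k
    using par[of "\<mu> (lam, k) + 1/2" lam k] that by (simp add: X_def O'_def y_def)
  ultimately show ?thesis using that[of O' X] by (simp add: O'_def)
qed

text \<open>The value of \<open>lam\<close> in \<open>elastic_parameters\<close> for
  \<open>e = 0\<close> and \<open>r = circle_gap n c\<close>.\<close>

definition circle_lambda :: "nat \<Rightarrow> real \<Rightarrow> real" where
  "circle_lambda n c = - c * circle_gap n c / 4"

text \<open>A parameter with \<open>e = 0\<close> belongs to a circle, and the family contains only
  one circle for each curvature; so \<open>e\<close> vanishes only on the curve of homogeneous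
  tori.\<close>

lemma circle_lambda_unique:
  assumes fam: "hopf_torus_family n U \<mu>" and k: "k > 0" and U: "(lam, k) \<in> U" and lam: "lam \<le> 0"
    and par: "elastic_parameters c 0 r (\<mu> (lam, k)) lam k" and r: "r > 0"
    and other: "(lam', k) \<in> family_parameters U \<mu>" "constrained_elastic_curvature (\<mu> (lam', k)) lam' k (\<lambda>_. k)"
  shows "lam = lam'"
proof -
  have "(lam, k) \<in> family_parameters U \<mu>"
    using U lam larger_real_rootI[OF par _ r] by (simp add: family_parameters_def)
  moreover have "constrained_elastic_curvature (\<mu> (lam, k)) lam k (\<lambda>_. k)"
    unfolding constant_curvature_iff using elastic_parameters_root_value[OF par] by simp
  moreover have "\<exists>!lam. (lam, k) \<in> family_parameters U \<mu> \<and> constrained_elastic_curvature (\<mu> (lam, k)) lam k (\<lambda>_. k)"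
    using fam k unfolding hopf_torus_family_def by blast
  ultimately show ?thesis using other by blast
qed

text \<open>The circle of curvature \<open>c\<close> closes for every \<open>\<mu>\<close>. That \<open>\<mu>\<close> is nevertheless determined at the
  homogeneous tori follows by approaching them through noncircular members of the family.\<close>

lemma circle_parameters:
  assumes n2: "n \<ge> 2" and fam: "hopf_torus_family n U \<mu>" and c: "c > 0"
  shows "(circle_lambda n c, c) \<in> family_parameters U \<mu>"
    and "constrained_elastic_curvature (\<mu> (circle_lambda n c, c)) (circle_lambda n c) c (\<lambda>_. c)"
    and "4 * (\<mu> (circle_lambda n c, c) + 1/2) + 2 * c\<^sup>2 = circle_gap n c"
proof -
  have Uo: "open U" and an: "real_analytic_on2 \<mu> U"
    and lobes: "\<And>lam k. (lam, k) \<in> U \<Longrightarrow> \<exists>\<gamma> T. n_lobed_constrained_elastic n (\<mu> (lam, k)) lam k \<gamma> T"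
    using fam unfolding hopf_torus_family_def by auto
  obtain lam0 where fp: "(lam0, c) \<in> family_parameters U \<mu>" and con: "constrained_elastic_curvature (\<mu> (lam0, c)) lam0 c (\<lambda>_. c)"
    using fam c unfolding hopf_torus_family_def by blast
  have ode: "c ^ 3 / 2 + (\<mu> (lam0, c) + 1/2) * c + lam0 = 0" using con by (simp add: constant_curvature_iff)
  have U0: "(lam0, c) \<in> U" and lam0: "lam0 \<le> 0" and root: "larger_real_root (\<mu> (lam0, c)) lam0 c"
    using fp by (auto simp: family_parameters_def)
  define r where "r = 4 * (\<mu> (lam0, c) + 1/2) + 2 * c\<^sup>2"
  have r: "r > 0" using larger_real_root_double[OF root c ode] by (simp add: r_def)
  obtain X O' where O': "open O'" "(lam0, c) \<in> O'" "O' \<subseteq> U" "continuous_on O' X"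
    and X0: "X (lam0, c) = (c, 0, r)"
    and par: "\<And>lam k. (lam, k) \<in> O' \<Longrightarrow> elastic_parameters (fst (X (lam, k))) (fst (snd (X (lam, k)))) (snd (snd (X (lam, k)))) (\<mu> (lam, k)) lam k"
    by (rule continuous_triple[OF an Uo U0 ode r[unfolded r_def], folded r_def], rule that)
  \<comment> \<open>Approaching from the left keeps \<open>lam \<le> 0\<close> even if
    \<open>lam0\<close> were 0, and by uniqueness the curves met on the way are not circles.\<close>
  define F where "F = at_left lam0"
  have F: "F \<noteq> bot" by (simp add: F_def)
  define x where "x lam = X (lam, c)" for lam
  have lim: "((\<lambda>lam. (lam, c)) \<longlongrightarrow> (lam0, c)) F" unfolding F_def by (intro tendsto_intros)
  have "isCont X (lam0, c)" using O' by (simp add: continuous_on_eq_continuous_at)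
  then have xlim: "(x \<longlongrightarrow> (c, 0, r)) F" unfolding x_def X0[symmetric] using lim by (rule isCont_tendsto_compose)
  have evO: "\<forall>\<^sub>F lam in F. (lam, c) \<in> O'" using topological_tendstoD[OF lim O'(1,2)] .
  have evl: "\<forall>\<^sub>F lam in F. lam < lam0" unfolding F_def by (simp add: eventually_at_filter)
  define G where "G = {p :: real \<times> real \<times> real. 0 < snd (snd p)} \<inter> {p. \<bar>fst (snd p)\<bar> < fst p} \<inter> {p. (fst (snd p))\<^sup>2 < 2} \<inter> {p. 0 < fst p}"
  have oG: "open G" unfolding G_def by (intro open_Int open_Collect_less continuous_intros)
  have evG: "\<forall>\<^sub>F lam in F. x lam \<in> G" by (rule topological_tendstoD[OF xlim oG]) (use c r in \<open>simp add: G_def\<close>)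
  have ev: "\<forall>\<^sub>F lam in F. (\<exists>\<gamma> T. n_lobed_constrained_elastic n (\<mu> (lam, c)) lam c \<gamma> T) \<and> fst (snd (x lam)) \<noteq> 0 \<and> x lam \<in> G \<and>
      elastic_parameters (fst (x lam)) (fst (snd (x lam))) (snd (snd (x lam))) (\<mu> (lam, c)) lam c"
    using evO evl evG
  proof eventually_elim
    case (elim lam)
    have U: "(lam, c) \<in> U" using elim O' by blast
    have p: "elastic_parameters (fst (x lam)) (fst (snd (x lam))) (snd (snd (x lam))) (\<mu> (lam, c)) lam c"
      using par elim by (simp add: x_def)
    have "fst (snd (x lam)) \<noteq> 0"
    proof
      assume z: "fst (snd (x lam)) = 0"
      have "lam = lam0"
        by (rule circle_lambda_unique[OF fam c U _ p[unfolded z] _ fp con]) (use elim lam0 in \<open>auto simp: G_def\<close>)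
      then show False using elim by simp
    qed
    then show ?case using lobes[OF U] elim p by blast
  qed
  have facts: "\<forall>\<^sub>F lam in F. real n * \<bar>integral {0..2 * pi} (angle_density (fst (x lam)) (fst (snd (x lam))) (snd (snd (x lam))))\<bar> = 2 * pi \<and>
     cmod (cis (2 * pi / real n) - 1) ^ 2 * (1 / (2 * (fst (x lam))\<^sup>2 + 2)) \<le>
       (3 * \<bar>fst (snd (x lam))\<bar> * curvature_period (fst (x lam)) (fst (snd (x lam))) (snd (snd (x lam)))
         + \<bar>1 - cos (sqrt (1 + (fst (x lam))\<^sup>2) * curvature_period (fst (x lam)) (fst (snd (x lam))) (snd (snd (x lam))))\<bar>
         + \<bar>sin (sqrt (1 + (fst (x lam))\<^sup>2) * curvature_period (fst (x lam)) (fst (snd (x lam))) (snd (snd (x lam))))\<bar>)\<^sup>2"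
    using ev
  proof eventually_elim
    case (elim lam)
    obtain c' e' r' where xl: "x lam = (c', e', r')" by (metis prod_cases3)
    obtain \<gamma> T where lob: "n_lobed_constrained_elastic n (\<mu> (lam, c)) lam c \<gamma> T" using elim by blast
    have h: "r' > 0" "e' \<noteq> 0" "\<bar>e'\<bar> < c'" "e'\<^sup>2 \<le> 2" "c' > 0" and p: "elastic_parameters c' e' r' (\<mu> (lam, c)) lam c"
      using elim by (auto simp: xl G_def)
    note f = lobed_curve_facts[OF n2 h(1-3) p lob]
    have "cmod (cis (2 * pi / real n) - 1) ^ 2 * (1 / (2 * c'\<^sup>2 + 2)) \<le> cmod (cis (2 * pi / real n) - 1) ^ 2 *
       ((tangent_sq c' e' r' (pi/2) + (axis_speed c' e' r' (pi/2))\<^sup>2) / (axis_norm c' e' r')\<^sup>2)"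
      by (intro mult_left_mono off_axis_bound h) auto
    then show ?case using f(2,4) unfolding xl by simp
  qed
  define Tc where "Tc p = curvature_period (fst p) (fst (snd p)) (snd (snd p))" for p :: "real \<times> real \<times> real"
  have "isCont Tc (c, 0, r)"
  proof -
    have "open {p :: real \<times> real \<times> real. 0 < snd (snd p)}" by (intro open_Collect_less continuous_intros)
    then show ?thesis using continuous_on_curvature_period r unfolding Tc_def by (simp add: continuous_on_eq_continuous_at)
  qed
  then have Tlim: "((\<lambda>lam. Tc (x lam)) \<longlongrightarrow> Tc (c, 0, r)) F" using xlim by (rule isCont_tendsto_compose)
  note v = circle_values[OF c r]
  define w where "w = sqrt (1 + c\<^sup>2)"
  have w: "w > 0" by (simp add: w_def add_pos_nonneg)
  \<comment> \<open>At \<open>r = 4\<close> the limiting lobe is a full turn, so the displacement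
    bound tends to 0, whereas a rotation by 2 pi / n moves a point away from the axis by a definite
    amount.\<close>
  have "r \<noteq> 4"
  proof
    assume "r = 4"
    then have T0: "Tc (c, 0, r) = 2 * pi / w" using v(1) by (simp add: Tc_def w_def add.commute)
    define d where "d = cmod (cis (2 * pi / real n) - 1) ^ 2"
    have xl: "((\<lambda>lam. fst (x lam)) \<longlongrightarrow> c) F" "((\<lambda>lam. fst (snd (x lam))) \<longlongrightarrow> 0) F"
      using tendsto_fst[OF xlim] tendsto_fst[OF tendsto_snd[OF xlim]] by simp_all
    have l1: "((\<lambda>lam. d * (1 / (2 * (fst (x lam))\<^sup>2 + 2))) \<longlongrightarrow> d * (1 / (2 * c\<^sup>2 + 2))) F"
      by (intro tendsto_intros xl) (smt (verit) zero_le_power2)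
    have l2: "((\<lambda>lam. (3 * \<bar>fst (snd (x lam))\<bar> * Tc (x lam) + \<bar>1 - cos (sqrt (1 + (fst (x lam))\<^sup>2) * Tc (x lam))\<bar>
         + \<bar>sin (sqrt (1 + (fst (x lam))\<^sup>2) * Tc (x lam))\<bar>)\<^sup>2) \<longlongrightarrow>
       (3 * \<bar>0\<bar> * Tc (c, 0, r) + \<bar>1 - cos (sqrt (1 + c\<^sup>2) * Tc (c, 0, r))\<bar> + \<bar>sin (sqrt (1 + c\<^sup>2) * Tc (c, 0, r))\<bar>)\<^sup>2) F"
      by (intro tendsto_intros xl Tlim)
    have z: "(3 * \<bar>0\<bar> * Tc (c, 0, r) + \<bar>1 - cos (sqrt (1 + c\<^sup>2) * Tc (c, 0, r))\<bar> + \<bar>sin (sqrt (1 + c\<^sup>2) * Tc (c, 0, r))\<bar>)\<^sup>2 = 0"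
      unfolding T0 w_def[symmetric] using w by simp
    have "\<forall>\<^sub>F lam in F. d * (1 / (2 * (fst (x lam))\<^sup>2 + 2)) \<le> (3 * \<bar>fst (snd (x lam))\<bar> * Tc (x lam) + \<bar>1 - cos (sqrt (1 + (fst (x lam))\<^sup>2) * Tc (x lam))\<bar>
         + \<bar>sin (sqrt (1 + (fst (x lam))\<^sup>2) * Tc (x lam))\<bar>)\<^sup>2"
      using facts unfolding d_def Tc_def by eventually_elim blast
    from tendsto_le[OF F l2[unfolded z] l1 this] have "d * (1 / (2 * c\<^sup>2 + 2)) \<le> 0" .
    moreover have "2 * c\<^sup>2 + 2 > 0" by (simp add: add_nonneg_pos)
    ultimately have "d \<le> 0" by (simp add: divide_le_0_iff)
    then have "cis (2 * pi / real n) = 1" by (simp add: d_def)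
    then have "cos (2 * pi / real n) = 1" by (metis Re_complex_of_real cis.sel(1) of_real_1)
    then obtain j :: int where "2 * pi / real n = of_int j * 2 * pi" using cos_one_2pi_int by auto
    then have "2 * pi * (1 / real n) = 2 * pi * of_int j" by simp
    then have j: "1 / real n = of_int j" by (simp only: mult_cancel_left) simp
    have "0 < 1 / real n" "1 / real n < 1" using n2 by auto
    then show False unfolding j by simp
  qed
  define I where "I p = integral {0..2 * pi} (angle_density (fst p) (fst (snd p)) (snd (snd p)))" for p :: "real \<times> real \<times> real"
  have "(c, 0, r) \<in> nonresonant" using c r \<open>r \<noteq> 4\<close> by (simp add: nonresonant_def)
  then have "isCont I (c, 0, r)" using continuous_on_angle_height(1) open_nonresonant unfolding I_def
    by (simp add: continuous_on_eq_continuous_at)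
  then have "((\<lambda>lam. real n * \<bar>I (x lam)\<bar>) \<longlongrightarrow> real n * \<bar>I (c, 0, r)\<bar>) F"
    using isCont_tendsto_compose[OF _ xlim] by (intro tendsto_intros) blast
  moreover have "((\<lambda>lam. real n * \<bar>I (x lam)\<bar>) \<longlongrightarrow> 2 * pi) F"
  proof (rule tendsto_eventually)
    show "\<forall>\<^sub>F lam in F. real n * \<bar>I (x lam)\<bar> = 2 * pi" using facts unfolding I_def by eventually_elim blast
  qed
  \<comment> \<open>The angle condition of the noncircular curves passes to the limit, and the
    explicit value at the circle then determines \<open>r\<close>.\<close>
  ultimately have "real n * \<bar>I (c, 0, r)\<bar> = 2 * pi" using tendsto_unique[OF F] by blast
  then have eq: "real n * (2 * pi * w / sqrt (c\<^sup>2 + r / 4)) = 2 * pi"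
    using v(2)[OF \<open>r \<noteq> 4\<close>] by (simp add: I_def w_def)
  have pos: "c\<^sup>2 + r / 4 > 0" using r by (simp add: add_nonneg_pos)
  have "real n * w = sqrt (c\<^sup>2 + r / 4)" using eq pos by (simp add: field_simps)
  then have "(real n * w)\<^sup>2 = c\<^sup>2 + r / 4" using pos by simp
  then have "(real n)\<^sup>2 * (1 + c\<^sup>2) = c\<^sup>2 + r / 4" by (simp add: power_mult_distrib w_def)
  then have rg: "r = circle_gap n c" by (simp add: circle_gap_def field_simps)
  have "lam0 = - c * r / 4" using ode by (simp add: r_def power2_eq_square power3_eq_cube field_simps)
  then have lam: "circle_lambda n c = lam0" by (simp add: circle_lambda_def rg)
  show "(circle_lambda n c, c) \<in> family_parameters U \<mu>"
    "constrained_elastic_curvature (\<mu> (circle_lambda n c, c)) (circle_lambda n c) c (\<lambda>_. c)"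
    "4 * (\<mu> (circle_lambda n c, c) + 1/2) + 2 * c\<^sup>2 = circle_gap n c"
    unfolding lam using fp con rg by (simp_all add: r_def)
qed

text \<open>Near 2 pi a small sine forces the total turning to be 2 pi + O(e), and the phase period
  is 2 pi / w + O(e). Together w = n \<Omega> + O(e), hence \<open>r\<close> and then
  \<open>lam\<close> differ by O(e) from the values of a circle. This linear rate prevents
  \<open>e\<close> from vanishing to higher order.\<close>

lemma circle_lambda_estimate:
  assumes n2: "n \<ge> 2" and c0: "c0 > 0"
  obtains K G where "K > 0" "open G" "(c0, 0, circle_gap n c0) \<in> G"
    "\<And>c e r. (c, e, r) \<in> G \<Longrightarrow>
      \<bar>sin (sqrt (1 + c\<^sup>2) * (real n * curvature_period c e r))\<bar> \<le> 2 * \<bar>e\<bar> * (real n * curvature_period c e r) \<Longrightarrow>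
      \<bar>- c * (r + e\<^sup>2) / 4 - circle_lambda n (c + e)\<bar> \<le> K * \<bar>e\<bar>"
proof -
  define w where "w p = sqrt ((fst p)\<^sup>2 + snd (snd p) / 4)" for p :: "real \<times> real \<times> real"
  define \<Omega> where "\<Omega> p = sqrt (1 + (fst p)\<^sup>2)" for p :: "real \<times> real \<times> real"
  \<comment> \<open>\<open>A * \<bar>e\<bar>\<close> will bound the error of w^2, and
    \<open>B * \<bar>e\<bar>\<close> that of \<open>lam\<close>. As \<open>K\<close> exceeds the
    value of \<open>B\<close> at the circle, \<open>B p < K\<close> holds on a
    neighbourhood.\<close>
  define A where "A p = w p * (real n * (2 * fst p * \<Omega> p + 4)) * (real n * \<Omega> p + w p)" for p :: "real \<times> real \<times> real"
  define B where "B p = fst p * A p + fst p * \<bar>fst (snd p)\<bar> +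
     \<bar>(real n)\<^sup>2 + ((real n)\<^sup>2 - 1) * (3 * (fst p)\<^sup>2 + 3 * fst p * fst (snd p) + (fst (snd p))\<^sup>2)\<bar>" for p :: "real \<times> real \<times> real"
  define p0 where "p0 = (c0, 0 :: real, circle_gap n c0)"
  define K where "K = \<bar>B p0\<bar> + 1"
  define \<theta> where "\<theta> p = \<Omega> p * (real n * curvature_period (fst p) (fst (snd p)) (snd (snd p)))" for p
  have cont: "continuous_on UNIV w" "continuous_on UNIV \<Omega>"
    unfolding w_def \<Omega>_def by (intro continuous_intros; simp)+
  have cB: "continuous_on UNIV B" unfolding B_def A_def by (intro continuous_intros cont)
  define R where "R = {p :: real \<times> real \<times> real. 0 < snd (snd p)}"
  have oR: "open R" unfolding R_def by (intro open_Collect_less continuous_intros)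
  have c\<theta>: "continuous_on R \<theta>" unfolding \<theta>_def R_def
    by (intro continuous_intros continuous_on_curvature_period continuous_on_subset[OF cont(2)]) simp
  \<comment> \<open>The window of radius 1 around 2 pi separates the right zero of the sine from the
    others.\<close>
  define P where "P = R \<inter> \<theta> -` {2 * pi - 1<..<2 * pi + 1}"
  define G where "G = P \<inter> {p. 0 < fst p} \<inter> {p. \<bar>fst (snd p)\<bar> < fst p} \<inter> {p. 4 < snd (snd p)} \<inter> {p. B p < K}"
  have "open P" unfolding P_def by (rule continuous_open_preimage[OF c\<theta> oR]) simp
  then have oG: "open G" unfolding G_def by (intro open_Int open_Collect_less continuous_intros cB)
  have gap: "circle_gap n c0 > 4" "sqrt (c0\<^sup>2 + circle_gap n c0 / 4) = real n * sqrt (1 + c0\<^sup>2)"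
    using circle_gap[OF n2] by auto
  have "\<theta> p0 = 2 * pi"
  proof -
    have "sqrt (1 + c0\<^sup>2) > 0" by (simp add: add_pos_nonneg)
    then show ?thesis using circle_values(1)[OF c0, of "circle_gap n c0"] gap n2
      by (simp add: \<theta>_def \<Omega>_def p0_def)
  qed
  then have p0: "p0 \<in> G" using c0 gap by (simp add: G_def P_def R_def p0_def K_def)
  have est: "\<bar>- c * (r + e\<^sup>2) / 4 - circle_lambda n (c + e)\<bar> \<le> K * \<bar>e\<bar>"
    if g: "(c, e, r) \<in> G"
      and s: "\<bar>sin (sqrt (1 + c\<^sup>2) * (real n * curvature_period c e r))\<bar> \<le> 2 * \<bar>e\<bar> * (real n * curvature_period c e r)" for c e r
  proof -
    have c: "c > 0" and ec: "\<bar>e\<bar> \<le> c" and r: "r > 4" and BK: "B (c, e, r) < K"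
      and th: "\<bar>\<theta> (c, e, r) - 2 * pi\<bar> \<le> 1" using g by (auto simp: G_def P_def abs_le_iff)
    define W O' T where "W = w (c, e, r)" and "O' = \<Omega> (c, e, r)" and "T = curvature_period c e r"
    have r0: "c\<^sup>2 + r / 4 > 0" using r by (simp add: add_nonneg_pos)
    have W: "W > 0" "W\<^sup>2 = c\<^sup>2 + r / 4" using r0 by (simp_all add: W_def w_def)
    have Om: "O' > 0" "O'\<^sup>2 = 1 + c\<^sup>2" by (simp_all add: O'_def \<Omega>_def add_pos_nonneg)
    have th': "\<theta> (c, e, r) = O' * (real n * T)" by (simp add: \<theta>_def O'_def T_def)
    have r4: "r \<ge> 4" using r by simp
    note Te = curvature_period_estimate[OF c r4 ec]
    have "\<bar>O' * (real n * T) - 2 * pi\<bar> \<le> 2 * \<bar>sin (O' * (real n * T) - 2 * pi)\<bar>"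
      by (rule abs_le_twice_abs_sin) (use th th' in simp)
    also have "sin (O' * (real n * T) - 2 * pi) = sin (O' * (real n * T))"
      using sin_periodic[of "O' * (real n * T) - 2 * pi"] by simp
    also have "2 * \<bar>sin (O' * (real n * T))\<bar> \<le> 2 * (2 * \<bar>e\<bar> * (real n * T))"
      using s by (simp add: O'_def \<Omega>_def T_def)
    also have "\<dots> \<le> 2 * (2 * \<bar>e\<bar> * (real n * (2 * pi)))"
      using Te(2) by (intro mult_left_mono) (auto simp: T_def)
    finally have 1: "\<bar>O' * (real n * T) - 2 * pi\<bar> \<le> 2 * (2 * \<bar>e\<bar> * (real n * (2 * pi)))" .
    have "\<bar>O' * real n * (2 * pi / W - T)\<bar> = O' * real n * \<bar>T - 2 * pi / W\<bar>"
      using Om by (simp add: abs_mult abs_minus_commute)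
    also have "\<dots> \<le> O' * real n * (2 * pi * (2 * c * \<bar>e\<bar>))"
      using Te(1) Om by (intro mult_left_mono) (auto simp: T_def W_def w_def)
    finally have 2: "\<bar>O' * real n * (2 * pi / W - T)\<bar> \<le> O' * real n * (2 * pi * (2 * c * \<bar>e\<bar>))" .
    have "O' * real n * (2 * pi / W) - 2 * pi = O' * real n * (2 * pi / W - T) + (O' * (real n * T) - 2 * pi)"
      by (simp add: algebra_simps)
    then have "\<bar>O' * real n * (2 * pi / W) - 2 * pi\<bar> \<le> O' * real n * (2 * pi * (2 * c * \<bar>e\<bar>)) + 2 * (2 * \<bar>e\<bar> * (real n * (2 * pi)))"
      using 1 2 by linarith
    also have "\<dots> = 2 * pi * (real n * (2 * c * O' + 4) * \<bar>e\<bar>)" by (simp add: algebra_simps)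
    also have "O' * real n * (2 * pi / W) - 2 * pi = 2 * pi * ((real n * O' - W) / W)" using W(1) by (simp add: field_simps)
    finally have "2 * pi * \<bar>(real n * O' - W) / W\<bar> \<le> 2 * pi * (real n * (2 * c * O' + 4) * \<bar>e\<bar>)" by (simp add: abs_mult)
    then have "\<bar>(real n * O' - W) / W\<bar> \<le> real n * (2 * c * O' + 4) * \<bar>e\<bar>" by (rule mult_left_le_imp_le) simp
    then have 3: "\<bar>real n * O' - W\<bar> \<le> W * (real n * (2 * c * O' + 4) * \<bar>e\<bar>)"
      using W(1) by (simp add: abs_divide pos_divide_le_eq mult.commute)
    have nn: "real n * O' + W \<ge> 0" using W(1) Om(1) by simp
    have "(real n * O')\<^sup>2 - W\<^sup>2 = (real n * O' - W) * (real n * O' + W)" by (simp add: power2_eq_square algebra_simps)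
    then have "\<bar>(real n * O')\<^sup>2 - W\<^sup>2\<bar> = \<bar>real n * O' - W\<bar> * (real n * O' + W)"
      by (simp add: abs_mult abs_of_nonneg[OF nn])
    also have "\<dots> \<le> W * (real n * (2 * c * O' + 4) * \<bar>e\<bar>) * (real n * O' + W)"
      using 3 W Om by (intro mult_right_mono) auto
    also have "\<dots> = A (c, e, r) * \<bar>e\<bar>" by (simp add: A_def W_def O'_def)
    finally have 4: "\<bar>(real n * O')\<^sup>2 - W\<^sup>2\<bar> \<le> A (c, e, r) * \<bar>e\<bar>" .
    have gr: "r - circle_gap n c = - 4 * ((real n * O')\<^sup>2 - W\<^sup>2)"
      unfolding power_mult_distrib W(2) Om(2) circle_gap_def by (simp add: field_simps)
    \<comment> \<open>\<open>e * Z\<close> is the difference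
      \<open>circle_lambda n c - circle_lambda n (c + e)\<close>.\<close>
    define Z where "Z = (real n)\<^sup>2 + ((real n)\<^sup>2 - 1) * (3 * c\<^sup>2 + 3 * c * e + e\<^sup>2)"
    have "- c * (r + e\<^sup>2) / 4 - circle_lambda n (c + e) = - (c / 4) * (r - circle_gap n c) - (c / 4) * e\<^sup>2 + e * Z"
      by (simp add: circle_lambda_def circle_gap_def Z_def power2_eq_square field_simps)
    also have "\<dots> = c * ((real n * O')\<^sup>2 - W\<^sup>2) - (c / 4) * e\<^sup>2 + e * Z" unfolding gr by (simp add: field_simps)
    finally have "\<bar>- c * (r + e\<^sup>2) / 4 - circle_lambda n (c + e)\<bar> \<le>
       \<bar>c * ((real n * O')\<^sup>2 - W\<^sup>2)\<bar> + \<bar>(c / 4) * e\<^sup>2\<bar> + \<bar>e * Z\<bar>" by linarith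
    also have "\<dots> = c * \<bar>(real n * O')\<^sup>2 - W\<^sup>2\<bar> + c / 4 * (\<bar>e\<bar> * \<bar>e\<bar>) + \<bar>e\<bar> * \<bar>Z\<bar>"
      using c by (simp add: abs_mult power2_eq_square)
    also have "\<dots> \<le> c * (A (c, e, r) * \<bar>e\<bar>) + c * (\<bar>e\<bar> * \<bar>e\<bar>) + \<bar>e\<bar> * \<bar>Z\<bar>"
      using 4 c by (intro add_mono mult_left_mono mult_right_mono) auto
    also have "\<dots> = B (c, e, r) * \<bar>e\<bar>" by (simp add: B_def Z_def algebra_simps)
    also have "\<dots> \<le> K * \<bar>e\<bar>" using BK by (intro mult_right_mono) auto
    finally show ?thesis .
  qed
  show ?thesis by (rule that[OF _ oG p0[unfolded p0_def] est]) (simp add: K_def)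
qed

text \<open>Brouwer for the map p - (f p, g p) cut off to the rectangle: at a fixed point a nonzero
  component would have to be stopped by an edge, where the sign condition excludes it.\<close>

lemma poincare_miranda:
  fixes f g :: "real \<times> real \<Rightarrow> real"
  assumes ab: "a \<le> b" "c \<le> d" and cf: "continuous_on ({a..b} \<times> {c..d}) f" and cg: "continuous_on ({a..b} \<times> {c..d}) g"
    and f: "\<And>y. c \<le> y \<Longrightarrow> y \<le> d \<Longrightarrow> f (a, y) \<le> 0 \<and> 0 \<le> f (b, y)"
    and g: "\<And>x. a \<le> x \<Longrightarrow> x \<le> b \<Longrightarrow> g (x, c) \<le> 0 \<and> 0 \<le> g (x, d)"
  obtains x y where "a \<le> x" "x \<le> b" "c \<le> y" "y \<le> d" "f (x, y) = 0" "g (x, y) = 0"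
proof -
  let ?S = "{a..b} \<times> {c..d}"
  define h where "h p = (max a (min b (fst p - f p)), max c (min d (snd p - g p)))" for p
  obtain p where p: "p \<in> ?S" "h p = p"
  proof (rule brouwer[of ?S h])
    show "compact ?S" "convex ?S" "?S \<noteq> {}" using ab by (auto intro: compact_Times convex_Times)
    show "continuous_on ?S h" unfolding h_def by (intro continuous_intros cf cg)
    show "h \<in> ?S \<rightarrow> ?S" using ab by (auto simp: h_def)
  qed
  obtain x y where xy: "p = (x, y)" by (cases p)
  have b: "a \<le> x" "x \<le> b" "c \<le> y" "y \<le> d" using p xy by auto
  have hx: "max a (min b (x - f (x, y))) = x" and hy: "max c (min d (y - g (x, y))) = y" using p xy by (auto simp: h_def)
  have "f (x, y) = 0"
  proof (rule ccontr)
    assume "f (x, y) \<noteq> 0"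
    then have "x = a \<and> f (x, y) > 0 \<or> x = b \<and> f (x, y) < 0" using hx b by (auto simp: max_def min_def split: if_splits)
    then show False using f[OF b(3,4)] by auto
  qed
  moreover have "g (x, y) = 0"
  proof (rule ccontr)
    assume "g (x, y) \<noteq> 0"
    then have "y = c \<and> g (x, y) > 0 \<or> y = d \<and> g (x, y) < 0" using hy b by (auto simp: max_def min_def split: if_splits)
    then show False using g[OF b(1,2)] by auto
  qed
  ultimately show ?thesis using that b by blast
qed

text \<open>Positivity of the angle integral resolves the absolute value left by the winding number,
  so the area is 2 pi + H; the parameters with \<open>e = 0\<close> are served by the explicit
  circle.\<close>

lemma family_member_class:
  assumes n2: "n \<ge> 2" and p: "(c, e, r) \<in> nonresonant" and e: "e \<ge> 0"
    and par: "elastic_parameters c e r (\<mu> (lam, k)) lam k" and fp: "(lam, k) \<in> family_parameters U \<mu>"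
    and lob: "n_lobed_constrained_elastic n (\<mu> (lam, k)) lam k \<gamma> T"
    and ang: "integral {0..2 * pi} (angle_density c e r) > 0"
    and circ: "e = 0 \<Longrightarrow> r = circle_gap n c"
  shows "conformal_class (Complex (1/2 + real n * integral {0..2 * pi} (height_density c e r) / (4 * pi))
     (real n * curvature_period c e r / (4 * pi))) \<in> conformal_classes_of_family n U \<mu>"
proof -
  note d = nonresonantD[OF p]
  obtain \<phi> where "curvature_period c e r > 0" by (rule phase_function[OF d(3), of c e])
  then have T: "real n * curvature_period c e r / (4 * pi) > 0" using n2 by simp
  have mem: "conformal_class \<tau> \<in> conformal_classes_of_family n U \<mu>"
    if "\<exists>g T. n_lobed_constrained_elastic n (\<mu> (lam, k)) lam k g T \<and> hopf_torus_conformal_to g (real n * T) (torus_lattice \<tau>)"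
      "Im \<tau> > 0" for \<tau>
    using that fp unfolding conformal_classes_of_family_def upper_half_plane_def by blast
  show ?thesis
  proof (cases "e = 0")
    case False
    note f = lobed_curve_facts[OF n2 d(3) False d(2) par lob]
    have "real n * integral {0..2 * pi} (angle_density c e r) = 2 * pi" using f(2) ang by simp
    then have "real n * integral {0..2 * pi} (phase_density c e r) = 2 * pi + real n * integral {0..2 * pi} (height_density c e r)"
      unfolding integral_phase_density[OF d(3,6)] by (simp add: distrib_left)
    then have "real n * integral {0..2 * pi} (phase_density c e r) / (4 * pi) = 1/2 + real n * integral {0..2 * pi} (height_density c e r) / (4 * pi)"
      by (simp add: field_simps)
    then show ?thesis using f(5) T by (intro mem) simp_all
  next
    case True
    have k: "k = c" using par True by (simp add: elastic_parameters_def)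
    have r: "r = circle_gap n c" by (rule circ[OF True])
    have r4: "r \<noteq> 4" using circle_gap(1)[OF n2, of c] r by simp
    note v = circle_values[OF d(1,3)]
    have w: "sqrt (c\<^sup>2 + r / 4) = real n * sqrt (1 + c\<^sup>2)" unfolding r by (rule circle_gap(2)[OF n2])
    have H: "real n * integral {0..2 * pi} (height_density c e r) = 2 * pi * c / sqrt (1 + c\<^sup>2)"
      unfolding True v(3)[OF r4] w using n2 by simp
    have L: "real n * curvature_period c e r = 2 * pi / sqrt (1 + c\<^sup>2)"
      unfolding True v(1) w using n2 by simp
    have "c ^ 3 / 2 + (\<mu> (lam, k) + 1/2) * c + lam = 0"
      using elastic_parameters_root_value[OF par] True k by simp
    from circle_hopf_torus[OF n2 this] T show ?thesis unfolding H L by (intro mem) (simp_all add: k)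
  qed
qed

lemma same_sign_on_connected:
  fixes h :: "'a::topological_space \<Rightarrow> real"
  assumes "connected S" "continuous_on S h" "\<And>x. x \<in> S \<Longrightarrow> h x \<noteq> 0" "x \<in> S" "h x > 0" "y \<in> S"
  shows "h y > 0"
proof (rule ccontr)
  assume "\<not> h y > 0"
  then have "h y \<le> 0" by simp
  moreover have "connected (h ` S)" using assms(1,2) by (intro connected_continuous_image)
  then have "\<And>a b z. a \<in> h ` S \<Longrightarrow> b \<in> h ` S \<Longrightarrow> a \<le> z \<Longrightarrow> z \<le> b \<Longrightarrow> z \<in> h ` S"
    unfolding connected_iff_interval by blast
  from this[of "h y" "h x" 0] have "h y \<le> 0 \<Longrightarrow> 0 \<in> h ` S" using assms(4,5,6) by simp
  ultimately have "0 \<in> h ` S" by simp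
  then show False using assms(3) by force
qed

lemma polar_coordinates_unique:
  fixes H L H' L' :: real
  assumes "L > 0" "L' > 0" "H / L = H' / L'" "H\<^sup>2 + L\<^sup>2 = H'\<^sup>2 + L'\<^sup>2"
  shows "H = H'" "L = L'"
proof -
  define q where "q = H / L"
  have H: "H = q * L" using assms(1) by (simp add: q_def)
  have H': "H' = q * L'" using assms(2,3) by (simp add: q_def)
  have "(q\<^sup>2 + 1) * L\<^sup>2 = (q\<^sup>2 + 1) * L'\<^sup>2"
    using assms(4) unfolding H H' by (simp add: power_mult_distrib distrib_right)
  moreover have "q\<^sup>2 + 1 \<noteq> 0" using zero_le_power2[of q] by linarith
  ultimately have "L\<^sup>2 = L'\<^sup>2" by simp
  then show "L = L'" using assms(1,2) by (simp add: power2_eq_iff_nonneg)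
  then show "H = H'" using H H' by simp
qed

text \<open>\<open>X (k, t)\<close> is the triple \<open>(c, e, r)\<close> of the curve with parameters \<open>(circle_lambda n k + \<sigma> t, k)\<close>. The sign
  \<open>\<sigma>\<close> selects the side of the curve of homogeneous tori on which \<open>e > 0\<close>, i.e. \<open>\<kappa>\<^sub>0\<close> is the larger root.\<close>

lemma family_side:
  assumes n2: "n \<ge> 2" and fam: "hopf_torus_family n U \<mu>" and c0: "c0 > 0"
    and G0: "open G0" "(c0, 0, circle_gap n c0) \<in> G0"
  obtains X :: "real \<times> real \<Rightarrow> real \<times> real \<times> real" and \<sigma> \<eta> :: real where "\<bar>\<sigma>\<bar> = 1" "0 < \<eta>" "\<eta> < c0"
    "continuous_on ({c0 - \<eta>..c0 + \<eta>} \<times> {0..\<eta>}) X"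
    "\<And>k. k \<in> {c0 - \<eta>..c0 + \<eta>} \<Longrightarrow> X (k, 0) = (k, 0, circle_gap n k)"
    "\<And>k t. k \<in> {c0 - \<eta>..c0 + \<eta>} \<Longrightarrow> t \<in> {0..\<eta>} \<Longrightarrow> X (k, t) \<in> G0 \<and>
       elastic_parameters (fst (X (k, t))) (fst (snd (X (k, t)))) (snd (snd (X (k, t)))) (\<mu> (circle_lambda n k + \<sigma> * t, k)) (circle_lambda n k + \<sigma> * t) k \<and>
       (circle_lambda n k + \<sigma> * t, k) \<in> family_parameters U \<mu>"
    "\<And>k t. k \<in> {c0 - \<eta>..c0 + \<eta>} \<Longrightarrow> t \<in> {0<..\<eta>} \<Longrightarrow> fst (snd (X (k, t))) > 0"
proof -
  have Uo: "open U" and an: "real_analytic_on2 \<mu> U"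
    and lobes: "\<And>lam k. (lam, k) \<in> U \<Longrightarrow> \<exists>\<gamma> T. n_lobed_constrained_elastic n (\<mu> (lam, k)) lam k \<gamma> T"
    using fam unfolding hopf_torus_family_def by auto
  note cp = circle_parameters[OF n2 fam]
  define l0 where "l0 = circle_lambda n c0"
  have U0: "(l0, c0) \<in> U" using cp(1)[OF c0] by (simp add: family_parameters_def l0_def)
  have ode: "c0 ^ 3 / 2 + (\<mu> (l0, c0) + 1/2) * c0 + l0 = 0"
    using cp(2)[OF c0] by (simp add: constant_curvature_iff l0_def)
  have gap: "4 * (\<mu> (l0, c0) + 1/2) + 2 * c0\<^sup>2 = circle_gap n c0" using cp(3)[OF c0] by (simp add: l0_def)
  have g4: "circle_gap n k > 4" for k by (rule circle_gap(1)[OF n2])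
  then have "4 * (\<mu> (l0, c0) + 1/2) + 2 * c0\<^sup>2 > 0" unfolding gap using order_less_trans[OF _ g4] by auto
  from continuous_triple[OF an Uo U0 ode this] obtain X0 O' where O': "open O'" "(l0, c0) \<in> O'" "O' \<subseteq> U" "continuous_on O' X0"
    and X00: "X0 (l0, c0) = (c0, 0, circle_gap n c0)"
    and par: "\<And>lam k. (lam, k) \<in> O' \<Longrightarrow> elastic_parameters (fst (X0 (lam, k))) (fst (snd (X0 (lam, k)))) (snd (snd (X0 (lam, k)))) (\<mu> (lam, k)) lam k"
    unfolding gap by metis
  obtain K G where K: "K > 0" and G: "open G" "(c0, 0, circle_gap n c0) \<in> G"
    and est: "\<And>c e r. (c, e, r) \<in> G \<Longrightarrow>
      \<bar>sin (sqrt (1 + c\<^sup>2) * (real n * curvature_period c e r))\<bar> \<le> 2 * \<bar>e\<bar> * (real n * curvature_period c e r) \<Longrightarrow>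
      \<bar>- c * (r + e\<^sup>2) / 4 - circle_lambda n (c + e)\<bar> \<le> K * \<bar>e\<bar>"
    by (rule circle_lambda_estimate[OF n2 c0], rule that)
  define G1 where "G1 = G0 \<inter> G \<inter> nonresonant \<inter> {p. 4 < snd (snd p)}"
  have oG1: "open G1" unfolding G1_def using G0 G open_nonresonant
    by (intro open_Int open_Collect_less continuous_intros) auto
  define O1 where "O1 = (O' \<inter> X0 -` G1) \<inter> {p. fst p < 0} \<inter> {p. 0 < snd p}"
  have oO1: "open O1" unfolding O1_def
    by (intro open_Int continuous_open_preimage[OF O'(4,1) oG1] open_Collect_less continuous_intros)
  have l0neg: "l0 < 0" unfolding l0_def circle_lambda_def using c0 g4[of c0] by (simp add: mult_pos_pos)
  have base: "(l0, c0) \<in> O1"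
    using O'(2) X00 G0(2) G(2) circle_gap(3)[OF n2 c0] g4[of c0] l0neg c0 by (simp add: O1_def G1_def)
  \<comment> \<open>Equal to \<open>e\<close> times a factor at least 1, but differentiable in
    \<open>lam\<close>, which is not known for \<open>e\<close> itself.\<close>
  define D where "D lam k = k ^ 3 / 2 + (\<mu> (lam, k) + 1/2) * k + lam" for lam k
  have D_e: "D lam k = fst (snd (X0 (lam, k))) * speed_sq (fst (X0 (lam, k))) (fst (snd (X0 (lam, k)))) (snd (snd (X0 (lam, k)))) 0
      \<and> speed_sq (fst (X0 (lam, k))) (fst (snd (X0 (lam, k)))) (snd (snd (X0 (lam, k)))) 0 \<ge> 1" if "(lam, k) \<in> O1" for lam k
  proof -
    have "(lam, k) \<in> O'" and r: "snd (snd (X0 (lam, k))) > 4" using that by (auto simp: O1_def G1_def)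
    from elastic_parameters_root_value[OF par[OF this(1)]] r show ?thesis
      by (simp add: D_def speed_sq_def add_increasing)
  qed
  \<comment> \<open>If \<open>e = 0\<close>, uniqueness of the circle makes the left side vanish;
    otherwise the member is a closed noncircular curve and the turning estimate applies.\<close>
  have lip: "\<bar>lam - circle_lambda n k\<bar> \<le> K * \<bar>fst (snd (X0 (lam, k)))\<bar>" if lk: "(lam, k) \<in> O1" for lam k
  proof -
    obtain c e r where x: "X0 (lam, k) = (c, e, r)" by (metis prod_cases3)
    have U: "(lam, k) \<in> U" and k: "k > 0" and lam: "lam < 0" and non: "(c, e, r) \<in> nonresonant" and g: "(c, e, r) \<in> G"
      and p: "elastic_parameters c e r (\<mu> (lam, k)) lam k"
      using lk O'(3) par[of lam k] x by (auto simp: O1_def G1_def)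
    note d = nonresonantD[OF non]
    show ?thesis
    proof (cases "e = 0")
      case True
      have "lam = circle_lambda n k"
        by (rule circle_lambda_unique[OF fam k U _ p[unfolded True] d(3) cp(1,2)[OF k]]) (use lam in simp)
      then show ?thesis using K by simp
    next
      case False
      obtain \<gamma> T where lob: "n_lobed_constrained_elastic n (\<mu> (lam, k)) lam k \<gamma> T" using lobes[OF U] by blast
      have "\<bar>- c * (r + e\<^sup>2) / 4 - circle_lambda n (c + e)\<bar> \<le> K * \<bar>e\<bar>"
        by (rule est[OF g lobed_curve_facts(3)[OF n2 d(3) False d(2) p lob]])
      moreover have "lam = - c * (r + e\<^sup>2) / 4" "k = c + e" using p by (simp_all add: elastic_parameters_def)
      ultimately show ?thesis unfolding x by simp
    qed
  qed
  obtain \<sigma> t1 where \<sigma>: "\<bar>\<sigma>\<bar> = 1" and t1: "t1 > 0" "\<And>t. 0 < t \<Longrightarrow> t < t1 \<Longrightarrow> D (l0 + \<sigma> * t) c0 > 0"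
  proof -
    obtain d1 where "((\<lambda>lam. \<mu> (lam, c0)) has_real_derivative d1) (at l0)"
      by (rule real_analytic_on2_differentiable_fst[OF an U0])
    then have "((\<lambda>lam. D lam c0) has_real_derivative d1 * c0 + 1) (at l0)"
      unfolding D_def by (auto intro!: derivative_eq_intros)
    then obtain d where d: "((\<lambda>lam. D lam c0) has_real_derivative d) (at l0)" by blast
    have D0: "D l0 c0 = 0" using ode by (simp add: D_def)
    \<comment> \<open>A vanishing derivative would let the quotient D / (lam - l0) tend to 0, but
      its absolute value is at least 1 / \<open>K\<close>.\<close>
    have "d \<noteq> 0"
    proof
      assume "d = 0"
      then have "((\<lambda>lam. D lam c0 / (lam - l0)) \<longlongrightarrow> 0) (at l0)"
        using d by (simp add: has_field_derivative_iff D0)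
      then have lim: "((\<lambda>lam. \<bar>D lam c0 / (lam - l0)\<bar>) \<longlongrightarrow> 0) (at l0)"
        by (rule tendsto_rabs_zero)
      have tl: "((\<lambda>lam. (lam, c0)) \<longlongrightarrow> (l0, c0)) (at l0)" by (intro tendsto_intros)
      have "\<forall>\<^sub>F lam in at l0. (lam, c0) \<in> O1" by (rule topological_tendstoD[OF tl oO1 base])
      moreover have "\<forall>\<^sub>F lam in at l0. lam \<noteq> l0" by (simp add: eventually_at_filter)
      ultimately have ev: "\<forall>\<^sub>F lam in at l0. 1 / K \<le> \<bar>D lam c0 / (lam - l0)\<bar>"
      proof eventually_elim
        case (elim lam)
        define e q where "e = fst (snd (X0 (lam, c0)))" and "q = speed_sq (fst (X0 (lam, c0))) (fst (snd (X0 (lam, c0)))) (snd (snd (X0 (lam, c0)))) 0"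
        have De: "D lam c0 = e * q" "q \<ge> 1" using D_e[OF elim(1)] by (simp_all add: e_def q_def)
        have "\<bar>lam - l0\<bar> \<le> K * \<bar>e\<bar>" using lip[OF elim(1)] by (simp add: l0_def e_def)
        also have "\<dots> \<le> K * (\<bar>e\<bar> * q)" using K De(2) mult_left_mono[of 1 q "\<bar>e\<bar>"] by (intro mult_left_mono) auto
        also have "\<dots> = K * \<bar>D lam c0\<bar>" using De by (simp add: abs_mult)
        finally show ?case using K elim(2) by (simp add: abs_divide divide_le_eq pos_le_divide_eq mult.commute)
      qed
      have "1 / K \<le> 0" by (rule tendsto_le[OF _ lim tendsto_const ev]) simp
      then show False using K by simp
    qed
    then consider "d > 0" | "d < 0" by linarith
    then show ?thesis
    proof cases
      case 1
      from DERIV_pos_inc_right[OF d 1] obtain \<delta> where "\<delta> > 0" "\<And>h. 0 < h \<Longrightarrow> h < \<delta> \<Longrightarrow> D l0 c0 < D (l0 + h) c0" by blast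
      then show ?thesis using that[of 1 \<delta>] D0 by simp
    next
      case 2
      from DERIV_neg_dec_left[OF d 2] obtain \<delta> where "\<delta> > 0" "\<And>h. 0 < h \<Longrightarrow> h < \<delta> \<Longrightarrow> D l0 c0 < D (l0 - h) c0" by blast
      then show ?thesis using that[of "- 1" \<delta>] D0 by simp
    qed
  qed
  define p where "p q = (circle_lambda n (fst q) + \<sigma> * snd q, fst q)" for q :: "real \<times> real"
  have cpp: "continuous_on A p" for A unfolding p_def circle_lambda_def circle_gap_def by (intro continuous_intros) auto
  have "open (p -` O1)" using oO1 by (rule open_vimage) (rule cpp)
  moreover have "(c0, 0) \<in> p -` O1" using base by (simp add: p_def l0_def)
  ultimately obtain \<epsilon> where \<epsilon>: "\<epsilon> > 0" "ball (c0, 0) \<epsilon> \<subseteq> p -` O1" using open_contains_ball by blast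
  define \<eta> where "\<eta> = min (\<epsilon> / 3) (c0 / 2)"
  have \<eta>: "\<eta> > 0" "\<eta> < c0" "3 * \<eta> \<le> \<epsilon>" using \<epsilon> c0 by (auto simp: \<eta>_def min_def)
  have inO: "p (k, t) \<in> O1" if "k \<in> {c0 - \<eta>..c0 + \<eta>}" "t \<in> {0..\<eta>}" for k t
  proof -
    have "dist (k, t) (c0, 0) \<le> \<bar>k - c0\<bar> + \<bar>t\<bar>"
      using sqrt_sum_squares_le_sum_abs by (simp add: dist_Pair_Pair dist_real_def)
    also have "\<dots> < \<epsilon>" using that \<eta> by (auto simp: abs_le_iff)
    finally have "(k, t) \<in> ball (c0, 0) \<epsilon>" by (simp add: dist_commute)
    then show ?thesis using \<epsilon>(2) by blast
  qed
  define X where "X q = X0 (p q)" for q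
  have cX: "continuous_on ({c0 - \<eta>..c0 + \<eta>} \<times> {0..\<eta>}) X"
    unfolding X_def by (rule continuous_on_compose2[OF O'(4) cpp]) (use inO in \<open>auto simp: O1_def\<close>)
  have e0: "fst (snd (X (k, 0))) = 0" and X_0: "X (k, 0) = (k, 0, circle_gap n k)" if k: "k \<in> {c0 - \<eta>..c0 + \<eta>}" for k
  proof -
    have k0: "k > 0" using k \<eta> by simp
    have o: "(circle_lambda n k, k) \<in> O1" using inO[OF k, of 0] \<eta> by (simp add: p_def)
    have "D (circle_lambda n k) k = 0" using cp(2)[OF k0] by (simp add: D_def constant_curvature_iff)
    then have e: "fst (snd (X0 (circle_lambda n k, k))) = 0" using D_e[OF o] by auto
    then show "fst (snd (X (k, 0))) = 0" by (simp add: X_def p_def)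
    obtain c e' r where x: "X0 (circle_lambda n k, k) = (c, e', r)" by (metis prod_cases3)
    have "elastic_parameters c 0 r (\<mu> (circle_lambda n k, k)) (circle_lambda n k) k"
      using par[of "circle_lambda n k" k] o e by (simp add: O1_def x)
    then have "k = c" "4 * (\<mu> (circle_lambda n k, k) + 1/2) + 2 * k\<^sup>2 = r" by (auto simp: elastic_parameters_def)
    then show "X (k, 0) = (k, 0, circle_gap n k)" using cp(3)[OF k0] e x by (simp add: X_def p_def)
  qed
  \<comment> \<open>For \<open>t > 0\<close> the bound \<open>lip\<close> excludes zeros of
    \<open>e\<close>, so its sign is constant on the connected strip and is decided on the segment
    above \<open>c0\<close>.\<close>
  have pos: "fst (snd (X (k, t))) > 0" if k: "k \<in> {c0 - \<eta>..c0 + \<eta>}" and t: "t \<in> {0<..\<eta>}" for k t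
  proof (rule same_sign_on_connected[of "{c0 - \<eta>..c0 + \<eta>} \<times> {0<..\<eta>}" "\<lambda>q. fst (snd (X q))"])
    let ?S = "{c0 - \<eta>..c0 + \<eta>} \<times> {0<..\<eta>}"
    show "connected ?S" by (intro convex_connected convex_Times) auto
    show "continuous_on ?S (\<lambda>q. fst (snd (X q)))"
      by (intro continuous_intros continuous_on_subset[OF cX]) auto
    show "fst (snd (X q)) \<noteq> 0" if q: "q \<in> ?S" for q
    proof -
      obtain k t where kt: "q = (k, t)" by (cases q)
      have "p (k, t) \<in> O1" using q by (intro inO) (auto simp: kt)
      from lip[OF this[unfolded p_def]] have "\<bar>\<sigma> * t\<bar> \<le> K * \<bar>fst (snd (X (k, t)))\<bar>" by (simp add: X_def p_def)
      then show ?thesis using \<sigma> q by (auto simp: kt abs_mult)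
    qed
    define s where "s = min \<eta> (t1 / 2)"
    have s: "0 < s" "s \<le> \<eta>" "s < t1" using \<eta> t1 by (auto simp: s_def)
    show "(c0, s) \<in> ?S" using s \<eta> by simp
    have o: "(l0 + \<sigma> * s, c0) \<in> O1" using inO[of c0 s] s \<eta> by (simp add: p_def l0_def)
    have "fst (snd (X0 (l0 + \<sigma> * s, c0))) > 0"
      using D_e[OF o] t1(2)[OF s(1,3)] by (smt (verit) mult_nonpos_nonneg)
    then show "fst (snd (X (c0, s))) > 0" by (simp add: X_def p_def l0_def)
    show "(k, t) \<in> ?S" using k t by simp
  qed
  have mem: "X (k, t) \<in> G0 \<and>
       elastic_parameters (fst (X (k, t))) (fst (snd (X (k, t)))) (snd (snd (X (k, t)))) (\<mu> (circle_lambda n k + \<sigma> * t, k)) (circle_lambda n k + \<sigma> * t) k \<and>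
       (circle_lambda n k + \<sigma> * t, k) \<in> family_parameters U \<mu>"
    if k: "k \<in> {c0 - \<eta>..c0 + \<eta>}" and t: "t \<in> {0..\<eta>}" for k t
  proof -
    have o: "(circle_lambda n k + \<sigma> * t, k) \<in> O1" using inO[OF k t] by (simp add: p_def)
    have g: "X (k, t) \<in> G0" and r: "snd (snd (X (k, t))) > 0" using o by (auto simp: X_def p_def O1_def G1_def)
    have pr: "elastic_parameters (fst (X (k, t))) (fst (snd (X (k, t)))) (snd (snd (X (k, t)))) (\<mu> (circle_lambda n k + \<sigma> * t, k)) (circle_lambda n k + \<sigma> * t) k"
      using par[of "circle_lambda n k + \<sigma> * t" k] o by (auto simp: X_def p_def O1_def)
    have "fst (snd (X (k, t))) \<ge> 0"
      using e0[OF k] pos[OF k, of t] t by (cases "t = 0") auto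
    from larger_real_rootI[OF pr this r] o O'(3) have "(circle_lambda n k + \<sigma> * t, k) \<in> family_parameters U \<mu>"
      by (auto simp: family_parameters_def O1_def)
    then show ?thesis using g pr by blast
  qed
  show ?thesis by (rule that[OF \<sigma> \<eta>(1,2) cX X_0 mem pos])
qed

theorem proposition3p1:
  fixes n :: nat and U :: "(real \<times> real) set" and \<mu> :: "real \<times> real \<Rightarrow> real"
  assumes "n \<ge> 2"
    and "hopf_torus_family n U \<mu>"
  shows "\<forall>b::real. b > 1 \<longrightarrow>
    (\<exists>V. openin moduli_space V \<and> conformal_class (Complex 0 b) \<in> V \<and>
         V \<subseteq> conformal_classes_of_family n U \<mu>)"
proof (intro allI impI)
  fix b :: real
  assume b: "b > 1"
  note n2 = assms(1) and fam = assms(2)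
  define c0 where "c0 = (b - 1/b) / 2"
  have "1 / b < 1" using b by simp
  then have "1 / b < b" using b by linarith
  then have c0: "c0 > 0" by (simp add: c0_def)
  define Ia where "Ia p = integral {0..2 * pi} (angle_density (fst p) (fst (snd p)) (snd (snd p)))" for p
  define Ih where "Ih p = integral {0..2 * pi} (height_density (fst p) (fst (snd p)) (snd (snd p)))" for p
  define Ii where "Ii p = integral {0..2 * pi} (iso_density (fst p) (fst (snd p)) (snd (snd p)))" for p
  define Ip where "Ip p = curvature_period (fst p) (fst (snd p)) (snd (snd p))" for p
  \<comment> \<open>\<open>r > 4\<close> makes \<open>axis_speed\<close> positive, as the
    isoperimetric estimate requires; the homogeneous tori satisfy it.\<close>
  define R where "R = nonresonant \<inter> {p. 4 < snd (snd p)}"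
  have oR: "open R" unfolding R_def by (intro open_Int open_nonresonant open_Collect_less continuous_intros)
  have cI: "continuous_on R Ia" "continuous_on R Ih" "continuous_on R Ii" "continuous_on R Ip"
  proof -
    show "continuous_on R Ia" "continuous_on R Ih" unfolding Ia_def Ih_def
      by (rule continuous_on_subset[OF continuous_on_angle_height(1)] continuous_on_subset[OF continuous_on_angle_height(2)],
          simp add: R_def)+
    show "continuous_on R Ii" unfolding Ii_def R_def by (rule continuous_on_iso_integral)
    show "continuous_on R Ip" unfolding Ip_def
      by (rule continuous_on_subset[OF continuous_on_curvature_period]) (auto simp: R_def)
  qed
  have gap: "circle_gap n k > 4" "sqrt (k\<^sup>2 + circle_gap n k / 4) = real n * sqrt (1 + k\<^sup>2)" for k
    using circle_gap[OF n2] by auto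
  have w: "sqrt (1 + k\<^sup>2) > 0" for k :: real by (simp add: add_pos_nonneg)
  have val: "Ih (k, 0, circle_gap n k) = 2 * pi * k / (real n * sqrt (1 + k\<^sup>2))"
    "Ip (k, 0, circle_gap n k) = 2 * pi / (real n * sqrt (1 + k\<^sup>2))" if "k > 0" for k
    using circle_values(1,3)[OF that, of "circle_gap n k"] gap[of k] by (simp_all add: Ih_def Ip_def)
  have Ia0: "Ia (c0, 0, circle_gap n c0) > 0"
  proof -
    have p: "(c0, 0, circle_gap n c0) \<in> nonresonant" by (rule circle_gap(3)[OF n2 c0])
    note d = nonresonantD[OF p]
    have "angle_density c0 0 (circle_gap n c0) x \<ge> 0" for x
      unfolding angle_density_def using d(5)[OF gap(1), of x] d(6)[of x] speed_sq_pos[OF d(3), of c0 0 x]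
      by (intro divide_nonneg_nonneg mult_nonneg_nonneg) (auto simp: axis_norm_def)
    then have "Ia (c0, 0, circle_gap n c0) \<ge> 0"
      unfolding Ia_def by (simp add: integral_nonneg integrable_continuous_real continuous_on_densities[OF d(3,6)])
    moreover have "\<bar>Ia (c0, 0, circle_gap n c0)\<bar> = 2 * pi * sqrt (1 + c0\<^sup>2) / sqrt (c0\<^sup>2 + circle_gap n c0 / 4)"
      using circle_values(2)[OF c0, of "circle_gap n c0"] gap(1)[of c0] by (simp add: Ia_def)
    moreover have "\<dots> > 0" unfolding gap(2) using n2 w[of c0] by simp
    ultimately show ?thesis by linarith
  qed
  \<comment> \<open>An open set of triples on which the angle integral and the integral of
    \<open>iso_density\<close> are both positive; it contains the base circle.\<close>
  define G0 where "G0 = (R \<inter> Ia -` {0<..}) \<inter> (R \<inter> Ii -` {0<..})"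
  have oG0: "open G0" unfolding G0_def
    by (intro open_Int continuous_open_preimage[OF cI(1) oR] continuous_open_preimage[OF cI(3) oR]) auto
  have G00: "(c0, 0, circle_gap n c0) \<in> G0"
    using Ia0 iso_integral_circle[OF n2 c0] circle_gap(3)[OF n2 c0] gap(1)[of c0] by (simp add: G0_def R_def Ii_def)
  obtain X :: "real \<times> real \<Rightarrow> real \<times> real \<times> real" and \<sigma> \<eta> :: real where \<sigma>: "\<bar>\<sigma>\<bar> = 1" and \<eta>: "0 < \<eta>" "\<eta> < c0"
    and cX: "continuous_on ({c0 - \<eta>..c0 + \<eta>} \<times> {0..\<eta>}) X"
    and X0: "\<And>k. k \<in> {c0 - \<eta>..c0 + \<eta>} \<Longrightarrow> X (k, 0) = (k, 0, circle_gap n k)"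
    and Xm: "\<And>k t. k \<in> {c0 - \<eta>..c0 + \<eta>} \<Longrightarrow> t \<in> {0..\<eta>} \<Longrightarrow> X (k, t) \<in> G0 \<and>
       elastic_parameters (fst (X (k, t))) (fst (snd (X (k, t)))) (snd (snd (X (k, t)))) (\<mu> (circle_lambda n k + \<sigma> * t, k)) (circle_lambda n k + \<sigma> * t) k \<and>
       (circle_lambda n k + \<sigma> * t, k) \<in> family_parameters U \<mu>"
    and Xp: "\<And>k t. k \<in> {c0 - \<eta>..c0 + \<eta>} \<Longrightarrow> t \<in> {0<..\<eta>} \<Longrightarrow> fst (snd (X (k, t))) > 0"
    by (rule family_side[OF n2 fam c0 oG0 G00], rule that)
  define H where "H q = real n * Ih (X q)" for q
  define L where "L q = real n * Ip (X q)" for q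
  let ?S = "{c0 - \<eta>..c0 + \<eta>} \<times> {0..\<eta>}"
  have XR: "X q \<in> R" if "q \<in> ?S" for q using Xm that by (cases q) (auto simp: G0_def)
  have cHL: "continuous_on ?S H" "continuous_on ?S L"
    unfolding H_def L_def
    by (intro continuous_intros continuous_on_compose2[OF cI(2) cX] continuous_on_compose2[OF cI(4) cX]; use XR in auto)+
  have Lpos: "L q > 0" if "q \<in> ?S" for q
  proof -
    have "snd (snd (X q)) > 0" using XR[OF that] by (simp add: R_def)
    then obtain \<phi> where "Ip (X q) > 0" unfolding Ip_def by (rule phase_function)
    then show ?thesis using n2 by (simp add: L_def)
  qed
  have lobes: "\<exists>\<gamma> T. n_lobed_constrained_elastic n (\<mu> (lam, k)) lam k \<gamma> T" if "(lam, k) \<in> family_parameters U \<mu>" for lam k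
    using fam that unfolding hopf_torus_family_def family_parameters_def by auto
  have cls: "conformal_class (Complex (1/2 + H (k, t) / (4 * pi)) (L (k, t) / (4 * pi))) \<in> conformal_classes_of_family n U \<mu>"
    if k: "k \<in> {c0 - \<eta>..c0 + \<eta>}" and t: "t \<in> {0..\<eta>}" for k t
  proof -
    obtain c e r where x: "X (k, t) = (c, e, r)" by (metis prod_cases3)
    have fp: "(circle_lambda n k + \<sigma> * t, k) \<in> family_parameters U \<mu>" using Xm[OF k t] by blast
    obtain \<gamma> T where lob: "n_lobed_constrained_elastic n (\<mu> (circle_lambda n k + \<sigma> * t, k)) (circle_lambda n k + \<sigma> * t) k \<gamma> T"
      using lobes[OF fp] by blast
    have e: "e \<ge> 0" "e = 0 \<Longrightarrow> r = circle_gap n c"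
      using X0[OF k] Xp[OF k, of t] t x by (cases "t = 0"; auto)+
    show ?thesis unfolding H_def L_def Ih_def Ip_def x fst_conv snd_conv
      by (rule family_member_class[OF n2 _ e(1) _ fp lob _ e(2)]) (use Xm[OF k t] in \<open>auto simp: x G0_def R_def Ia_def\<close>)
  qed
  have at0: "H (k, 0) / L (k, 0) = k" "(H (k, 0))\<^sup>2 + (L (k, 0))\<^sup>2 = 4 * pi\<^sup>2" if k: "k \<in> {c0 - \<eta>..c0 + \<eta>}" for k
  proof -
    have k0: "k > 0" using k \<eta> by simp
    have HL: "H (k, 0) = 2 * pi * k / sqrt (1 + k\<^sup>2)" "L (k, 0) = 2 * pi / sqrt (1 + k\<^sup>2)"
      using n2 by (simp_all add: H_def L_def X0[OF k] val[OF k0])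
    show "H (k, 0) / L (k, 0) = k" unfolding HL using w[of k] by simp
    have "(H (k, 0))\<^sup>2 + (L (k, 0))\<^sup>2 = ((2 * pi * k)\<^sup>2 + (2 * pi)\<^sup>2) / (sqrt (1 + k\<^sup>2))\<^sup>2"
      unfolding HL power_divide by (simp only: add_divide_distrib)
    also have "(2 * pi * k)\<^sup>2 + (2 * pi)\<^sup>2 = 4 * pi\<^sup>2 * (sqrt (1 + k\<^sup>2))\<^sup>2"
      by (simp add: power_mult_distrib distrib_left)
    finally show "(H (k, 0))\<^sup>2 + (L (k, 0))\<^sup>2 = 4 * pi\<^sup>2" using w[of k] by simp
  qed
  have iso: "(H (k, t))\<^sup>2 + (L (k, t))\<^sup>2 > 4 * pi\<^sup>2" if k: "k \<in> {c0 - \<eta>..c0 + \<eta>}" and t: "t \<in> {0<..\<eta>}" for k t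
  proof -
    obtain c e r where x: "X (k, t) = (c, e, r)" by (metis prod_cases3)
    have t': "t \<in> {0..\<eta>}" using t by simp
    have fp: "(circle_lambda n k + \<sigma> * t, k) \<in> family_parameters U \<mu>" and g: "(c, e, r) \<in> G0"
      and p: "elastic_parameters c e r (\<mu> (circle_lambda n k + \<sigma> * t, k)) (circle_lambda n k + \<sigma> * t) k"
      using Xm[OF k t'] by (auto simp: x)
    have non: "(c, e, r) \<in> nonresonant" and r: "r > 4" and ia: "integral {0..2 * pi} (angle_density c e r) > 0"
      and ii: "integral {0..2 * pi} (iso_density c e r) > 0"
      using g by (auto simp: G0_def R_def Ia_def Ii_def)
    have e: "e \<noteq> 0" using Xp[OF k t] by (simp add: x)
    note d = nonresonantD[OF non]
    obtain \<gamma> T where lob: "n_lobed_constrained_elastic n (\<mu> (circle_lambda n k + \<sigma> * t, k)) (circle_lambda n k + \<sigma> * t) k \<gamma> T"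
      using lobes[OF fp] by blast
    have "real n * integral {0..2 * pi} (angle_density c e r) = 2 * pi"
      using lobed_curve_facts(2)[OF n2 d(3) e d(2) p lob] ia by simp
    from isoperimetric[OF _ non r e ii this] n2 show ?thesis
      by (simp add: H_def L_def Ih_def Ip_def x)
  qed
  have cq: "continuous_on ?S (\<lambda>q. H q / L q)"
    using Lpos by (intro continuous_intros cHL) force
  \<comment> \<open>At \<open>t = 0\<close> the ratio H / L equals \<open>k\<close>; by continuity
    it moves by less than \<open>\<eta> / 2\<close> on short vertical edges, which leaves the ratios
    within \<open>\<eta> / 2\<close> of \<open>c0\<close> in between.\<close>
  obtain t1 where t1: "0 < t1" "t1 \<le> \<eta>"
    and side: "\<And>t. t \<in> {0..t1} \<Longrightarrow> H (c0 - \<eta>, t) / L (c0 - \<eta>, t) < c0 - \<eta> / 2 \<and> c0 + \<eta> / 2 < H (c0 + \<eta>, t) / L (c0 + \<eta>, t)"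
  proof -
    have ex: "\<exists>\<delta>>0. \<forall>t\<in>{0..\<eta>}. t < \<delta> \<longrightarrow> \<bar>H (k, t) / L (k, t) - k\<bar> < \<eta> / 2" if k: "k \<in> {c0 - \<eta>..c0 + \<eta>}" for k
    proof -
      have "continuous_on {0..\<eta>} (\<lambda>t. H (k, t) / L (k, t))"
        by (rule continuous_on_compose2[OF cq]) (use k in \<open>auto intro!: continuous_intros\<close>)
      then obtain \<delta> where \<delta>: "\<delta> > 0" "\<forall>t\<in>{0..\<eta>}. dist t 0 < \<delta> \<longrightarrow> dist (H (k, t) / L (k, t)) (H (k, 0) / L (k, 0)) < \<eta> / 2"
        unfolding continuous_on_iff using \<eta> by (metis atLeastAtMost_iff half_gt_zero less_eq_real_def)
      then show ?thesis unfolding at0(1)[OF k] by (intro exI[of _ \<delta>]) (auto simp: dist_real_def)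
    qed
    obtain \<delta>1 where d1: "\<delta>1 > 0" "\<forall>t\<in>{0..\<eta>}. t < \<delta>1 \<longrightarrow> \<bar>H (c0 - \<eta>, t) / L (c0 - \<eta>, t) - (c0 - \<eta>)\<bar> < \<eta> / 2"
      using ex[of "c0 - \<eta>"] \<eta> by auto
    obtain \<delta>2 where d2: "\<delta>2 > 0" "\<forall>t\<in>{0..\<eta>}. t < \<delta>2 \<longrightarrow> \<bar>H (c0 + \<eta>, t) / L (c0 + \<eta>, t) - (c0 + \<eta>)\<bar> < \<eta> / 2"
      using ex[of "c0 + \<eta>"] \<eta> by auto
    define t1 where "t1 = min \<eta> (min \<delta>1 \<delta>2 / 2)"
    have t1: "0 < t1" "t1 \<le> \<eta>" "t1 < \<delta>1" "t1 < \<delta>2" using \<eta> d1 d2 by (auto simp: t1_def min_def)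
    show ?thesis
    proof (rule that[OF t1(1,2)])
      fix t assume t: "t \<in> {0..t1}"
      have "\<bar>H (c0 - \<eta>, t) / L (c0 - \<eta>, t) - (c0 - \<eta>)\<bar> < \<eta> / 2" "\<bar>H (c0 + \<eta>, t) / L (c0 + \<eta>, t) - (c0 + \<eta>)\<bar> < \<eta> / 2"
        using d1(2) d2(2) t t1 by auto
      then show "H (c0 - \<eta>, t) / L (c0 - \<eta>, t) < c0 - \<eta> / 2 \<and> c0 + \<eta> / 2 < H (c0 + \<eta>, t) / L (c0 + \<eta>, t)"
        by linarith
    qed
  qed
  define Z where "Z q = (H q)\<^sup>2 + (L q)\<^sup>2" for q
  have cZ: "continuous_on ?S Z" unfolding Z_def by (intro continuous_intros cHL)
  \<comment> \<open>The strict isoperimetric inequality on the compact upper edge leaves a uniform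
    gap above 4 pi^2.\<close>
  obtain \<xi> where \<xi>: "\<xi> > 0" and top: "\<And>k. k \<in> {c0 - \<eta>..c0 + \<eta>} \<Longrightarrow> 4 * pi\<^sup>2 + \<xi> \<le> Z (k, t1)"
  proof -
    have "continuous_on {c0 - \<eta>..c0 + \<eta>} (\<lambda>k. Z (k, t1))"
      by (rule continuous_on_compose2[OF cZ]) (use t1 in \<open>auto intro!: continuous_intros\<close>)
    moreover have "{c0 - \<eta>..c0 + \<eta>} \<noteq> {}" using \<eta> by simp
    ultimately obtain k where k: "k \<in> {c0 - \<eta>..c0 + \<eta>}" "\<forall>k'\<in>{c0 - \<eta>..c0 + \<eta>}. Z (k, t1) \<le> Z (k', t1)"
      using continuous_attains_inf[of "{c0 - \<eta>..c0 + \<eta>}" "\<lambda>k. Z (k, t1)"] by auto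
    have "Z (k, t1) > 4 * pi\<^sup>2" using iso[OF k(1), of t1] t1 by (simp add: Z_def)
    then show ?thesis using that[of "Z (k, t1) - 4 * pi\<^sup>2"] k(2) by auto
  qed
  show "\<exists>V. openin moduli_space V \<and> conformal_class (Complex 0 b) \<in> V \<and> V \<subseteq> conformal_classes_of_family n U \<mu>"
  proof (rule rectangular_class_neighbourhood[OF b \<xi>, of "\<eta> / 2"])
    show "\<eta> / 2 > 0" using \<eta> by simp
    fix h l :: real
    assume l: "l > 0" and z: "4 * pi\<^sup>2 \<le> h\<^sup>2 + l\<^sup>2" "h\<^sup>2 + l\<^sup>2 \<le> 4 * pi\<^sup>2 + \<xi>" and hl: "\<bar>h / l - (b - 1/b) / 2\<bar> \<le> \<eta> / 2"
    have sub: "{c0 - \<eta>..c0 + \<eta>} \<times> {0..t1} \<subseteq> ?S" using t1 by auto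
    obtain k t where kt: "c0 - \<eta> \<le> k" "k \<le> c0 + \<eta>" "0 \<le> t" "t \<le> t1"
      and eq: "H (k, t) / L (k, t) - h / l = 0" "Z (k, t) - (h\<^sup>2 + l\<^sup>2) = 0"
    \<comment> \<open>The vertical edges control the ratio. On the lower edge the homogeneous tori
      give \<open>Z = 4 * pi\<^sup>2\<close>, and on the upper edge \<open>Z\<close> is at least
      \<open>4 * pi\<^sup>2 + \<xi>\<close>.\<close>
    proof (rule poincare_miranda[of "c0 - \<eta>" "c0 + \<eta>" 0 t1 "\<lambda>q. H q / L q - h / l" "\<lambda>q. Z q - (h\<^sup>2 + l\<^sup>2)"])
      show "c0 - \<eta> \<le> c0 + \<eta>" "0 \<le> t1" using \<eta> t1 by auto
      show "continuous_on ({c0 - \<eta>..c0 + \<eta>} \<times> {0..t1}) (\<lambda>q. H q / L q - h / l)"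
        "continuous_on ({c0 - \<eta>..c0 + \<eta>} \<times> {0..t1}) (\<lambda>q. Z q - (h\<^sup>2 + l\<^sup>2))"
        by (intro continuous_intros continuous_on_subset[OF cq sub] continuous_on_subset[OF cZ sub])+
      show "H (c0 - \<eta>, y) / L (c0 - \<eta>, y) - h / l \<le> 0 \<and> 0 \<le> H (c0 + \<eta>, y) / L (c0 + \<eta>, y) - h / l" if "0 \<le> y" "y \<le> t1" for y
      proof -
        have "\<bar>h / l - c0\<bar> \<le> \<eta> / 2" using hl by (simp only: c0_def)
        then have "h / l \<le> c0 + \<eta> / 2" "c0 - \<eta> / 2 \<le> h / l" by linarith+
        moreover have "y \<in> {0..t1}" using that by simp
        ultimately show ?thesis using side[of y] by fastforce
      qed
      show "Z (x, 0) - (h\<^sup>2 + l\<^sup>2) \<le> 0 \<and> 0 \<le> Z (x, t1) - (h\<^sup>2 + l\<^sup>2)" if "c0 - \<eta> \<le> x" "x \<le> c0 + \<eta>" for x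
        using at0(2)[of x] top[of x] that z by (auto simp: Z_def)
    qed
    have k: "k \<in> {c0 - \<eta>..c0 + \<eta>}" and t: "t \<in> {0..\<eta>}" using kt t1 by auto
    have "H (k, t) = h" "L (k, t) = l"
      using polar_coordinates_unique[OF Lpos l, of "(k, t)" "H (k, t)" h] eq k t by (simp_all add: Z_def)
    then show "conformal_class (Complex (1/2 + h / (4 * pi)) (l / (4 * pi))) \<in> conformal_classes_of_family n U \<mu>"
      using cls[OF k t] by simp
  qed
qed

end
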